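(* Let $\beta>0$ and $R>0$. If $\Theta\subset\mathcal{H}^\beta(R)$, then $$\Delta\big(\mathcal{E}_n^D(\Theta),\mathcal{E}_n^P(\Theta)\big)^2\lesssim n^{-\frac{2\beta}{2\beta+1}}\log^2 n\ \sup_{f\in\Theta}\int_0^1\Big(\frac1{f(x)}\wedge n^{\frac{\beta}{\beta+1}}\Big)^{\frac1{2\beta+1}}dx.$$
   Context: Notation: $a\wedge b=\min(a,b)$, $a\vee b=\max(a,b)$. For positive sequences, $a_n\lesssim b_n$ means there are a constant $C$ independent of $n$ and an $n_0\ge1$ with $a_n\le Cb_n$ for all $n\ge n_0$. The parameter space $\Theta=\Theta_n$ is allowed to depend on the sample size $n$; $\beta,R$ are fixed. Function spaces: $\lfloor\beta\rfloor$ denotes the largest integer strictly smaller than $\beta$. $|f|_{\mathcal{C}^\beta}:=\sup_{x\ne y,\,x,y\in[0,1]}|f^{(\lfloor\beta\rfloor)}(x)-f^{(\lfloor\beta\rfloor)}(y)|/|x-y|^{\beta-\lfloor\beta\rfloor}$ and $\|f\|_{\mathcal{C}^\beta}:=\|f\|_\infty+\|f^{(\lfloor\beta\rfloor)}\|_\infty+|f|_{\mathcal{C}^\beta}$. $\mathcal{C}^\beta(R)$ is the set of $f:[0,1]\to\mathbb{R}$ with $f\ge0$, $\int_0^1f=1$, $f^{(\lfloor\beta\rfloor)}$ exists and $\|f\|_{\mathcal{C}^\beta}\le R$. Set $|f|_{\mathcal{H}^\beta}:=\max_{1\le j<\beta}\big\||f^{(j)}|^\beta/|f|^{\beta-j}\big\|_\infty^{1/j}$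 ($j$ integer, $0/0:=0$, and $|f|_{\mathcal{H}^\beta}:=0$ for $\beta\le1$), $\|f\|_{\mathcal{H}^\beta}:=\|f\|_{\mathcal{C}^\beta}+|f|_{\mathcal{H}^\beta}$ and $\mathcal{H}^\beta(R):=\{f\in\mathcal{C}^\beta(R):\|f\|_{\mathcal{H}^\beta}\le R\}$. Experiments (indexed by $f\in\Theta$): $\mathcal{E}_n^D(\Theta)$: one observes $n$ i.i.d. random variables on $[0,1]$ with Lebesgue density $f$ (law $P_f^n$). $\mathcal{E}_n^P(\Theta)$: one observes a Poisson process on $[0,1]$ with intensity function $nf$ (law $\overline P_f^n$), equivalently $X_1,\dots,X_N$ with $X_i$ i.i.d. with density $f$ and $N\sim\mathrm{Poi}(n)$ independent. Le Cam deficiency and distance: for experiments $\mathcal{E}(\Theta)=(\Omega,\mathcal{A},(P_\theta)_{\theta\in\Theta})$ and $\mathcal{F}(\Theta)=(\Omega',\mathcal{A}',(Q_\theta)_{\theta\in\Theta})$ (dominated, on Polish spaces), $\delta(\mathcal{E}(\Theta),\mathcal{F}(\Theta)):=\inf_M\sup_{\theta\in\Theta}\|MP_\theta-Q_\theta\|_{\mathrm{TV}}$, infimum over all Markov kernels $M$ from $(\Omega,\mathcal{A})$ to $(\Omega',\mathcal{A}')$, and $\Delta(\mathcal{E},\mathcal{F}):=\delta(\mathcal{E},\mathcal{F})\vee\delta(\mathcal{F},\mathcal{E})$. Here $\|P-Q\|_{\mathrm{TV}}=\sup_A|P(A)-Q(A)|$. *)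

theory Defs
  imports "HOL-Probability.Probability"
begin

section \<open>Powers of extended nonnegative reals\<close>

definition ennreal_powr :: "ennreal \<Rightarrow> real \<Rightarrow> ennreal" where
  "ennreal_powr a p = (if a = \<infinity> then \<infinity> else ennreal (enn2real a powr p))"


section \<open>Function spaces on the unit interval\<close>

text \<open>
  Functions on the unit interval are represented by functions \<open>real \<Rightarrow> real\<close>; every definition
  below only depends on the values on \<open>{0..1}\<close>.
\<close>

text \<open>The largest integer \<^emph>\<open>strictly\<close> smaller than \<open>\<beta>\<close>, so this is not the library's \<open>floor\<close>.\<close>

definition strict_floor :: "real \<Rightarrow> nat" where
  "strict_floor \<beta> = nat (\<lceil>\<beta>\<rceil> - 1)"

lemma strict_floor_less: "0 < \<beta> \<Longrightarrow> real (strict_floor \<beta>) < \<beta>"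
  unfolding strict_floor_def by linarith

lemma le_strict_floor_iff: "0 < \<beta> \<Longrightarrow> k \<le> strict_floor \<beta> \<longleftrightarrow> real k < \<beta>"
  unfolding strict_floor_def by linarith

text \<open>Derivatives on \<open>{0..1}\<close>, one-sided at the two endpoints.\<close>

definition nth_deriv :: "nat \<Rightarrow> (real \<Rightarrow> real) \<Rightarrow> real \<Rightarrow> real" where
  "nth_deriv k f = ((\<lambda>g x. vector_derivative g (at x within {0..1})) ^^ k) f"

definition has_nth_deriv :: "nat \<Rightarrow> (real \<Rightarrow> real) \<Rightarrow> bool" where
  "has_nth_deriv k f \<longleftrightarrow> (\<forall>j<k. nth_deriv j f differentiable_on {0..1})"

definition sup_norm :: "(real \<Rightarrow> real) \<Rightarrow> ennreal" where
  "sup_norm f = (SUP x\<in>{0..1}. ennreal \<bar>f x\<bar>)"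

definition holder_seminorm :: "real \<Rightarrow> (real \<Rightarrow> real) \<Rightarrow> ennreal" where
  "holder_seminorm \<beta> f =
     (SUP (x, y) \<in> {(x, y). x \<in> {0..1} \<and> y \<in> {0..1} \<and> x \<noteq> y}.
        ennreal (\<bar>nth_deriv (strict_floor \<beta>) f x - nth_deriv (strict_floor \<beta>) f y\<bar>
                 / \<bar>x - y\<bar> powr (\<beta> - strict_floor \<beta>)))"

definition holder_norm :: "real \<Rightarrow> (real \<Rightarrow> real) \<Rightarrow> ennreal" where
  "holder_norm \<beta> f =
     sup_norm f + sup_norm (nth_deriv (strict_floor \<beta>) f) + holder_seminorm \<beta> f"

definition holder_densities :: "real \<Rightarrow> real \<Rightarrow> (real \<Rightarrow> real) set" where
  "holder_densities \<beta> R =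
     {f. (\<forall>x\<in>{0..1}. 0 \<le> f x) \<and> (LINT x:{0..1}|lborel. f x) = 1 \<and>
         has_nth_deriv (strict_floor \<beta>) f \<and> holder_norm \<beta> f \<le> ennreal R}"

text \<open>
  Division in \<open>ennreal\<close> satisfies \<open>0 / 0 = 0\<close> and \<open>a / 0 = \<infinity>\<close> for \<open>a \<noteq> 0\<close>, as required here.
  For \<open>\<beta> \<le> 1\<close> the supremum over \<open>j\<close> is over the empty set and hence \<open>0\<close>.
\<close>

definition flat_seminorm :: "real \<Rightarrow> (real \<Rightarrow> real) \<Rightarrow> ennreal" where
  "flat_seminorm \<beta> f =
     (SUP j \<in> {j::nat. 1 \<le> j \<and> real j < \<beta>}.
        ennreal_powr
          (SUP x\<in>{0..1}. ennreal (\<bar>nth_deriv j f x\<bar> powr \<beta>) / ennreal (\<bar>f x\<bar> powr (\<beta> - j)))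
          (1 / j))"

definition flat_norm :: "real \<Rightarrow> (real \<Rightarrow> real) \<Rightarrow> ennreal" where
  "flat_norm \<beta> f = holder_norm \<beta> f + flat_seminorm \<beta> f"

definition flat_densities :: "real \<Rightarrow> real \<Rightarrow> (real \<Rightarrow> real) set" where
  "flat_densities \<beta> R = {f \<in> holder_densities \<beta> R. flat_norm \<beta> f \<le> ennreal R}"


section \<open>Statistical experiments and the Le Cam distance\<close>

text \<open>
  The parameter set \<open>\<Theta>\<close> is passed separately; an experiment is meaningful on \<open>\<Theta>\<close> if
  \<open>law E \<theta> \<in> space (prob_algebra (sample_space E))\<close> for all \<open>\<theta> \<in> \<Theta>\<close>.
\<close>

record ('p, 'a) stat_experiment =
  sample_space :: "'a measure"
  law :: "'p \<Rightarrow> 'a measure"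

definition tv_dist :: "'a measure \<Rightarrow> 'a measure \<Rightarrow> ennreal" where
  "tv_dist P Q = (SUP A\<in>sets P. ennreal \<bar>measure P A - measure Q A\<bar>)"

text \<open>
  Markov kernels are the measurable maps into \<open>prob_algebra\<close>; the image \<open>K P\<close> of a law \<open>P\<close> under a
  kernel \<open>K\<close> is \<open>P \<bind> K\<close>.
\<close>

definition deficiency ::
    "'p set \<Rightarrow> ('p, 'a) stat_experiment \<Rightarrow> ('p, 'b) stat_experiment \<Rightarrow> ennreal" where
  "deficiency \<Theta> E F =
     (INF K \<in> sample_space E \<rightarrow>\<^sub>M prob_algebra (sample_space F).
        SUP \<theta>\<in>\<Theta>. tv_dist (law E \<theta> \<bind> K) (law F \<theta>))"

definition le_cam_dist ::
    "'p set \<Rightarrow> ('p, 'a) stat_experiment \<Rightarrow> ('p, 'b) stat_experiment \<Rightarrow> ennreal" where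
  "le_cam_dist \<Theta> E F = max (deficiency \<Theta> E F) (deficiency \<Theta> F E)"


section \<open>Density estimation and Poisson intensity estimation\<close>

abbreviation unit_borel :: "real measure" where
  "unit_borel \<equiv> restrict_space borel {0..1}"

definition density_law :: "(real \<Rightarrow> real) \<Rightarrow> real measure" where
  "density_law f = density (restrict_space lborel {0..1}) (\<lambda>x. ennreal (f x))"

definition iid_law :: "nat \<Rightarrow> (real \<Rightarrow> real) \<Rightarrow> (nat \<Rightarrow> real) measure" where
  "iid_law n f = Pi\<^sub>M {..<n} (\<lambda>_. density_law f)"

definition density_experiment :: "nat \<Rightarrow> (real \<Rightarrow> real, nat \<Rightarrow> real) stat_experiment" where
  "density_experiment n =
     \<lparr> sample_space = Pi\<^sub>M {..<n} (\<lambda>_. unit_borel), law = iid_law n \<rparr>"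

text \<open>
  A realisation of a finite point process is the finite multiset of its points (equivalently, a
  finite counting measure), and the \<open>\<sigma>\<close>-algebra is generated by the numbers of points in Borel
  sets.
\<close>

definition point_configs :: "real multiset measure" where
  "point_configs =
     sigma {X. set_mset X \<subseteq> {0..1}}
       {{X. set_mset X \<subseteq> {0..1} \<and> size (filter_mset (\<lambda>x. x \<in> B) X) = k} | B k.
          B \<in> sets unit_borel}"

definition points :: "nat \<Rightarrow> (nat \<Rightarrow> real) \<Rightarrow> real multiset" where
  "points k x = image_mset x (mset_set {..<k})"

text \<open>
  For a probability density \<open>f\<close>, the Poisson process with intensity function \<open>n f\<close> is the point
  process of \<open>N\<close> independent points with density \<open>f\<close>, where \<open>N\<close> is Poisson with parameter \<open>n\<close>
  and independent of the points. (\<open>poisson_pmf\<close> is only specified for positive parameters.)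
\<close>

definition poisson_process_law :: "nat \<Rightarrow> (real \<Rightarrow> real) \<Rightarrow> real multiset measure" where
  "poisson_process_law n f =
     measure_pmf (poisson_pmf (real n)) \<bind> (\<lambda>k. distr (iid_law k f) point_configs (points k))"

definition poisson_experiment :: "nat \<Rightarrow> (real \<Rightarrow> real, real multiset) stat_experiment" where
  "poisson_experiment n =
     \<lparr> sample_space = point_configs, law = poisson_process_law n \<rparr>"


subsection \<open>Well-definedness of the two experiments\<close>

lemma holder_seminorm_imp_continuous:
  assumes "0 < \<beta>" and "holder_seminorm \<beta> f < \<infinity>"
  shows "continuous_on {0..1} (nth_deriv (strict_floor \<beta>) f)"
proof -
  let ?g = "nth_deriv (strict_floor \<beta>) f"
  define a where "a = \<beta> - strict_floor \<beta>"
  have a: "0 < a" using strict_floor_less[OF assms(1)] by (simp add: a_def)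
  obtain C where C: "holder_seminorm \<beta> f = ennreal C" "0 \<le> C"
    using assms(2) by (cases "holder_seminorm \<beta> f") auto
  have bound: "\<bar>?g x - ?g y\<bar> \<le> C * \<bar>x - y\<bar> powr a" if "x \<in> {0..1}" "y \<in> {0..1}" for x y
  proof (cases "x = y")
    case False
    have "ennreal (\<bar>?g x - ?g y\<bar> / \<bar>x - y\<bar> powr a) \<le> holder_seminorm \<beta> f"
      unfolding holder_seminorm_def a_def
      using that False
      by (intro SUP_upper2[of "(x, y)"]) auto
    then have "\<bar>?g x - ?g y\<bar> / \<bar>x - y\<bar> powr a \<le> C"
      using C by simp
    then show ?thesis using False by (simp add: field_simps)
  qed simp
  show ?thesis
    unfolding continuous_on_def
  proof
    fix x :: real assume x: "x \<in> {0..1}"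
    have "((\<lambda>y. C * \<bar>y - x\<bar> powr a) \<longlongrightarrow> C * \<bar>x - x\<bar> powr a) (at x within {0..1})"
      by (intro tendsto_intros tendsto_powr') (use a in auto)
    then have "((\<lambda>y. C * \<bar>y - x\<bar> powr a) \<longlongrightarrow> 0) (at x within {0..1})"
      by simp
    then have "((\<lambda>y. ?g y - ?g x) \<longlongrightarrow> 0) (at x within {0..1})"
      by (rule Lim_null_comparison[rotated])
         (use x bound in \<open>auto simp: eventually_at_filter\<close>)
    then show "(?g \<longlongrightarrow> ?g x) (at x within {0..1})"
      by (simp add: LIM_zero_iff)
  qed
qed

lemma holder_densities_continuous:
  assumes "0 < \<beta>" and "f \<in> holder_densities \<beta> R"
  shows "continuous_on {0..1} f"
proof (cases "strict_floor \<beta> = 0")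
  case True
  have "holder_norm \<beta> f < \<infinity>"
    using assms(2) by (auto simp: holder_densities_def intro: le_less_trans)
  then have "holder_seminorm \<beta> f < \<infinity>"
    by (auto simp: holder_norm_def)
  from holder_seminorm_imp_continuous[OF assms(1) this] True show ?thesis
    by (simp add: nth_deriv_def)
next
  case False
  then have "nth_deriv 0 f differentiable_on {0..1}"
    using assms(2) by (auto simp: holder_densities_def has_nth_deriv_def)
  then show ?thesis
    by (simp add: nth_deriv_def differentiable_imp_continuous_on)
qed

lemma density_law_in_prob_algebra:
  assumes "0 < \<beta>" and f: "f \<in> holder_densities \<beta> R"
  shows "density_law f \<in> space (prob_algebra unit_borel)"
proof -
  have cont: "continuous_on {0..1} f"
    by (rule holder_densities_continuous[OF assms])
  have meas: "f \<in> borel_measurable (restrict_space lborel {0..1})"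
    using borel_measurable_continuous_on_restrict[OF cont]
    by (simp cong: measurable_cong_sets sets_restrict_space_cong)
  have int: "set_integrable lborel {0..1} f"
    by (rule borel_integrable_atLeastAtMost') (rule cont)
  have "{0..1::real} \<in> sets (restrict_space lborel {0..1})"
    by (auto simp: sets_restrict_space intro: image_eqI[of _ _ "{0..1}"])
  then have "emeasure (density_law f) (space (density_law f)) =
      (\<integral>\<^sup>+x. ennreal (f x) \<partial>restrict_space lborel {0..1})"
    unfolding density_law_def using meas
    by (auto simp: emeasure_density space_restrict_space intro!: nn_integral_cong)
  also have "\<dots> = (\<integral>\<^sup>+x. ennreal (indicator {0..1} x *\<^sub>R f x) \<partial>lborel)"
    by (subst nn_integral_restrict_space)
       (auto intro!: nn_integral_cong simp: indicator_def)
  also have "\<dots> = ennreal (LINT x:{0..1}|lborel. f x)"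
    unfolding set_lebesgue_integral_def
    using int f
    by (intro nn_integral_eq_integral)
       (auto simp: set_integrable_def holder_densities_def indicator_def)
  also have "\<dots> = 1"
    using f by (simp add: holder_densities_def)
  finally have "prob_space (density_law f)"
    by (rule prob_spaceI)
  then show ?thesis
    by (auto simp: space_prob_algebra density_law_def cong: sets_restrict_space_cong)
qed

lemma iid_law_in_prob_algebra:
  assumes "0 < \<beta>" and "f \<in> holder_densities \<beta> R"
  shows "iid_law n f \<in> space (prob_algebra (Pi\<^sub>M {..<n} (\<lambda>_. unit_borel)))"
proof -
  from density_law_in_prob_algebra[OF assms]
  have P: "prob_space (density_law f)" and S: "sets (density_law f) = sets unit_borel"
    by (auto simp: space_prob_algebra)
  show ?thesis
    unfolding iid_law_def space_prob_algebra
  proof (intro CollectI conjI)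
    show "sets (Pi\<^sub>M {..<n} (\<lambda>_. density_law f)) = sets (Pi\<^sub>M {..<n} (\<lambda>_. unit_borel))"
      using S by (intro sets_PiM_cong) auto
    show "prob_space (Pi\<^sub>M {..<n} (\<lambda>_. density_law f))"
      using P by (rule prob_space_PiM)
  qed
qed

lemma points_measurable: "points k \<in> Pi\<^sub>M {..<k} (\<lambda>_. unit_borel) \<rightarrow>\<^sub>M point_configs"
proof -
  let ?P = "Pi\<^sub>M {..<k} (\<lambda>_. unit_borel)"
  have range: "set_mset (points k x) \<subseteq> {0..1}" if x: "x \<in> space ?P" for x
  proof -
    have "x i \<in> {0..1}" if "i < k" for i
      using PiE_mem[of x "{..<k}" "\<lambda>_. {0..1}" i] x that
      unfolding space_PiM space_restrict_space by simp
    then show ?thesis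
      unfolding points_def by auto
  qed
  show ?thesis
    unfolding point_configs_def
  proof (rule measurable_measure_of)
    show "points k \<in> space ?P \<rightarrow> {X. set_mset X \<subseteq> {0..1}}"
      using range by blast
  next
    fix A :: "real multiset set"
    assume "A \<in> {{X. set_mset X \<subseteq> {0..1} \<and> size (filter_mset (\<lambda>x. x \<in> B) X) = m} | B m.
                   B \<in> sets unit_borel}"
    then obtain B m where B: "B \<in> sets unit_borel"
      and A: "A = {X. set_mset X \<subseteq> {0..1} \<and> size (filter_mset (\<lambda>x. x \<in> B) X) = m}"
      by blast
    have size: "size (filter_mset (\<lambda>y. y \<in> B) (points k x)) = (\<Sum>i<k. indicator B (x i))" for x
      by (induction k) (simp_all add: points_def lessThan_Suc)
    have "(\<lambda>x. indicator B (x i) :: nat) \<in> borel_measurable ?P" if "i < k" for i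
      by (rule measurable_compose[OF measurable_component_singleton borel_measurable_indicator])
         (use that B in auto)
    then have "(\<lambda>x. \<Sum>i<k. indicator B (x i) :: nat) \<in> borel_measurable ?P"
      by (intro borel_measurable_sum) auto
    then have *: "(\<lambda>x. \<Sum>i<k. indicator B (x i) :: nat) -` {m} \<inter> space ?P \<in> sets ?P"
      by (rule measurable_sets) simp
    have "points k -` A \<inter> space ?P = (\<lambda>x. \<Sum>i<k. indicator B (x i) :: nat) -` {m} \<inter> space ?P"
      unfolding A using range by (auto simp: size)
    also note *
    finally show "points k -` A \<inter> space ?P \<in> sets ?P" .
  qed auto
qed

lemma poisson_process_law_in_prob_algebra:
  assumes "0 < \<beta>" and "f \<in> holder_densities \<beta> R"
  shows "poisson_process_law n f \<in> space (prob_algebra point_configs)"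
proof -
  have K: "(\<lambda>k. distr (iid_law k f) point_configs (points k)) \<in>
          count_space UNIV \<rightarrow>\<^sub>M prob_algebra point_configs"
  proof -
    have "distr (iid_law k f) point_configs (points k) \<in> space (prob_algebra point_configs)" for k
    proof -
      from iid_law_in_prob_algebra[OF assms, of k]
      have "prob_space (iid_law k f)"
        and S: "sets (iid_law k f) = sets (Pi\<^sub>M {..<k} (\<lambda>_. unit_borel))"
        by (auto simp: space_prob_algebra)
      moreover have "points k \<in> iid_law k f \<rightarrow>\<^sub>M point_configs"
        using points_measurable S by (simp cong: measurable_cong_sets)
      ultimately show ?thesis
        by (simp add: space_prob_algebra prob_space.prob_space_distr)
    qed
    then show ?thesis by simp
  qed
  have P: "measure_pmf (poisson_pmf (real n)) \<in> space (prob_algebra (count_space UNIV))"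
    by (simp add: space_prob_algebra prob_space_measure_pmf)
  show ?thesis
    unfolding poisson_process_law_def space_prob_algebra
    using prob_space_bind'[OF P K] sets_bind'[OF P K] by simp
qed

end

theory Submission
  imports Defs "HOL-Combinatorics.Multiset_Permutations" "HOL-Real_Asymp.Real_Asymp"
begin

text \<open>
  Both experiments are iid samples; only the sample size differs, by about \<open>sqrt n\<close>. Surplus
  observations are thrown away. A missing observation is drawn from an estimator \<open>g\<close> of \<open>f\<close> built from the
  first \<open>n / 4\<close> observations and is inserted at a uniformly random position among the other ones.
  Averaging over the position turns the density ratio of the new sample into a mean of about \<open>n\<close>
  uncorrelated terms, so one insertion costs \<open>sqrt (\<chi>\<^sup>2(g, f) / n)\<close> in total variation (up to
  constants), and by the triangle inequality all of them cost \<open>sqrt (\<chi>\<^sup>2(g, f))\<close>.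

  The estimator is any element of the parameter set whose masses on the intervals with end points in
  \<open>{0, 1/n, \<dots>, 1}\<close> are compatible with the observed counts. By a Chernoff bound and a union bound \<open>f\<close> itself is
  compatible with high probability, so that \<open>f\<close> and \<open>g\<close> have similar masses. Where
  \<open>v = max (f x) (g x)\<close> is not too small, flatness bounds both densities by a multiple of \<open>v\<close> on an
  interval of length \<open>h = (v ln\<^sup>2 n / n) powr (1 / (2 \<beta> + 1))\<close> around \<open>x\<close>, and interpolation of the Taylor polynomial of
  \<open>f - g\<close> gives \<open>\<bar>f x - g x\<bar> \<le> C h powr \<beta>\<close>. Cutting \<open>g\<close> off where it is small makes \<open>\<chi>\<^sup>2(g, f)\<close> finite and bounds it
  by the integrals of the rate at \<open>f\<close> and at \<open>g\<close>; as \<open>g\<close> also lies in the parameter set, both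
  are bounded by the supremum.
\<close>

text \<open>The number of insertions is of order sqrt n, the standard deviation of the Poisson size.
  A point appended at a known place would cost about the square root of the chi-square divergence
  each time, too much by a factor sqrt n; hence the random position. The observations read by the
  estimator stay in place and insertions happen behind them: given these observations the density
  ratio is fixed and the other points are still iid. The same kernels serve both directions, with n
  as initial or as final size; a sample of fewer than about n / 2 points need not be extended well,
  since the claimed error then exceeds 1. A point configuration has lost its order, and a uniformly
  random one replaces it. Choosing the estimator inside the parameter set gives it the flatness of f
  for free, and the choice is measurable because the counts take finitely many values. Since
  densities may vanish, the comparison must be local: a tolerance growing with the root of the mass
  of an interval makes the error at x depend on the size of the densities there. The logarithm pays
  for a union bound over about n^2 intervals.\<close>

abbreviation laws :: "'a measure \<Rightarrow> 'a measure set" where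
  "laws M \<equiv> space (prob_algebra M)"

abbreviation kernels :: "'a measure \<Rightarrow> 'b measure \<Rightarrow> ('a \<Rightarrow> 'b measure) set" where
  "kernels M N \<equiv> M \<rightarrow>\<^sub>M prob_algebra N"

abbreviation Fam :: "'i set \<Rightarrow> 'a measure \<Rightarrow> ('i \<Rightarrow> 'a) measure" where
  "Fam I M \<equiv> Pi\<^sub>M I (\<lambda>_. M)"

abbreviation Seq :: "nat \<Rightarrow> 'a measure \<Rightarrow> (nat \<Rightarrow> 'a) measure" where
  "Seq k M \<equiv> Pi\<^sub>M {..<k} (\<lambda>_. M)"

section \<open>Total variation bounds through test functions\<close>

text \<open>One-sided, since passing from \<open>h\<close> to \<open>1 - h\<close> reverses the inequality for probability measures.\<close>

definition tv_le :: "ennreal \<Rightarrow> 'a measure \<Rightarrow> 'a measure \<Rightarrow> bool" where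
  "tv_le e P Q \<longleftrightarrow>
     (\<forall>h\<in>borel_measurable P. (\<forall>x. h x \<le> 1) \<longrightarrow> (integral\<^sup>N P h) \<le> (integral\<^sup>N Q h) + e)"

lemma tv_leI:
  assumes "\<And>h. h \<in> borel_measurable P \<Longrightarrow> (\<And>x. h x \<le> 1) \<Longrightarrow> (integral\<^sup>N P h) \<le> (integral\<^sup>N Q h) + e"
  shows "tv_le e P Q"
  using assms unfolding tv_le_def by blast

lemma tv_leD:
  assumes "tv_le e P Q" "h \<in> borel_measurable P" "\<And>x. h x \<le> 1"
  shows "(integral\<^sup>N P h) \<le> (integral\<^sup>N Q h) + e"
  using assms unfolding tv_le_def by blast

lemma tv_le_refl: "tv_le 0 P P"
  by (auto intro: tv_leI)

lemma tv_le_mono: "tv_le e P Q \<Longrightarrow> e \<le> e' \<Longrightarrow> tv_le e' P Q"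
  unfolding tv_le_def by (meson add_left_mono order_trans)

lemma tv_le_trans:
  assumes "tv_le e P Q" "tv_le e' Q R" "sets P = sets Q"
  shows "tv_le (e + e') P R"
proof (rule tv_leI)
  fix h :: "'a \<Rightarrow> ennreal" assume h: "h \<in> borel_measurable P" "\<And>x. h x \<le> 1"
  have h': "h \<in> borel_measurable Q"
    using h(1) assms(3) by (simp cong: measurable_cong_sets)
  have "(integral\<^sup>N P h) \<le> (integral\<^sup>N Q h) + e"
    by (rule tv_leD[OF assms(1) h])
  also have "\<dots> \<le> (integral\<^sup>N R h) + e' + e"
    by (intro add_right_mono tv_leD[OF assms(2) h' h(2)])
  finally show "(integral\<^sup>N P h) \<le> (integral\<^sup>N R h) + (e + e')"
    by (simp add: ac_simps)
qed

lemma nn_integral_le_1_law: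
  assumes "P \<in> laws M" "\<And>x. h x \<le> 1"
  shows "(integral\<^sup>N P h) \<le> 1"
proof -
  interpret prob_space P using assms(1) by (simp add: space_prob_algebra)
  have "(integral\<^sup>N P h) \<le> (\<integral>\<^sup>+x. 1 \<partial>P)"
    by (rule nn_integral_mono) (use assms in auto)
  then show ?thesis by (simp add: emeasure_space_1)
qed

lemma tv_le_1:
  assumes "P \<in> laws M" "1 \<le> e"
  shows "tv_le e P Q"
  using nn_integral_le_1_law[OF assms(1)] assms(2)
  by (intro tv_leI) (meson add_increasing order_trans zero_le)

lemma nn_integral_bind_law:
  assumes P: "P \<in> laws M" and K: "K \<in> kernels M N"
    and h: "h \<in> borel_measurable N"
  shows "(integral\<^sup>N (P \<bind> K) h) = (\<integral>\<^sup>+x. \<integral>\<^sup>+y. h y \<partial>K x \<partial>P)"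
proof (rule nn_integral_bind[OF h])
  have "sets P = sets M" using P by (simp add: space_prob_algebra)
  then show "K \<in> P \<rightarrow>\<^sub>M subprob_algebra N"
    using measurable_prob_algebraD[OF K] by (simp cong: measurable_cong_sets)
qed

lemma bind_law:
  assumes "P \<in> laws M" "K \<in> kernels M N"
  shows "P \<bind> K \<in> laws N"
  using measurable_space[OF measurable_bind_prob_space[OF measurable_const[OF assms(1), of "count_space UNIV"] assms(2)]]
  by simp

lemma sets_law: "P \<in> laws M \<Longrightarrow> sets P = sets M"
  by (simp add: space_prob_algebra)

lemma tv_le_bind:
  assumes PQ: "tv_le e P Q" and P: "P \<in> laws M" and Q: "Q \<in> laws M"
    and K: "K \<in> kernels M N"
  shows "tv_le e (P \<bind> K) (Q \<bind> K)"
proof (rule tv_leI)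
  fix h :: "'b \<Rightarrow> ennreal" assume h: "h \<in> borel_measurable (P \<bind> K)" "\<And>x. h x \<le> 1"
  have hN: "h \<in> borel_measurable N"
    using h(1) sets_law[OF bind_law[OF P K]]
    by (simp cong: measurable_cong_sets)
  \<comment> \<open>\<open>tv_le\<close> asks for the bound by 1 at every point of the type, while
    \<open>K\<close> is controlled only on \<open>space M\<close>; the value 0 elsewhere changes
    neither integral.\<close>
  define H where "H x = (if x \<in> space M then \<integral>\<^sup>+y. h y \<partial>K x else 0)" for x
  have sp: "space P = space M" "space Q = space M"
    using sets_eq_imp_space_eq[OF sets_law[OF P]]
      sets_eq_imp_space_eq[OF sets_law[OF Q]] by auto
  have "H \<in> borel_measurable M"
    unfolding H_def
    by (rule measurable_cong[THEN iffD1, OF _ measurable_compose[OF measurable_prob_algebraD[OF K]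
          nn_integral_measurable_subprob_algebra[OF hN]]]) auto
  then have "H \<in> borel_measurable P"
    using sets_law[OF P] by (simp cong: measurable_cong_sets)
  moreover have "H x \<le> 1" for x
    unfolding H_def using nn_integral_le_1_law[OF measurable_space[OF K] h(2), of x] by auto
  ultimately have "(integral\<^sup>N P H) \<le> (integral\<^sup>N Q H) + e"
    by (rule tv_leD[OF PQ])
  moreover have "(integral\<^sup>N P H) = (integral\<^sup>N (P \<bind> K) h)"
    unfolding nn_integral_bind_law[OF P K hN]
    by (rule nn_integral_cong) (simp add: H_def sp)
  moreover have "(integral\<^sup>N Q H) = (integral\<^sup>N (Q \<bind> K) h)"
    unfolding nn_integral_bind_law[OF Q K hN]
    by (rule nn_integral_cong) (simp add: H_def sp)
  ultimately show "(integral\<^sup>N (P \<bind> K) h) \<le> (integral\<^sup>N (Q \<bind> K) h) + e" by simp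
qed

lemma pmf_law: "measure_pmf q \<in> laws (count_space UNIV)"
  by (simp add: space_prob_algebra prob_space_measure_pmf)

lemma tv_le_imp_tv_dist_le:
  assumes PQ: "tv_le e P Q" and P: "P \<in> laws M" and Q: "Q \<in> laws M"
  shows "tv_dist P Q \<le> e"
  unfolding tv_dist_def
proof (rule SUP_least)
  fix A assume A: "A \<in> sets P"
  interpret P: prob_space P using P by (simp add: space_prob_algebra)
  interpret Q: prob_space Q using Q by (simp add: space_prob_algebra)
  have S: "sets P = sets Q" using P Q by (simp add: space_prob_algebra)
  have *: "ennreal (measure P B) \<le> ennreal (measure Q B) + e" if "B \<in> sets P" for B
  proof -
    have "(\<integral>\<^sup>+x. indicator B x \<partial>P) \<le> (\<integral>\<^sup>+x. indicator B x \<partial>Q) + e"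
      using that by (intro tv_leD[OF PQ]) (auto simp: indicator_def)
    then show ?thesis
      using that S by (simp add: P.emeasure_eq_measure Q.emeasure_eq_measure)
  qed
  have c: "measure P (space P - A) = 1 - measure P A" "measure Q (space P - A) = 1 - measure Q A"
    using P.prob_compl[OF A] Q.prob_compl[of A] A S sets_eq_imp_space_eq[OF S] by auto
  show "ennreal \<bar>measure P A - measure Q A\<bar> \<le> e"
  proof (cases e)
    case (real r)
    have "measure P A \<le> measure Q A + r"
      using *[OF A] real by (simp flip: ennreal_plus)
    moreover have "1 - measure P A \<le> 1 - measure Q A + r"
      using *[of "space P - A"] A real unfolding c by (simp flip: ennreal_plus)
    ultimately show ?thesis using real by (auto simp: abs_if)
  qed simp
qed

text \<open>The countable index reduces joint measurability to that of each
  \<open>\<kappa> p\<close>. Random positions, random sample sizes and random orders all enter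
  through this lemma.\<close>

lemma measurable_bind_pmf_kernel:
  fixes q :: "'b :: countable pmf"
  assumes "\<And>p. \<kappa> p \<in> kernels M N"
  shows "(\<lambda>x. measure_pmf q \<bind> (\<lambda>p. \<kappa> p x)) \<in> kernels M N"
proof (rule measurable_bind_prob_space2[where N="count_space UNIV"])
  show "(\<lambda>x. measure_pmf q) \<in> kernels M (count_space UNIV)"
    by (simp add: pmf_law)
  show "(\<lambda>(x, p). \<kappa> p x) \<in> kernels (M \<Otimes>\<^sub>M count_space UNIV) N"
    by (rule measurable_compose_countable[where g=snd]) (use assms in \<open>simp_all add: case_prod_beta\<close>)
qed

section \<open>Inserting one point at a random position\<close>

abbreviation flip :: "'a \<Rightarrow> 'a \<Rightarrow> 'a \<Rightarrow> 'a" where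
  "flip \<equiv> Transposition.transpose"

section \<open>Exchangeability of iid families\<close>

lemma nn_integral_PiM_reindex:
  assumes \<mu>: "prob_space \<mu>" and t: "inj_on t I" "t \<in> I \<rightarrow> I"
    and F: "F \<in> borel_measurable (Fam I \<mu>)"
  shows "(\<integral>\<^sup>+w. F (\<lambda>i\<in>I. w (t i)) \<partial>Fam I \<mu>) = (\<integral>\<^sup>+w. F w \<partial>Fam I \<mu>)"
proof -
  let ?P = "Fam I \<mu>"
  have m: "(\<lambda>w. \<lambda>i\<in>I. w (t i)) \<in> ?P \<rightarrow>\<^sub>M ?P"
    using t by (intro measurable_restrict measurable_component_singleton) auto
  show ?thesis
    using nn_integral_distr[OF m, of F] F distr_PiM_reindex[OF \<mu> t] by simp
qed

lemma restrict_comp_transpose: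
  assumes "w \<in> space (Pi\<^sub>M I M)" "i \<in> I" "j \<in> I"
  shows "(\<lambda>n\<in>I. w (flip i j n)) = w \<circ> flip i j"
  using assms by (intro ext) (auto simp: space_PiM PiE_def extensional_def restrict_def Transposition.transpose_def)

lemma nn_integral_PiM_transpose:
  assumes "prob_space \<mu>" and I: "i \<in> I" "j \<in> I" and "F \<in> borel_measurable (Fam I \<mu>)"
  shows "(\<integral>\<^sup>+w. F (w \<circ> flip i j) \<partial>Fam I \<mu>) = (\<integral>\<^sup>+w. F w \<partial>Fam I \<mu>)"
proof -
  have "flip i j \<in> I \<rightarrow> I" using I by (auto simp: Transposition.transpose_def)
  from nn_integral_PiM_reindex[OF assms(1) inj_on_transpose this assms(4)] show ?thesis
    by (simp add: restrict_comp_transpose[OF _ I] cong: nn_integral_cong)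
qed

lemma sets_PiM_law:
  "P \<in> laws S \<Longrightarrow> sets (Fam I P) = sets (Fam I S)"
  by (rule sets_PiM_cong) (auto simp: sets_law)

lemma PiM_law:
  "P \<in> laws S \<Longrightarrow> Fam I P \<in> laws (Fam I S)"
  using sets_PiM_law[of P S I] by (auto simp: space_prob_algebra intro!: prob_space_PiM)

text \<open>This is nonnegativity of the variance of |X|.\<close>

lemma (in prob_space) expectation_abs_le_sqrt:
  fixes X :: "'a \<Rightarrow> real"
  assumes X: "X \<in> borel_measurable M" "integrable M (\<lambda>x. (X x)\<^sup>2)"
  shows "integrable M (\<lambda>x. \<bar>X x\<bar>)" "expectation (\<lambda>x. \<bar>X x\<bar>) \<le> sqrt (expectation (\<lambda>x. (X x)\<^sup>2))"
proof -
  show ia: "integrable M (\<lambda>x. \<bar>X x\<bar>)"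
    using square_integrable_imp_integrable[OF X] by (rule integrable_abs)
  have "(expectation (\<lambda>x. \<bar>X x\<bar>))\<^sup>2 \<le> expectation (\<lambda>x. (X x)\<^sup>2)"
    using variance_positive[of "\<lambda>x. \<bar>X x\<bar>"] variance_eq[OF ia] X(2) by simp
  then show "expectation (\<lambda>x. \<bar>X x\<bar>) \<le> sqrt (expectation (\<lambda>x. (X x)\<^sup>2))"
    by (rule real_le_rsqrt)
qed

text \<open>Independent centred summands have vanishing cross terms, so the second moment of their
  mean is the variance divided by \<open>card I\<close>. This division is the gain from the random
  position. The bound \<open>B\<close> serves integrability and does not enter the estimate.\<close>

lemma nn_integral_mean_abs_le:
  fixes \<mu> :: "'a measure" and \<phi> :: "'a \<Rightarrow> real"
  assumes \<mu>: "prob_space \<mu>" and I: "finite I" "I \<noteq> {}"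
    and \<phi>[measurable]: "\<phi> \<in> borel_measurable \<mu>" and bnd: "\<And>x. \<bar>\<phi> x\<bar> \<le> B"
    and mean: "(\<integral>x. \<phi> x \<partial>\<mu>) = 0" and var: "(\<integral>x. (\<phi> x)\<^sup>2 \<partial>\<mu>) \<le> v"
  shows "(\<integral>\<^sup>+w. ennreal \<bar>(\<Sum>p\<in>I. \<phi> (w p)) / card I\<bar> \<partial>Fam I \<mu>) \<le> ennreal (sqrt (v / card I))"
proof -
  let ?P = "Fam I \<mu>"
  interpret \<mu>: prob_space \<mu> by fact
  interpret PP: product_sigma_finite "\<lambda>_. \<mu>" ..
  interpret P: prob_space ?P by (rule prob_space_PiM) (rule \<mu>)
  have B: "0 \<le> B" using bnd[of undefined] by linarith
  have comp[measurable]: "(\<lambda>w. \<phi> (w p)) \<in> borel_measurable ?P" if "p \<in> I" for p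
    using that by measurable
  have int: "integrable ?P (\<lambda>w. \<phi> (w p) * \<phi> (w q))" if "p \<in> I" "q \<in> I" for p q
  proof (rule P.integrable_const_bound[of _ "B * B"])
    have "\<bar>\<phi> (w p)\<bar> * \<bar>\<phi> (w q)\<bar> \<le> B * B" for w
      using bnd B by (intro mult_mono) auto
    then show "AE w in ?P. norm (\<phi> (w p) * \<phi> (w q)) \<le> B * B"
      by (simp add: abs_mult)
    show "(\<lambda>w. \<phi> (w p) * \<phi> (w q)) \<in> borel_measurable ?P"
      using that by measurable
  qed
  have dc: "(\<integral>w. F (w p) \<partial>?P) = (\<integral>x. F x \<partial>\<mu>)" if "p \<in> I" "F \<in> borel_measurable \<mu>" for p and F :: "'a \<Rightarrow> real"
  proof -
    have "(\<integral>x. F x \<partial>\<mu>) = (\<integral>x. F x \<partial>distr ?P \<mu> (\<lambda>w. w p))"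
      by (subst distr_PiM_component) (use that \<mu> in auto)
    also have "\<dots> = (\<integral>w. F (w p) \<partial>?P)"
      by (rule integral_distr) (use that in auto)
    finally show ?thesis ..
  qed
  have cross: "(\<integral>w. \<phi> (w p) * \<phi> (w q) \<partial>?P) = (if p = q then \<integral>x. (\<phi> x)\<^sup>2 \<partial>\<mu> else 0)"
    if pq: "p \<in> I" "q \<in> I" for p q
  proof (cases "p = q")
    case True
    then show ?thesis using dc[OF pq(1), of "\<lambda>x. \<phi> x * \<phi> x"] by (simp add: power2_eq_square)
  next
    case False
    \<comment> \<open>Filling up with the constant 1 lets the product formula over all of
      \<open>I\<close> compute the expectation of the two factors at p and q.\<close>
    define f where "f i = (if i = p \<or> i = q then \<phi> else (\<lambda>_. 1))" for i
    have "(\<integral>w. (\<Prod>i\<in>I. f i (w i)) \<partial>?P) = (\<Prod>i\<in>I. \<integral>x. f i x \<partial>\<mu>)"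
    proof (rule PP.product_integral_prod[OF I(1)])
      fix i show "integrable \<mu> (f i)"
        unfolding f_def using bnd by (auto intro!: \<mu>.integrable_const_bound[of _ B])
    qed
    moreover have "(\<Prod>i\<in>I. \<integral>x. f i x \<partial>\<mu>) = 0"
      using I(1) pq(1) mean by (auto simp: f_def intro!: prod_zero bexI[of _ p])
    moreover have "(\<Prod>i\<in>I. f i (w i)) = \<phi> (w p) * \<phi> (w q)" for w
    proof -
      have "(\<Prod>i\<in>I. f i (w i)) = (\<Prod>i\<in>{p, q}. f i (w i))"
        using I(1) pq by (intro prod.mono_neutral_right) (auto simp: f_def)
      then show ?thesis using False by (simp add: f_def)
    qed
    ultimately show ?thesis using False by simp
  qed
  let ?S = "\<lambda>w. (\<Sum>p\<in>I. \<phi> (w p)) / card I"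
  have sq: "(?S w)\<^sup>2 = (\<Sum>p\<in>I. \<Sum>q\<in>I. \<phi> (w p) * \<phi> (w q)) / (card I)\<^sup>2" for w
    by (simp add: power2_eq_square sum_product)
  have "integrable ?P (\<lambda>w. (?S w)\<^sup>2)"
    unfolding sq using int by (intro integrable_divide integrable_sum) auto
  moreover have [measurable]: "?S \<in> borel_measurable ?P" by measurable
  ultimately have ES: "(\<integral>w. (?S w)\<^sup>2 \<partial>?P) = (\<Sum>p\<in>I. \<Sum>q\<in>I. \<integral>w. \<phi> (w p) * \<phi> (w q) \<partial>?P) / (card I)\<^sup>2"
    and iS: "integrable ?P (\<lambda>w. (?S w)\<^sup>2)"
    unfolding sq using int by (simp_all add: integral_sum)
  have "(\<Sum>p\<in>I. \<Sum>q\<in>I. \<integral>w. \<phi> (w p) * \<phi> (w q) \<partial>?P) = card I * (\<integral>x. (\<phi> x)\<^sup>2 \<partial>\<mu>)"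
    using I(1) by (simp add: cross)
  then have "(\<integral>w. (?S w)\<^sup>2 \<partial>?P) = (\<integral>x. (\<phi> x)\<^sup>2 \<partial>\<mu>) / card I"
    unfolding ES using I by (simp add: power2_eq_square)
  also have "\<dots> \<le> v / card I" using var by (intro divide_right_mono) auto
  finally have le: "(\<integral>w. (?S w)\<^sup>2 \<partial>?P) \<le> v / card I" .
  have "P.expectation (\<lambda>w. \<bar>?S w\<bar>) \<le> sqrt (P.expectation (\<lambda>w. (?S w)\<^sup>2))" and ia: "integrable ?P (\<lambda>w. \<bar>?S w\<bar>)"
    using P.expectation_abs_le_sqrt[of ?S] iS by auto
  then have "P.expectation (\<lambda>w. \<bar>?S w\<bar>) \<le> sqrt (v / card I)"
    using le by (meson order_trans real_sqrt_le_mono)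
  then show ?thesis
    using ia by (subst nn_integral_eq_integral) (auto intro: ennreal_leI)
qed

text \<open>The point that stood at position p moves to the end and no other point is shifted. Hence
  the result is the sequence with y appended, composed with a single transposition.\<close>

definition insert_swap :: "nat \<Rightarrow> nat \<Rightarrow> (nat \<Rightarrow> 'a) \<Rightarrow> 'a \<Rightarrow> nat \<Rightarrow> 'a" where
  "insert_swap j p x y = (\<lambda>i\<in>{..<Suc j}. if i = p then y else if i = j then x p else x i)"

lemma measurable_insert_swap:
  assumes "p \<le> j"
  shows "(\<lambda>(x, y). insert_swap j p x y) \<in>
           Seq j S \<Otimes>\<^sub>M S \<rightarrow>\<^sub>M Seq (Suc j) S"
proof -
  have "(\<lambda>xy. if i = p then snd xy else if i = j then fst xy p else fst xy i)
      \<in> Seq j S \<Otimes>\<^sub>M S \<rightarrow>\<^sub>M S" if "i \<in> {..<Suc j}" for i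
  proof -
    have "i = p \<or> i \<noteq> p \<and> i = j \<and> p < j \<or> i \<noteq> p \<and> i \<noteq> j \<and> i < j"
      using that assms by auto
    then consider "i = p" | "i \<noteq> p" "i = j" "p < j" | "i \<noteq> p" "i \<noteq> j" "i < j"
      by blast
    then show ?thesis
    proof cases
      case 2
      then have "(\<lambda>xy. fst xy p) \<in> Seq j S \<Otimes>\<^sub>M S \<rightarrow>\<^sub>M S"
        by (intro measurable_compose[OF measurable_fst measurable_component_singleton]) auto
      with 2 show ?thesis by simp
    next
      case 3
      then have "(\<lambda>xy. fst xy i) \<in> Seq j S \<Otimes>\<^sub>M S \<rightarrow>\<^sub>M S"
        by (intro measurable_compose[OF measurable_fst measurable_component_singleton]) auto
      with 3 show ?thesis by simp
    qed simp
  qed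
  then show ?thesis
    unfolding insert_swap_def case_prod_beta by (rule measurable_restrict)
qed

text \<open>The \<open>min\<close> has no effect for \<open>p \<in> {m..j}\<close>; it makes the insertion measurable for every \<open>p\<close>.\<close>

definition step_kernel ::
    "'a measure \<Rightarrow> nat \<Rightarrow> nat \<Rightarrow> ((nat \<Rightarrow> 'a) \<Rightarrow> 'a measure) \<Rightarrow> (nat \<Rightarrow> 'a) \<Rightarrow> (nat \<Rightarrow> 'a) measure" where
  "step_kernel S m j \<nu> x = \<nu> (restrict x {..<m}) \<bind>
     (\<lambda>y. measure_pmf (pmf_of_set {m..j}) \<bind>
       (\<lambda>p. return (Seq (Suc j) S) (insert_swap j (min p j) x y)))"

lemma measurable_insert_kernel:
  "(\<lambda>(x, y). measure_pmf q \<bind> (\<lambda>p. return (Seq (Suc j) S) (insert_swap j (min p j) x y)))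
     \<in> kernels (Seq j S \<Otimes>\<^sub>M S) (Seq (Suc j) S)"
  unfolding case_prod_beta
  by (intro measurable_bind_pmf_kernel measurable_compose[OF _ measurable_return_prob_space]
      measurable_insert_swap[unfolded case_prod_beta]) simp

lemma measurable_step_kernel:
  assumes \<nu>: "\<nu> \<in> kernels (Seq m S) S" and "m \<le> j"
  shows "step_kernel S m j \<nu> \<in> kernels (Seq j S) (Seq (Suc j) S)"
  unfolding step_kernel_def
proof (rule measurable_bind_prob_space2)
  show "(\<lambda>x. \<nu> (restrict x {..<m})) \<in> kernels (Seq j S) S"
    by (rule measurable_compose[OF measurable_restrict_subset \<nu>]) (use assms in auto)
qed (rule measurable_insert_kernel)

lemma nn_integral_step_kernel:
  assumes \<nu>: "\<nu> \<in> kernels (Seq m S) S" and "m \<le> j"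
    and h[measurable]: "h \<in> borel_measurable (Seq (Suc j) S)"
    and x: "x \<in> space (Seq j S)"
  shows "(integral\<^sup>N (step_kernel S m j \<nu> x) h) =
    (\<integral>\<^sup>+y. (\<Sum>p\<in>{m..j}. h (insert_swap j p x y)) / ennreal (Suc j - m) \<partial>\<nu> (restrict x {..<m}))"
proof -
  let ?P = "Seq (Suc j) S"
  let ?R = "\<lambda>y p. return ?P (insert_swap j (min p j) x y)"
  have "restrict x {..<m} \<in> space (Seq m S)"
    using measurable_space[OF measurable_restrict_subset x] \<open>m \<le> j\<close> by auto
  from measurable_space[OF \<nu> this]
  have \<nu>x: "\<nu> (restrict x {..<m}) \<in> laws S" .
  have sp: "space (\<nu> (restrict x {..<m})) = space S"
    using sets_eq_imp_space_eq[OF sets_law[OF \<nu>x]] .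
  have K: "(\<lambda>y. measure_pmf (pmf_of_set {m..j}) \<bind> ?R y) \<in> S \<rightarrow>\<^sub>M prob_algebra ?P"
    using measurable_Pair2[OF measurable_insert_kernel x] by simp
  have ins: "insert_swap j p x y \<in> space ?P" if "y \<in> space S" "p \<le> j" for y p
    using measurable_space[OF measurable_insert_swap[OF that(2)], of "(x, y)" S] x that(1)
    by (simp add: space_pair_measure)
  have "(integral\<^sup>N (step_kernel S m j \<nu> x) h) =
      (\<integral>\<^sup>+y. \<integral>\<^sup>+z. h z \<partial>(measure_pmf (pmf_of_set {m..j}) \<bind> ?R y) \<partial>\<nu> (restrict x {..<m}))"
    unfolding step_kernel_def by (rule nn_integral_bind_law[OF \<nu>x K h])
  also have "\<dots> = (\<integral>\<^sup>+y. (\<Sum>p\<in>{m..j}. h (insert_swap j p x y)) / ennreal (Suc j - m) \<partial>\<nu> (restrict x {..<m}))"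
  proof (rule nn_integral_cong)
    fix y assume "y \<in> space (\<nu> (restrict x {..<m}))"
    then have y: "y \<in> space S" by (simp add: sp)
    have "(\<integral>\<^sup>+z. h z \<partial>(measure_pmf (pmf_of_set {m..j}) \<bind> ?R y)) =
        (\<integral>\<^sup>+p. \<integral>\<^sup>+z. h z \<partial>?R y p \<partial>measure_pmf (pmf_of_set {m..j}))"
      using y by (intro nn_integral_bind_law[OF pmf_law _ h])
         (auto intro!: measurable_space[OF measurable_return_prob_space] ins)
    also have "\<dots> = (\<integral>\<^sup>+p. h (insert_swap j (min p j) x y) \<partial>measure_pmf (pmf_of_set {m..j}))"
      using y by (intro nn_integral_cong nn_integral_return ins h) auto
    also have "\<dots> = (\<Sum>p\<in>{m..j}. h (insert_swap j (min p j) x y)) / ennreal (card {m..j})"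
      using \<open>m \<le> j\<close> by (subst nn_integral_pmf_of_set) (auto simp: ennreal_of_nat_eq_real_of_nat)
    finally show "(\<integral>\<^sup>+z. h z \<partial>(measure_pmf (pmf_of_set {m..j}) \<bind> ?R y)) =
       (\<Sum>p\<in>{m..j}. h (insert_swap j p x y)) / ennreal (Suc j - m)"
      by simp
  qed
  finally show ?thesis .
qed

text \<open>Separates the coordinates below m, which the insertion leaves alone because m \<le> p,
  from those on which the transposition acts.\<close>

lemma insert_swap_merge:
  assumes v: "v \<in> extensional {m..<j}" and p: "p \<in> {m..j}"
  shows "insert_swap j p (merge {..<m} {m..<j} (u, v)) y =
           merge {..<m} {m..j} (u, (v(j := y)) \<circ> flip p j)"
  using p by (auto simp: insert_swap_def merge_def fun_eq_iff Transposition.transpose_def)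

lemma measurable_comp_transpose:
  assumes "i \<in> I" "j \<in> I"
  shows "(\<lambda>w. w \<circ> flip i j) \<in> Fam I M \<rightarrow>\<^sub>M Fam I M"
proof (rule measurable_cong[THEN iffD1])
  show "(\<lambda>w. \<lambda>n\<in>I. w (flip i j n)) \<in> Fam I M \<rightarrow>\<^sub>M Fam I M"
    using assms by (intro measurable_restrict measurable_component_singleton)
      (auto simp: Transposition.transpose_def)
qed (rule restrict_comp_transpose[OF _ assms])

text \<open>The heart of the insertion argument: \<open>r\<close> is the density ratio of the
  inserted point. Exchangeability moves the random position from the test function to the ratio, so
  the new sample has as density the mean of \<open>r\<close> over all positions. This mean differs
  from 1 by a mean of independent centred terms, which is small in L1.\<close>

lemma nn_integral_weighted_insertion_le:
  fixes \<mu> :: "'a measure" and r :: "'a \<Rightarrow> real"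
  assumes \<mu>: "prob_space \<mu>" and I: "finite I" "j \<notin> I"
    and H[measurable]: "H \<in> borel_measurable (Fam (insert j I) \<mu>)" and H1: "\<And>w. H w \<le> 1"
    and r[measurable]: "r \<in> borel_measurable \<mu>" and r0: "\<And>x. 0 \<le> r x" and rB: "\<And>x. r x \<le> B"
    and mean: "(\<integral>x. r x \<partial>\<mu>) = 1" and var: "(\<integral>x. (r x - 1)\<^sup>2 \<partial>\<mu>) \<le> V"
  shows "(\<integral>\<^sup>+v. \<integral>\<^sup>+y. ennreal (r y) *
             ((\<Sum>p\<in>insert j I. H ((v(j := y)) \<circ> flip p j)) / ennreal (card (insert j I)))
             \<partial>\<mu> \<partial>Fam I \<mu>)
         \<le> (\<integral>\<^sup>+w. H w \<partial>Fam (insert j I) \<mu>) + ennreal (sqrt (V / card (insert j I)))"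
proof -
  let ?J = "insert j I"
  let ?P = "Fam ?J \<mu>"
  let ?c = "real (card ?J)"
  let ?W = "\<lambda>w. (\<Sum>p\<in>?J. r (w p) - 1) / ?c"
  interpret \<mu>: prob_space \<mu> by fact
  interpret PP: product_sigma_finite "\<lambda>_. \<mu>" ..
  have J: "finite ?J" "?J \<noteq> {}" using I by auto
  have "card ?J \<noteq> 0" using J by (simp only: card_eq_0_iff) simp
  then have c: "0 < ?c" by simp
  have tr: "(\<lambda>w. w \<circ> flip p j) \<in> ?P \<rightarrow>\<^sub>M ?P" if "p \<in> ?J" for p
    using that by (intro measurable_comp_transpose) auto
  have rw[measurable]: "(\<lambda>w. r (w p)) \<in> borel_measurable ?P" if "p \<in> ?J" for p
    using that by measurable
  have HT[measurable]: "(\<lambda>w. H (w \<circ> flip p j)) \<in> borel_measurable ?P" if "p \<in> ?J" for p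
    using measurable_compose[OF tr[OF that] H] .
  define G where "G w = ennreal (r (w j)) * ((\<Sum>p\<in>?J. H (w \<circ> flip p j)) / ennreal ?c)" for w
  have "(\<integral>\<^sup>+v. \<integral>\<^sup>+y. ennreal (r y) *
      ((\<Sum>p\<in>?J. H ((v(j := y)) \<circ> flip p j)) / ennreal ?c) \<partial>\<mu> \<partial>Fam I \<mu>) =
      (\<integral>\<^sup>+v. \<integral>\<^sup>+y. G (v(j := y)) \<partial>\<mu> \<partial>Fam I \<mu>)"
    by (simp add: G_def)
  also have "\<dots> = (\<integral>\<^sup>+w. G w \<partial>?P)"
    unfolding G_def using I by (intro PP.product_nn_integral_insert[symmetric]) auto
  also have "\<dots> = (\<integral>\<^sup>+w. (\<Sum>p\<in>?J. ennreal (r (w j)) * H (w \<circ> flip p j)) / ennreal ?c \<partial>?P)"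
    by (simp add: G_def sum_distrib_left ennreal_times_divide)
  also have "\<dots> = (\<Sum>p\<in>?J. \<integral>\<^sup>+w. ennreal (r (w j)) * H (w \<circ> flip p j) \<partial>?P) / ennreal ?c"
    by (subst nn_integral_divide) (auto simp: nn_integral_sum)
  \<comment> \<open>Invariance under the transposition of p and j: afterwards \<open>H\<close> is
    the same in every summand and only the weights are averaged.\<close>
  also have "(\<Sum>p\<in>?J. \<integral>\<^sup>+w. ennreal (r (w j)) * H (w \<circ> flip p j) \<partial>?P) =
     (\<Sum>p\<in>?J. \<integral>\<^sup>+w. ennreal (r (w p)) * H w \<partial>?P)"
  proof (rule sum.cong[OF refl])
    fix p assume p: "p \<in> ?J"
    have "(\<integral>\<^sup>+w. ennreal (r (w j)) * H (w \<circ> flip p j) \<partial>?P) =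
        (\<integral>\<^sup>+w. (\<lambda>w. ennreal (r (w p)) * H w) (w \<circ> flip p j) \<partial>?P)"
      by (simp add: o_def)
    also have "\<dots> = (\<integral>\<^sup>+w. ennreal (r (w p)) * H w \<partial>?P)"
      using p by (intro nn_integral_PiM_transpose \<mu>) auto
    finally show "(\<integral>\<^sup>+w. ennreal (r (w j)) * H (w \<circ> flip p j) \<partial>?P) =
        (\<integral>\<^sup>+w. ennreal (r (w p)) * H w \<partial>?P)" .
  qed
  also have "\<dots> / ennreal ?c = (\<integral>\<^sup>+w. (\<Sum>p\<in>?J. ennreal (r (w p)) * H w) / ennreal ?c \<partial>?P)"
    by (subst nn_integral_divide) (auto simp: nn_integral_sum)
  also have "\<dots> \<le> (\<integral>\<^sup>+w. H w + ennreal \<bar>?W w\<bar> \<partial>?P)"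
  proof (rule nn_integral_mono)
    fix w
    have S: "(\<Sum>p\<in>?J. r (w p)) / ?c \<le> 1 + \<bar>?W w\<bar>"
    proof -
      have "(\<Sum>p\<in>?J. r (w p)) / ?c = 1 + ?W w"
        using c by (simp only: sum_subtractf) (simp add: field_simps)
      then show ?thesis by linarith
    qed
    have "(\<Sum>p\<in>?J. ennreal (r (w p)) * H w) / ennreal ?c = ennreal ((\<Sum>p\<in>?J. r (w p)) / ?c) * H w"
    proof -
      have "(\<Sum>p\<in>?J. ennreal (r (w p)) * H w) = ennreal (\<Sum>p\<in>?J. r (w p)) * H w"
        using r0 by (simp flip: sum_distrib_right add: sum_ennreal del: sum.insert)
      then show ?thesis
        using c r0 by (simp add: divide_ennreal[symmetric] sum_nonneg ennreal_times_divide mult.commute del: sum.insert)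
    qed
    also have "\<dots> \<le> (1 + ennreal \<bar>?W w\<bar>) * H w"
      using S by (intro mult_right_mono) (auto simp flip: ennreal_1 ennreal_plus simp del: sum.insert)
    also have "\<dots> \<le> H w + ennreal \<bar>?W w\<bar>"
      using mult_left_mono[OF H1[of w], of "ennreal \<bar>?W w\<bar>"]
      by (simp add: distrib_right del: sum.insert)
    finally show "(\<Sum>p\<in>?J. ennreal (r (w p)) * H w) / ennreal ?c \<le> H w + ennreal \<bar>?W w\<bar>" .
  qed
  also have "\<dots> = (integral\<^sup>N ?P H) + (\<integral>\<^sup>+w. ennreal \<bar>?W w\<bar> \<partial>?P)"
    using I by (intro nn_integral_add) (auto simp del: sum.insert)
  also have "(\<integral>\<^sup>+w. ennreal \<bar>?W w\<bar> \<partial>?P) \<le> ennreal (sqrt (V / ?c))"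
  proof (rule nn_integral_mean_abs_le[OF \<mu> J, where B="B + 1"])
    show "\<bar>r x - 1\<bar> \<le> B + 1" for x using r0[of x] rB[of x] by linarith
    have "integrable \<mu> r"
      using r0 rB by (intro \<mu>.integrable_const_bound[of _ B]) auto
    then show "(\<integral>x. r x - 1 \<partial>\<mu>) = 0" using mean by (simp add: \<mu>.prob_space)
  qed (use var in auto)
  finally show ?thesis
    by (meson add_left_mono order_trans order_refl)
qed

text \<open>Condition on the first m coordinates u. For u in \<open>G\<close> the ratio
  \<open>r\<close> is fixed and the weighted insertion bound applies to the independent coordinates
  m, ..., j. Outside \<open>G\<close> the integral is at most 1, which costs the probability
  \<open>e\<close> of the complement.\<close>

lemma tv_le_step_kernel:
  fixes \<mu> :: "'a measure"
  assumes \<mu>: "\<mu> \<in> laws S"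
    and \<nu>: "\<nu> \<in> kernels (Seq m S) S" and mj: "m \<le> j"
    and G: "G \<in> sets (Seq m S)"
    and bad: "emeasure (Seq m \<mu>) (space (Seq m S) - G) \<le> e"
    and good: "\<And>u. u \<in> G \<Longrightarrow> \<exists>r. r \<in> borel_measurable S \<and> (\<forall>x. 0 \<le> r x \<and> r x \<le> B) \<and>
        \<nu> u = density \<mu> (\<lambda>x. ennreal (r x)) \<and> (\<integral>x. (r x - 1)\<^sup>2 \<partial>\<mu>) \<le> V"
  shows "tv_le (e + ennreal (sqrt (V / (Suc j - m))))
     (Seq j \<mu> \<bind> step_kernel S m j \<nu>) (Seq (Suc j) \<mu>)"
proof (rule tv_leI)
  interpret \<mu>: prob_space \<mu> using \<mu> by (simp add: space_prob_algebra)
  interpret PP: product_sigma_finite "\<lambda>_. \<mu>" ..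
  have [measurable_cong]: "sets \<mu> = sets S" by (rule sets_law[OF \<mu>])
  note sS = sets_PiM_law[OF \<mu>] and PM = PiM_law[OF \<mu>]
  note spS = sets_eq_imp_space_eq[OF sS]
  let ?e = "ennreal (sqrt (V / (Suc j - m)))"
  let ?b = "ennreal (Suc j - m)"
  let ?mg = "merge {..<m} {m..j}"
  have un: "{..<j} = {..<m} \<union> {m..<j}" "{..<Suc j} = {..<m} \<union> {m..j}" using mj by auto
  have ij: "{m..j} = insert j {m..<j}" using mj by auto
  fix h :: "(nat \<Rightarrow> 'a) \<Rightarrow> ennreal"
  assume h0: "h \<in> borel_measurable (Seq j \<mu> \<bind> step_kernel S m j \<nu>)" and h1: "\<And>x. h x \<le> 1"
  note K = measurable_step_kernel[OF \<nu> mj]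
  have h: "h \<in> borel_measurable (Seq (Suc j) S)"
    using h0 sets_law[OF bind_law[OF PM K]] by (simp cong: measurable_cong_sets)
  have h': "h \<in> borel_measurable (Pi\<^sub>M ({..<m} \<union> {m..j}) (\<lambda>_. \<mu>))"
    using h unfolding un by (simp add: sS cong: measurable_cong_sets)
  define A where "A x = (integral\<^sup>N (step_kernel S m j \<nu> x) h)" for x
  have "A \<in> borel_measurable (Seq j S)"
    unfolding A_def by (rule measurable_compose[OF measurable_prob_algebraD[OF K]
          nn_integral_measurable_subprob_algebra[OF h]])
  then have A: "A \<in> borel_measurable (Pi\<^sub>M ({..<m} \<union> {m..<j}) (\<lambda>_. \<mu>))"
    unfolding un by (simp add: sS cong: measurable_cong_sets)
  define C where "C u = (\<integral>\<^sup>+w. h (?mg (u, w)) \<partial>Fam {m..j} \<mu>)" for u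
  have mgm: "(\<lambda>w. ?mg (u, w)) \<in> Fam {m..j} \<mu> \<rightarrow>\<^sub>M Pi\<^sub>M ({..<m} \<union> {m..j}) (\<lambda>_. \<mu>)"
    if "u \<in> space (Seq m \<mu>)" for u
    using measurable_Pair2[OF measurable_merge that] .
  have inner: "(\<integral>\<^sup>+v. A (merge {..<m} {m..<j} (u, v)) \<partial>Fam {m..<j} \<mu>) \<le>
      C u + ?e + indicator (space (Seq m S) - G) u"
    if u: "u \<in> space (Seq m \<mu>)" for u
  proof (cases "u \<in> G")
    case False
    have "merge {..<m} {m..<j} (u, v) \<in> space (Seq j S)"
      if "v \<in> space (Fam {m..<j} \<mu>)" for v
      using measurable_space[OF measurable_merge[of "{..<m}" "{m..<j}" "\<lambda>_. \<mu>"], of "(u, v)"] u that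
      by (simp add: space_pair_measure flip: un spS)
    then have "A (merge {..<m} {m..<j} (u, v)) \<le> 1" if "v \<in> space (Fam {m..<j} \<mu>)" for v
      unfolding A_def using that by (intro nn_integral_le_1_law[OF measurable_space[OF K] h1])
    then have "(\<integral>\<^sup>+v. A (merge {..<m} {m..<j} (u, v)) \<partial>Fam {m..<j} \<mu>) \<le>
        (\<integral>\<^sup>+v. 1 \<partial>Fam {m..<j} \<mu>)"
      by (intro nn_integral_mono)
    also have "\<dots> \<le> 1" by (rule nn_integral_le_1_law[OF PM]) simp
    finally show ?thesis
      using False u by (simp add: spS add_increasing)
  next
    case True
    obtain r where r: "r \<in> borel_measurable S" "\<And>x. 0 \<le> r x" "\<And>x. r x \<le> B"
      "\<nu> u = density \<mu> (\<lambda>x. ennreal (r x))" "(\<integral>x. (r x - 1)\<^sup>2 \<partial>\<mu>) \<le> V"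
      using good[OF True] by blast
    have [measurable]: "r \<in> borel_measurable \<mu>" using r(1) by simp
    have rint: "integrable \<mu> r"
      using r(2,3) by (intro \<mu>.integrable_const_bound[of _ B]) auto
    \<comment> \<open>That \<open>\<nu> u\<close> has mass 1 is the statement that \<open>r\<close>
      has mean 1, which centres the summands.\<close>
    have "prob_space (\<nu> u)"
      using measurable_space[OF \<nu>, of u] u by (simp add: spS space_prob_algebra)
    then have "emeasure (\<nu> u) (space \<mu>) = 1"
      using r(4) prob_space.emeasure_space_1 by fastforce
    then have "(\<integral>\<^sup>+x. ennreal (r x) \<partial>\<mu>) = 1"
      unfolding r(4) by (simp add: emeasure_density cong: nn_integral_cong)
    then have mean: "(\<integral>x. r x \<partial>\<mu>) = 1"
      using nn_integral_eq_integral[OF rint] r(2) by simp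
    define H where "H w = h (?mg (u, w))" for w
    have Hm: "H \<in> borel_measurable (Fam (insert j {m..<j}) \<mu>)"
      unfolding H_def ij[symmetric] by (rule measurable_compose[OF mgm[OF u] h'])
    have "(\<integral>\<^sup>+v. A (merge {..<m} {m..<j} (u, v)) \<partial>Fam {m..<j} \<mu>) =
       (\<integral>\<^sup>+v. \<integral>\<^sup>+y. ennreal (r y) *
             ((\<Sum>p\<in>insert j {m..<j}. H ((v(j := y)) \<circ> flip p j)) / ennreal (card (insert j {m..<j})))
             \<partial>\<mu> \<partial>Fam {m..<j} \<mu>)"
    proof (rule nn_integral_cong)
      fix v assume v: "v \<in> space (Fam {m..<j} \<mu>)"
      let ?x = "merge {..<m} {m..<j} (u, v)"
      have x: "?x \<in> space (Seq j S)"
        using measurable_space[OF measurable_merge[of "{..<m}" "{m..<j}" "\<lambda>_. \<mu>"], of "(u, v)"] u v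
        by (simp add: space_pair_measure flip: un spS)
      have ru: "restrict ?x {..<m} = u"
        using u by (auto simp: merge_def restrict_def space_PiM PiE_def extensional_def fun_eq_iff)
      have ve: "v \<in> extensional {m..<j}" using v by (simp add: space_PiM PiE_def)
      define T where "T y = (\<Sum>p\<in>insert j {m..<j}. H ((v(j := y)) \<circ> flip p j)) / ?b" for y
      have T: "T y = (\<Sum>p\<in>{m..j}. h (insert_swap j p ?x y)) / ?b" for y
        unfolding T_def ij[symmetric] H_def by (simp add: insert_swap_merge[OF ve])
      have "(\<lambda>y. insert_swap j p ?x y) \<in> S \<rightarrow>\<^sub>M Seq (Suc j) S" if "p \<in> {m..j}" for p
        using measurable_Pair2[OF measurable_insert_swap[of p j S] x] that by simp
      then have Tm: "T \<in> borel_measurable \<mu>"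
        unfolding T by (intro borel_measurable_divide_ennreal borel_measurable_sum
             measurable_compose[OF _ h]) auto
      have "A ?x = (\<integral>\<^sup>+y. T y \<partial>\<nu> u)"
        unfolding A_def nn_integral_step_kernel[OF \<nu> mj h x] ru T ..
      also have "\<dots> = (\<integral>\<^sup>+y. ennreal (r y) * T y \<partial>\<mu>)"
        unfolding r(4) using Tm by (intro nn_integral_density) auto
      finally show "A ?x = (\<integral>\<^sup>+y. ennreal (r y) *
         ((\<Sum>p\<in>insert j {m..<j}. H ((v(j := y)) \<circ> flip p j)) / ennreal (card (insert j {m..<j}))) \<partial>\<mu>)"
        by (simp add: T_def flip: ij)
    qed
    also have "\<dots> \<le> (\<integral>\<^sup>+w. H w \<partial>Fam (insert j {m..<j}) \<mu>) + ennreal (sqrt (V / card (insert j {m..<j})))"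
      by (rule nn_integral_weighted_insertion_le[OF \<mu>.prob_space_axioms _ _ Hm _ _ r(2) r(3) mean r(5)])
         (auto simp: H_def h1)
    also have "\<dots> = C u + ?e" by (simp add: C_def H_def flip: ij)
    finally show ?thesis using True by simp
  qed
  have "(\<lambda>(u, w). h (?mg (u, w))) \<in> borel_measurable (Seq m \<mu> \<Otimes>\<^sub>M Fam {m..j} \<mu>)"
    using measurable_compose[OF measurable_merge h'] by (simp add: case_prod_beta)
  then have Cm: "C \<in> borel_measurable (Seq m \<mu>)"
    unfolding C_def
    by (intro sigma_finite_measure.borel_measurable_nn_integral[OF PP.sigma_finite]) auto
  have G': "space (Seq m S) - G \<in> sets (Seq m \<mu>)"
    using G by (auto simp: sS)
  have "(integral\<^sup>N (Seq j \<mu> \<bind> step_kernel S m j \<nu>) h) = (integral\<^sup>N (Seq j \<mu>) A)"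
    unfolding A_def by (rule nn_integral_bind_law[OF PM K h])
  also have "\<dots> = (\<integral>\<^sup>+u. \<integral>\<^sup>+v. A (merge {..<m} {m..<j} (u, v)) \<partial>Fam {m..<j} \<mu> \<partial>Seq m \<mu>)"
    unfolding un by (rule PP.product_nn_integral_fold[OF _ _ _ A]) auto
  also have "\<dots> \<le> (\<integral>\<^sup>+u. C u + ?e + indicator (space (Seq m S) - G) u \<partial>Seq m \<mu>)"
    by (rule nn_integral_mono) (rule inner)
  also have "\<dots> = (integral\<^sup>N (Seq m \<mu>) C) + ?e * emeasure (Seq m \<mu>) (space (Seq m \<mu>))
      + emeasure (Seq m \<mu>) (space (Seq m S) - G)"
    using Cm G' by (simp add: nn_integral_add)
  also have "(integral\<^sup>N (Seq m \<mu>) C) = (\<integral>\<^sup>+z. h z \<partial>Seq (Suc j) \<mu>)"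
    unfolding un C_def by (rule PP.product_nn_integral_fold[OF _ _ _ h', symmetric]) auto
  also have "emeasure (Seq m \<mu>) (space (Seq m \<mu>)) = 1"
    using PM[of "{..<m}"] by (intro prob_space.emeasure_space_1) (simp add: space_prob_algebra)
  finally have "(integral\<^sup>N (Seq j \<mu> \<bind> step_kernel S m j \<nu>) h) \<le>
     (\<integral>\<^sup>+z. h z \<partial>Seq (Suc j) \<mu>) + ?e * 1 +
       emeasure (Seq m \<mu>) (space (Seq m S) - G)" .
  also have "\<dots> \<le> (\<integral>\<^sup>+z. h z \<partial>Seq (Suc j) \<mu>) + ?e * 1 + e"
    by (rule add_left_mono[OF bad])
  also have "\<dots> = (\<integral>\<^sup>+z. h z \<partial>Seq (Suc j) \<mu>) + (e + ?e)"
    by (simp only: mult_1_left ac_simps)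
  finally show "(integral\<^sup>N (Seq j \<mu> \<bind> step_kernel S m j \<nu>) h) \<le>
     (\<integral>\<^sup>+z. h z \<partial>Seq (Suc j) \<mu>) + (e + ?e)" .
qed

section \<open>Changing the number of observations\<close>

fun extend_kernel ::
    "'a measure \<Rightarrow> (nat \<Rightarrow> (nat \<Rightarrow> 'a) \<Rightarrow> (nat \<Rightarrow> 'a) measure) \<Rightarrow> nat \<Rightarrow> nat \<Rightarrow> (nat \<Rightarrow> 'a) \<Rightarrow> (nat \<Rightarrow> 'a) measure" where
  "extend_kernel S \<kappa> k 0 x = return (Seq k S) x" |
  "extend_kernel S \<kappa> k (Suc s) x = extend_kernel S \<kappa> k s x \<bind> \<kappa> (k + s)"

definition resize_kernel ::
    "'a measure \<Rightarrow> (nat \<Rightarrow> (nat \<Rightarrow> 'a) \<Rightarrow> (nat \<Rightarrow> 'a) measure) \<Rightarrow> nat \<Rightarrow> nat \<Rightarrow> (nat \<Rightarrow> 'a) \<Rightarrow> (nat \<Rightarrow> 'a) measure" where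
  "resize_kernel S \<kappa> k m x =
     (if k \<le> m then extend_kernel S \<kappa> k (m - k) x else return (Seq m S) (restrict x {..<m}))"

lemma measurable_extend_kernel:
  assumes "\<And>j. \<kappa> j \<in> kernels (Seq j S) (Seq (Suc j) S)"
  shows "extend_kernel S \<kappa> k s \<in> kernels (Seq k S) (Seq (k + s) S)"
proof (induction s)
  case (Suc s)
  show ?case
    using measurable_bind_prob_space[OF Suc assms[of "k + s"]] by simp
qed simp

lemma measurable_resize_kernel:
  assumes "\<And>j. \<kappa> j \<in> kernels (Seq j S) (Seq (Suc j) S)"
  shows "resize_kernel S \<kappa> k m \<in> kernels (Seq k S) (Seq m S)"
proof (cases "k \<le> m")
  case True
  then show ?thesis
    using measurable_extend_kernel[OF assms, of k "m - k"] by (simp add: resize_kernel_def[abs_def])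
next
  case False
  then have "(\<lambda>x. restrict x {..<m}) \<in> Seq k S \<rightarrow>\<^sub>M Seq m S"
    by (intro measurable_restrict_subset) auto
  from measurable_compose[OF this measurable_return_prob_space] False show ?thesis
    by (simp add: resize_kernel_def[abs_def])
qed

lemma bind_assoc_law:
  assumes "P \<in> laws M" "K \<in> kernels M N" "L \<in> kernels N R"
  shows "(P \<bind> K) \<bind> L = P \<bind> (\<lambda>x. K x \<bind> L)"
  using assms sets_law[OF assms(1)] measurable_prob_algebraD[OF assms(2)]
  by (intro bind_assoc[where N=N and R=R] measurable_prob_algebraD) (auto cong: measurable_cong_sets)

lemma bind_return_restrict:
  fixes k m :: nat
  assumes P: "P \<in> laws S" and "m \<le> k"
  shows "Seq k P \<bind> (\<lambda>x. return (Seq m S) (restrict x {..<m})) = Seq m P"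
proof -
  interpret P: prob_space P using P by (simp add: space_prob_algebra)
  interpret prob_space "Seq k P" by (intro prob_space_PiM P.prob_space_axioms)
  note s = sets_PiM_law[OF P]
  have r: "(\<lambda>x. restrict x {..<m}) \<in> Seq k P \<rightarrow>\<^sub>M Seq m S"
    by (subst measurable_cong_sets[OF s[of "{..<k}"] refl], rule measurable_restrict_subset)
       (use \<open>m \<le> k\<close> in auto)
  have "Seq k P \<bind> (\<lambda>x. return (Seq m S) (restrict x {..<m})) =
      distr (Seq k P) (Seq m S) (\<lambda>x. restrict x {..<m})"
    using bind_return_distr[OF not_empty r] by (simp add: o_def)
  also have "\<dots> = distr (Seq k P) (Seq m P) (\<lambda>x. \<lambda>n\<in>{..<m}. x n)"
    by (rule distr_cong) (auto simp: s)
  also have "\<dots> = Seq m P"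
    using \<open>m \<le> k\<close> by (intro distr_PiM_reindex[where f="\<lambda>n. n" and K="{..<k}", simplified] P.prob_space_axioms) auto
  finally show ?thesis .
qed

text \<open>A kernel does not increase the error made before it, so the errors of successive
  insertions add up.\<close>

lemma tv_le_extend_kernel:
  assumes P: "P \<in> laws S"
    and \<kappa>: "\<And>j. \<kappa> j \<in> kernels (Seq j S) (Seq (Suc j) S)"
    and step: "\<And>j. J \<le> j \<Longrightarrow> tv_le (ennreal \<eta>) (Seq j P \<bind> \<kappa> j) (Seq (Suc j) P)"
    and "J \<le> k" "0 \<le> \<eta>"
  shows "tv_le (ennreal (\<eta> * s)) (Seq k P \<bind> extend_kernel S \<kappa> k s) (Seq (k + s) P)"
proof (induction s)
  case 0
  have "extend_kernel S \<kappa> k 0 = return (Seq k S)" by (simp add: fun_eq_iff)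
  moreover have "Seq k P \<bind> return (Seq k S) = Seq k P"
    using sets_law[OF PiM_law[OF P, of "{..<k}"]] by (intro bind_return'') auto
  ultimately show ?case by (simp add: tv_le_refl)
next
  case (Suc s)
  note e = measurable_extend_kernel[where \<kappa>=\<kappa> and S=S, OF \<kappa>]
  note PM = PiM_law[OF P]
  have eq: "Seq k P \<bind> extend_kernel S \<kappa> k (Suc s) =
      (Seq k P \<bind> extend_kernel S \<kappa> k s) \<bind> \<kappa> (k + s)"
  proof -
    have "extend_kernel S \<kappa> k (Suc s) = (\<lambda>x. extend_kernel S \<kappa> k s x \<bind> \<kappa> (k + s))"
      by (simp add: fun_eq_iff)
    then show ?thesis
      by (simp only: bind_assoc_law[OF PM e \<kappa>])
  qed
  have "tv_le (ennreal (\<eta> * s) + ennreal \<eta>) (Seq k P \<bind> extend_kernel S \<kappa> k (Suc s)) (Seq (Suc (k + s)) P)"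
    unfolding eq
  proof (rule tv_le_trans[OF tv_le_bind[OF Suc bind_law[OF PM e] PM \<kappa>] step])
    show "sets ((Seq k P \<bind> extend_kernel S \<kappa> k s) \<bind> \<kappa> (k + s)) = sets (Seq (k + s) P \<bind> \<kappa> (k + s))"
      using sets_law[OF bind_law[OF bind_law[OF PM e] \<kappa>]]
        sets_law[OF bind_law[OF PM \<kappa>]] by simp
  qed (use \<open>J \<le> k\<close> in simp)
  then show ?case
    using \<open>0 \<le> \<eta>\<close> by (simp add: distrib_left add.commute del: extend_kernel.simps flip: ennreal_plus)
qed

text \<open>Shortening an iid sample is exact. An extension from k < J is not controlled by
  \<open>step\<close>, but then k \<noteq> n, hence m = n and |m - k| \<ge> n - J, and the claimed
  error is at least 1.\<close>

lemma tv_le_resize_kernel: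
  assumes P: "P \<in> laws S"
    and \<kappa>: "\<And>j. \<kappa> j \<in> kernels (Seq j S) (Seq (Suc j) S)"
    and step: "\<And>j. J \<le> j \<Longrightarrow> tv_le (ennreal \<eta>) (Seq j P \<bind> \<kappa> j) (Seq (Suc j) P)"
    and \<eta>: "0 \<le> \<eta>" and J: "J \<le> n" "1 \<le> \<eta> * (real n - real J)" and km: "k = n \<or> m = n"
  shows "tv_le (ennreal (\<eta> * \<bar>real m - real k\<bar>)) (Seq k P \<bind> resize_kernel S \<kappa> k m) (Seq m P)"
proof (cases "k \<le> m")
  case True
  have R: "resize_kernel S \<kappa> k m = extend_kernel S \<kappa> k (m - k)"
    using True by (simp add: resize_kernel_def fun_eq_iff)
  show ?thesis
  proof (cases "J \<le> k")
    case J: True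
    show ?thesis
      using tv_le_extend_kernel[OF P \<kappa> step J \<eta>, of "m - k"] True R by (simp add: of_nat_diff)
  next
    case False
    then have "m = n" "real n - real J \<le> \<bar>real m - real k\<bar>" using km J(1) True by auto
    then have "1 \<le> \<eta> * \<bar>real m - real k\<bar>"
      using J(2) \<eta> by (meson mult_left_mono order_trans)
    then show ?thesis
      by (intro tv_le_1[OF bind_law[OF PiM_law[OF P] measurable_resize_kernel[OF \<kappa>]]]) simp
  qed
next
  case False
  then have "resize_kernel S \<kappa> k m = (\<lambda>x. return (Seq m S) (restrict x {..<m}))"
    by (simp add: resize_kernel_def fun_eq_iff)
  then show ?thesis
    using bind_return_restrict[OF P, of m k] False by (auto intro: tv_le_mono[OF tv_le_refl])
qed

section \<open>Poissonization\<close>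

text \<open>Shifting the index in the exponential series gives the first two factorial moments, and
  (k - r)^2 = k (k - 1) + (1 - 2 r) k + r^2.\<close>

lemma poisson_second_moment:
  fixes r :: real
  assumes r: "0 < r"
  shows "integrable (measure_pmf (poisson_pmf r)) (\<lambda>k. (real k - r)\<^sup>2)"
    and "measure_pmf.expectation (poisson_pmf r) (\<lambda>k. (real k - r)\<^sup>2) = r"
proof -
  let ?p = "\<lambda>k. r ^ k / fact k * exp (- r)"
  have s0: "(\<lambda>k. r ^ k / fact k) sums exp r"
    using exp_converges[of r] by (simp add: scaleR_conv_of_real divide_inverse mult.commute)
  have "(\<lambda>k. real (Suc k) * (r ^ Suc k / fact (Suc k))) sums (r * exp r)"
    using sums_mult[OF s0, of r] by (simp add: field_simps del: of_nat_Suc)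
  then have s1: "(\<lambda>k. real k * (r ^ k / fact k)) sums (r * exp r)"
    by (subst (asm) sums_Suc_iff) simp
  have "(\<lambda>k. real (Suc k) * real k * (r ^ Suc k / fact (Suc k))) sums (r * (r * exp r))"
    using sums_mult[OF s1, of r] by (simp add: field_simps del: of_nat_Suc)
  then have s2: "(\<lambda>k. real k * (real k - 1) * (r ^ k / fact k)) sums (r * (r * exp r))"
    using sums_Suc_iff[of "\<lambda>k. real k * (real k - 1) * (r ^ k / fact k)" "r * (r * exp r)"] by simp
  have "(\<lambda>k. (real k * (real k - 1) * (r ^ k / fact k) + (1 - 2 * r) * (real k * (r ^ k / fact k)) + r\<^sup>2 * (r ^ k / fact k)) * exp (- r)) sums
      ((r * (r * exp r) + (1 - 2 * r) * (r * exp r) + r\<^sup>2 * exp r) * exp (- r))"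
    by (intro sums_mult2 sums_add sums_mult s0 s1 s2)
  moreover have "(r * (r * exp r) + (1 - 2 * r) * (r * exp r) + r\<^sup>2 * exp r) * exp (- r) = r"
  proof -
    have "(r * (r * exp r) + (1 - 2 * r) * (r * exp r) + r\<^sup>2 * exp r) = r * exp r"
      by (simp add: algebra_simps power2_eq_square)
    then show ?thesis by (simp flip: exp_add)
  qed
  moreover have "(real k * (real k - 1) * (r ^ k / fact k) + (1 - 2 * r) * (real k * (r ^ k / fact k)) + r\<^sup>2 * (r ^ k / fact k)) * exp (- r)
      = ?p k * (real k - r)\<^sup>2" for k
  proof -
    have "real k * (real k - 1) * c + (1 - 2 * r) * (real k * c) + r\<^sup>2 * c = c * (real k - r)\<^sup>2" for c
      by (simp add: algebra_simps power2_eq_square)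
    from this[of "r ^ k / fact k"] show ?thesis by (simp only: mult.commute mult.left_commute) 
  qed
  ultimately have s: "(\<lambda>k. ?p k * (real k - r)\<^sup>2) sums r"
    by simp
  have "(\<integral>\<^sup>+k. ennreal ((real k - r)\<^sup>2) \<partial>measure_pmf (poisson_pmf r)) =
      (\<Sum>k. ennreal (?p k * (real k - r)\<^sup>2))"
    using r by (simp add: nn_integral_measure_pmf nn_integral_count_space_nat flip: ennreal_mult')
  also have "\<dots> = ennreal r"
    using r s by (simp add: suminf_ennreal2 sums_unique[symmetric] sums_summable)
  finally have nn: "(\<integral>\<^sup>+k. ennreal ((real k - r)\<^sup>2) \<partial>measure_pmf (poisson_pmf r)) = ennreal r" .
  show "integrable (measure_pmf (poisson_pmf r)) (\<lambda>k. (real k - r)\<^sup>2)"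
    by (rule integrableI_nonneg) (auto simp: nn)
  show "measure_pmf.expectation (poisson_pmf r) (\<lambda>k. (real k - r)\<^sup>2) = r"
    using r by (subst integral_eq_nn_integral) (auto simp: nn)
qed

text \<open>Turns a cost \<eta> per inserted point into a cost \<eta> sqrt n for the random size:
  the mean deviation is at most the standard deviation.\<close>

lemma nn_integral_poisson_deviation:
  assumes "0 < r" "0 \<le> \<eta>"
  shows "(\<integral>\<^sup>+k. ennreal (\<eta> * \<bar>real k - r\<bar>) \<partial>measure_pmf (poisson_pmf r)) \<le> ennreal (\<eta> * sqrt r)"
proof -
  note a = measure_pmf.expectation_abs_le_sqrt[of "\<lambda>k. real k - r" "poisson_pmf r", OF _ poisson_second_moment(1)[OF assms(1)]]
  have "(\<integral>\<^sup>+k. ennreal (\<eta> * \<bar>real k - r\<bar>) \<partial>measure_pmf (poisson_pmf r)) =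
      ennreal (\<eta> * measure_pmf.expectation (poisson_pmf r) (\<lambda>k. \<bar>real k - r\<bar>))"
    using a(1) assms by (subst nn_integral_eq_integral) auto
  also have "\<dots> \<le> ennreal (\<eta> * sqrt r)"
    using a(2) assms poisson_second_moment(2)[OF assms(1)] by (intro ennreal_leI mult_left_mono) auto
  finally show ?thesis .
qed

lemma nn_integral_pmf_swap:
  fixes F :: "nat \<Rightarrow> 'a \<Rightarrow> ennreal"
  assumes "\<And>k. F k \<in> borel_measurable M"
  shows "(\<integral>\<^sup>+x. \<integral>\<^sup>+k. F k x \<partial>measure_pmf q \<partial>M) = (\<integral>\<^sup>+k. \<integral>\<^sup>+x. F k x \<partial>M \<partial>measure_pmf q)"
  using assms by (simp add: nn_integral_measure_pmf nn_integral_count_space_nat nn_integral_suminf nn_integral_cmult)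

lemma
  assumes f: "density_law f \<in> laws unit_borel"
  shows iid_law_law: "iid_law k f \<in> laws (Seq k unit_borel)"
    and points_iid_law: "points k \<in> iid_law k f \<rightarrow>\<^sub>M point_configs"
    and distr_points_law: "distr (iid_law k f) point_configs (points k) \<in> laws point_configs"
proof -
  show I: "iid_law k f \<in> laws (Seq k unit_borel)"
    unfolding iid_law_def by (rule PiM_law[OF f])
  show p: "points k \<in> iid_law k f \<rightarrow>\<^sub>M point_configs"
    using points_measurable unfolding measurable_cong_sets[OF sets_law[OF I] refl] .
  show "distr (iid_law k f) point_configs (points k) \<in> laws point_configs"
    using prob_space.prob_space_distr[OF _ p] I by (auto simp: space_prob_algebra)
qed

lemma poisson_law:
  "density_law f \<in> laws unit_borel \<Longrightarrow>
    poisson_process_law n f \<in> laws point_configs"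
  unfolding poisson_process_law_def by (intro bind_law[OF pmf_law]) (simp add: distr_points_law)

text \<open>What both directions need to know about the insertion kernels apart from their accuracy,
  which depends on the density and is assumed separately in each bound.\<close>

locale resizing =
  fixes \<kappa> :: "nat \<Rightarrow> (nat \<Rightarrow> real) \<Rightarrow> (nat \<Rightarrow> real) measure" and n J :: nat and \<eta> :: real
  assumes \<kappa>: "\<And>j. \<kappa> j \<in> kernels (Seq j unit_borel) (Seq (Suc j) unit_borel)"
    and n: "0 < n" and J: "J \<le> n" "1 \<le> \<eta> * (real n - real J)" and \<eta>: "0 \<le> \<eta>"
begin

abbreviation "Q k m \<equiv> resize_kernel unit_borel \<kappa> k m"

lemmas Q = measurable_resize_kernel[where \<kappa>=\<kappa> and S=unit_borel, OF \<kappa>]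

definition to_poisson :: "(nat \<Rightarrow> real) \<Rightarrow> real multiset measure" where
  "to_poisson x = measure_pmf (poisson_pmf (real n)) \<bind> (\<lambda>k. distr (Q n k x) point_configs (points k))"

lemma distr_Q: "(\<lambda>x. distr (Q n k x) point_configs (points k)) \<in> kernels (Seq n unit_borel) point_configs"
  by (rule measurable_compose[OF Q measurable_distr_prob_space]) (rule points_measurable)

lemma to_poisson: "to_poisson \<in> kernels (Seq n unit_borel) point_configs"
  unfolding to_poisson_def by (intro measurable_bind_pmf_kernel distr_Q)

text \<open>Given that the Poisson size is k, the error is \<eta> |k - n|; swapping the integrals
  over the sample and over k averages this bound.\<close>

lemma tv_le_to_poisson:
  assumes f: "density_law f \<in> laws unit_borel"
    and step: "\<And>j. J \<le> j \<Longrightarrow> tv_le (ennreal \<eta>) (iid_law j f \<bind> \<kappa> j) (iid_law (Suc j) f)"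
  shows "tv_le (ennreal (\<eta> * sqrt n)) (iid_law n f \<bind> to_poisson) (poisson_process_law n f)"
proof (rule tv_leI)
  let ?q = "poisson_pmf (real n)"
  note I = iid_law_law[OF f] and pts = points_iid_law[OF f]
  fix h :: "real multiset \<Rightarrow> ennreal"
  assume h0: "h \<in> borel_measurable (iid_law n f \<bind> to_poisson)" and h1: "\<And>x. h x \<le> 1"
  have h: "h \<in> borel_measurable point_configs"
    using h0 sets_law[OF bind_law[OF I to_poisson]] by (simp cong: measurable_cong_sets)
  have hp: "(\<lambda>z. h (points k z)) \<in> borel_measurable (Seq k unit_borel)" for k
    by (rule measurable_compose[OF points_measurable h])
  have I': "sets (iid_law n f) = sets (Seq n unit_borel)"
    by (rule sets_law[OF I])
  have Qx: "Q n k x \<in> laws (Seq k unit_borel)" if "x \<in> space (iid_law n f)" for x k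
    using measurable_space[OF Q] that sets_eq_imp_space_eq[OF I'] by simp
  have "(integral\<^sup>N (iid_law n f \<bind> to_poisson) h) = (\<integral>\<^sup>+x. \<integral>\<^sup>+y. h y \<partial>to_poisson x \<partial>iid_law n f)"
    by (rule nn_integral_bind_law[OF I to_poisson h])
  also have "\<dots> = (\<integral>\<^sup>+x. \<integral>\<^sup>+k. \<integral>\<^sup>+z. h (points k z) \<partial>Q n k x \<partial>measure_pmf ?q \<partial>iid_law n f)"
  proof (rule nn_integral_cong)
    fix x assume x: "x \<in> space (iid_law n f)"
    have "(integral\<^sup>N (to_poisson x) h) = (\<integral>\<^sup>+k. \<integral>\<^sup>+y. h y \<partial>distr (Q n k x) point_configs (points k) \<partial>measure_pmf ?q)"
      unfolding to_poisson_def
      using x sets_eq_imp_space_eq[OF I']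
      by (intro nn_integral_bind_law[OF pmf_law _ h])
         (auto intro!: measurable_space[OF distr_Q])
    also have "\<dots> = (\<integral>\<^sup>+k. \<integral>\<^sup>+z. h (points k z) \<partial>Q n k x \<partial>measure_pmf ?q)"
      using points_measurable h sets_law[OF Qx[OF x]]
      by (intro nn_integral_cong nn_integral_distr) (auto cong: measurable_cong_sets)
    finally show "(integral\<^sup>N (to_poisson x) h) = (\<integral>\<^sup>+k. \<integral>\<^sup>+z. h (points k z) \<partial>Q n k x \<partial>measure_pmf ?q)" .
  qed
  also have "\<dots> = (\<integral>\<^sup>+k. \<integral>\<^sup>+x. \<integral>\<^sup>+z. h (points k z) \<partial>Q n k x \<partial>iid_law n f \<partial>measure_pmf ?q)"
    using measurable_compose[OF measurable_prob_algebraD[OF Q] nn_integral_measurable_subprob_algebra[OF hp]] I'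
    by (intro nn_integral_pmf_swap) (simp cong: measurable_cong_sets)
  also have "\<dots> = (\<integral>\<^sup>+k. \<integral>\<^sup>+z. h (points k z) \<partial>(iid_law n f \<bind> Q n k) \<partial>measure_pmf ?q)"
    by (intro nn_integral_cong nn_integral_bind_law[OF I Q hp, symmetric])
  also have "\<dots> \<le> (\<integral>\<^sup>+k. (\<integral>\<^sup>+z. h (points k z) \<partial>iid_law k f) + ennreal (\<eta> * \<bar>real k - real n\<bar>) \<partial>measure_pmf ?q)"
  proof (rule nn_integral_mono)
    fix k
    have t: "tv_le (ennreal (\<eta> * \<bar>real k - real n\<bar>)) (iid_law n f \<bind> Q n k) (iid_law k f)"
      using tv_le_resize_kernel[OF f \<kappa> step[unfolded iid_law_def] \<eta> J, of n k] by (simp add: iid_law_def)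
    show "(\<integral>\<^sup>+z. h (points k z) \<partial>(iid_law n f \<bind> Q n k)) \<le> (\<integral>\<^sup>+z. h (points k z) \<partial>iid_law k f) + ennreal (\<eta> * \<bar>real k - real n\<bar>)"
    proof (rule tv_leD[OF t _ h1])
      show "(\<lambda>z. h (points k z)) \<in> borel_measurable (iid_law n f \<bind> Q n k)"
        unfolding measurable_cong_sets[OF sets_law[OF bind_law[OF I Q]] refl] by (rule hp)
    qed
  qed
  also have "\<dots> = (\<integral>\<^sup>+k. (\<integral>\<^sup>+z. h (points k z) \<partial>iid_law k f) \<partial>measure_pmf ?q) + (\<integral>\<^sup>+k. ennreal (\<eta> * \<bar>real k - real n\<bar>) \<partial>measure_pmf ?q)"
    by (simp add: nn_integral_add)
  also have "\<dots> \<le> (\<integral>\<^sup>+k. (\<integral>\<^sup>+z. h (points k z) \<partial>iid_law k f) \<partial>measure_pmf ?q) + ennreal (\<eta> * sqrt n)"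
    using n by (intro add_left_mono nn_integral_poisson_deviation \<eta>) simp
  also have "(\<integral>\<^sup>+k. (\<integral>\<^sup>+z. h (points k z) \<partial>iid_law k f) \<partial>measure_pmf ?q) =
      (\<integral>\<^sup>+k. (\<integral>\<^sup>+y. h y \<partial>distr (iid_law k f) point_configs (points k)) \<partial>measure_pmf ?q)"
    by (rule nn_integral_cong, rule nn_integral_distr[symmetric, OF pts]) (use h in simp)
  also have "\<dots> = (integral\<^sup>N (poisson_process_law n f) h)"
    unfolding poisson_process_law_def
    using distr_points_law[OF f] by (intro nn_integral_bind_law[OF pmf_law _ h, symmetric]) simp
  finally show "(integral\<^sup>N (iid_law n f \<bind> to_poisson) h) \<le> (integral\<^sup>N (poisson_process_law n f) h) + ennreal (\<eta> * sqrt n)" .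
qed

end

subsection \<open>Recovering an ordered sample from a point configuration\<close>

text \<open>Expresses order statistics through the numbers of points in half-lines. Such counts
  generate the \<sigma>-algebra of \<open>point_configs\<close>, so this yields measurability of
  \<open>order_stat\<close>.\<close>

lemma sorted_nth_le_iff:
  fixes xs :: "'a :: linorder list"
  assumes "sorted xs" "i < length xs"
  shows "xs ! i \<le> a \<longleftrightarrow> i < length (filter (\<lambda>x. x \<le> a) xs)"
  using assms
proof (induction xs arbitrary: i)
  case (Cons x xs)
  show ?case
  proof (cases "x \<le> a")
    case True
    then show ?thesis using Cons by (cases i) auto
  next
    case False
    then have "\<forall>y\<in>set (x # xs). a < y" using Cons.prems(1) by auto
    then have "filter (\<lambda>y. y \<le> a) (x # xs) = []" "a < (x # xs) ! i"
      using nth_mem[OF Cons.prems(2)] by (auto simp: filter_empty_conv not_le simp del: filter.simps)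
    then show ?thesis by (simp del: filter.simps)
  qed
qed simp

text \<open>The default 0 lies in the unit interval, so the values are in \<open>unit_borel\<close>
  for every index and every configuration.\<close>

definition order_stat :: "real multiset \<Rightarrow> nat \<Rightarrow> real" where
  "order_stat X i = (if i < size X then sorted_list_of_multiset X ! i else 0)"

lemma space_point_configs: "space point_configs = {X. set_mset X \<subseteq> {0..1}}"
  unfolding point_configs_def by (rule space_measure_of) auto

lemma measurable_count_points:
  assumes "B \<in> sets unit_borel"
  shows "(\<lambda>X. size (filter_mset (\<lambda>x. x \<in> B) X)) \<in> point_configs \<rightarrow>\<^sub>M count_space UNIV"
proof (rule measurable_count_space_eq_countable[THEN iffD2, OF _ conjI], simp)
  show "\<forall>k\<in>UNIV. (\<lambda>X. size (filter_mset (\<lambda>x. x \<in> B) X)) -` {k} \<inter> space point_configs \<in> sets point_configs"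
  proof
    fix k :: nat
    have "{X. set_mset X \<subseteq> {0..1} \<and> size (filter_mset (\<lambda>x. x \<in> B) X) = k} \<in> sets point_configs"
      unfolding point_configs_def by (rule in_measure_of) (use assms in auto)
    then show "(\<lambda>X. size (filter_mset (\<lambda>x. x \<in> B) X)) -` {k} \<inter> space point_configs \<in> sets point_configs"
      by (rule back_subst[of "\<lambda>A. A \<in> sets point_configs"]) (auto simp: space_point_configs)
  qed
qed simp

lemma measurable_size_points: "size \<in> point_configs \<rightarrow>\<^sub>M count_space UNIV"
proof (rule measurable_cong[THEN iffD1, OF _ measurable_count_points[of "{0..1}"]])
  fix X assume "X \<in> space point_configs"
  then show "size (filter_mset (\<lambda>x. x \<in> {0..1}) X) = size X"
    by (subst filter_mset_cong[OF refl, of _ _ "\<lambda>_. True"]) (auto simp: space_point_configs)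
qed (auto simp: sets_restrict_space)

lemma measurable_order_stat: "(\<lambda>X. order_stat X i) \<in> point_configs \<rightarrow>\<^sub>M unit_borel"
proof (rule measurable_restrict_space2)
  show "(\<lambda>X. order_stat X i) \<in> space point_configs \<rightarrow> {0..1}"
  proof
    fix X assume X: "X \<in> space point_configs"
    show "order_stat X i \<in> {0..1}"
    proof (cases "i < size X")
      case True
      then have "sorted_list_of_multiset X ! i \<in> set (sorted_list_of_multiset X)"
        by (intro nth_mem) (metis mset_sorted_list_of_multiset size_mset)
      then show ?thesis using X True by (auto simp: order_stat_def space_point_configs)
    qed (simp add: order_stat_def)
  qed
  show "(\<lambda>X. order_stat X i) \<in> borel_measurable point_configs"
    unfolding borel_measurable_iff_le
  proof
    fix a :: real
    let ?B = "{0..1} \<inter> {..a}"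
    have B: "?B \<in> sets unit_borel" by (auto simp: sets_restrict_space)
    have "{X \<in> space point_configs. order_stat X i \<le> a} =
      {X \<in> space point_configs. (i < size X \<and> i < size (filter_mset (\<lambda>x. x \<in> ?B) X)) \<or> (\<not> i < size X \<and> 0 \<le> a)}"
    proof (rule Collect_cong, rule conj_cong[OF refl])
      fix X assume X: "X \<in> space point_configs"
      have "size (filter_mset (\<lambda>x. x \<in> ?B) X) = size (filter_mset (\<lambda>x. x \<le> a) X)"
        using X by (intro arg_cong[where f=size] filter_mset_cong) (auto simp: space_point_configs)
      also have "\<dots> = length (filter (\<lambda>x. x \<le> a) (sorted_list_of_multiset X))"
        by (metis mset_filter mset_sorted_list_of_multiset size_mset)
      finally show "(order_stat X i \<le> a) = ((i < size X \<and> i < size (filter_mset (\<lambda>x. x \<in> ?B) X)) \<or> (\<not> i < size X \<and> 0 \<le> a))"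
        using sorted_nth_le_iff[OF sorted_sorted_list_of_multiset, of i X a]
        by (auto simp: order_stat_def) (metis mset_sorted_list_of_multiset size_mset)+
    qed
    moreover have "{X \<in> space point_configs. i < size X} \<in> sets point_configs"
      using measurable_sets[OF measurable_size_points, of "{i<..}"]
      by (rule back_subst[of "\<lambda>A. A \<in> sets point_configs"]) auto
    moreover have "{X \<in> space point_configs. i < size (filter_mset (\<lambda>x. x \<in> ?B) X)} \<in> sets point_configs"
      using measurable_sets[OF measurable_count_points[OF B], of "{i<..}"]
      by (rule back_subst[of "\<lambda>A. A \<in> sets point_configs"]) auto
    ultimately show "{X \<in> space point_configs. order_stat X i \<le> a} \<in> sets point_configs"
      by auto
  qed
qed

definition reorder :: "nat \<Rightarrow> nat list \<Rightarrow> real multiset \<Rightarrow> nat \<Rightarrow> real" where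
  "reorder k \<pi> X = (\<lambda>i\<in>{..<k}. order_stat X (\<pi> ! i))"

lemma measurable_reorder: "reorder k \<pi> \<in> point_configs \<rightarrow>\<^sub>M Seq k unit_borel"
  unfolding reorder_def by (intro measurable_restrict measurable_order_stat)

lemma order_stat_points:
  obtains \<sigma> where "\<sigma> permutes {..<k}" "\<And>i. i < k \<Longrightarrow> order_stat (points k x) i = x (\<sigma> i)"
proof -
  let ?ys = "map x [0..<k]"
  have m: "mset ?ys = points k x"
    by (simp add: points_def atLeast0LessThan[symmetric] flip: mset_upt)
  obtain \<sigma> where \<sigma>: "\<sigma> permutes {..<length ?ys}" "permute_list \<sigma> ?ys = sorted_list_of_multiset (points k x)"
    using mset_eq_permutation[of "sorted_list_of_multiset (points k x)" ?ys] m by auto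
  have "order_stat (points k x) i = x (\<sigma> i)" if "i < k" for i
  proof -
    have "\<sigma> i < k" using permutes_in_image[OF \<sigma>(1), of i] that by simp
    moreover have "size (points k x) = k" by (simp add: points_def)
    ultimately show ?thesis
      using that \<sigma>(1) by (simp add: order_stat_def \<sigma>(2)[symmetric] permute_list_nth)
  qed
  then show thesis using that \<sigma>(1) by simp
qed

text \<open>The permutation that sorts x depends on x, but composing with it only rearranges the set
  of all permutations. Summing over all orders therefore removes it.\<close>

lemma sum_reorder_points:
  fixes F :: "(nat \<Rightarrow> real) \<Rightarrow> ennreal"
  shows "(\<Sum>\<pi>\<in>permutations_of_set {..<k}. F (reorder k \<pi> (points k x))) =
    (\<Sum>\<pi>\<in>permutations_of_set {..<k}. F (\<lambda>i\<in>{..<k}. x (\<pi> ! i)))"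
proof -
  obtain \<sigma> where \<sigma>: "\<sigma> permutes {..<k}" "\<And>i. i < k \<Longrightarrow> order_stat (points k x) i = x (\<sigma> i)"
    using order_stat_points by blast
  have r: "reorder k \<pi> (points k x) = (\<lambda>i\<in>{..<k}. x (map \<sigma> \<pi> ! i))" if "\<pi> \<in> permutations_of_set {..<k}" for \<pi>
  proof -
    have l: "length \<pi> = k" using length_finite_permutations_of_set[OF that] by simp
    have "\<pi> ! i < k" if "i < k" for i
      using nth_mem[of i \<pi>] permutations_of_setD(1)[OF \<open>\<pi> \<in> _\<close>] l that by auto
    then show ?thesis
      using \<sigma>(2) l by (auto simp: reorder_def restrict_def fun_eq_iff)
  qed
  have "(\<Sum>\<pi>\<in>permutations_of_set {..<k}. F (\<lambda>i\<in>{..<k}. x (\<pi> ! i))) =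
      (\<Sum>\<pi>\<in>map \<sigma> ` permutations_of_set {..<k}. F (\<lambda>i\<in>{..<k}. x (\<pi> ! i)))"
    by (simp add: permutations_of_set_image_permutes[OF \<sigma>(1)])
  also have "\<dots> = (\<Sum>\<pi>\<in>permutations_of_set {..<k}. F (\<lambda>i\<in>{..<k}. x (map \<sigma> \<pi> ! i)))"
    using permutes_inj[OF \<sigma>(1)] by (subst sum.reindex) (auto intro: inj_on_subset[OF inj_mapI])
  finally show ?thesis using r by simp
qed

lemma nth_permutations_of_set:
  assumes \<pi>: "\<pi> \<in> permutations_of_set {..<k}"
  shows "inj_on ((!) \<pi>) {..<k}" "(!) \<pi> \<in> {..<k} \<rightarrow> {..<k}"
proof -
  have l: "length \<pi> = k" using length_finite_permutations_of_set[OF \<pi>] by simp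
  show "inj_on ((!) \<pi>) {..<k}"
    using inj_on_nth[OF permutations_of_setD(2)[OF \<pi>], of "{..<k}"] l by simp
  show "(!) \<pi> \<in> {..<k} \<rightarrow> {..<k}"
    using nth_mem[of _ \<pi>] permutations_of_setD(1)[OF \<pi>] l by auto
qed

section \<open>From the Poisson process back to an iid sample\<close>

context resizing
begin

text \<open>The insertion kernels read positions, which a configuration does not have. Putting the
  sorted points in uniformly random order restores an iid sample given the number of points.\<close>

definition to_density :: "real multiset \<Rightarrow> (nat \<Rightarrow> real) measure" where
  "to_density X = measure_pmf (pmf_of_set (permutations_of_set {..<size X})) \<bind>
     (\<lambda>\<pi>. Q (size X) n (reorder (size X) \<pi> X))"

lemma to_density: "to_density \<in> kernels point_configs (Seq n unit_borel)"
  unfolding to_density_def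
  by (rule measurable_compose_countable[OF _ measurable_size_points, where
        f="\<lambda>k X. measure_pmf (pmf_of_set (permutations_of_set {..<k})) \<bind> (\<lambda>\<pi>. Q k n (reorder k \<pi> X))"])
     (intro measurable_bind_pmf_kernel measurable_compose[OF measurable_reorder Q])

lemma nn_integral_to_density:
  assumes h: "h \<in> borel_measurable (Seq n unit_borel)"
    and X: "points k x \<in> space point_configs"
  shows "(\<integral>\<^sup>+y. h y \<partial>to_density (points k x)) =
    (\<Sum>\<pi>\<in>permutations_of_set {..<k}. \<integral>\<^sup>+y. h y \<partial>Q k n (\<lambda>i\<in>{..<k}. x (\<pi> ! i))) / fact k"
proof -
  have k: "size (points k x) = k" by (simp add: points_def)
  have "(\<integral>\<^sup>+y. h y \<partial>to_density (points k x)) =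
    (\<integral>\<^sup>+\<pi>. \<integral>\<^sup>+y. h y \<partial>Q k n (reorder k \<pi> (points k x)) \<partial>measure_pmf (pmf_of_set (permutations_of_set {..<k})))"
    unfolding to_density_def k
    by (intro nn_integral_bind_law[OF pmf_law _ h])
       (auto intro!: measurable_space[OF Q] measurable_space[OF measurable_reorder] X)
  also have "\<dots> = (\<Sum>\<pi>\<in>permutations_of_set {..<k}. \<integral>\<^sup>+y. h y \<partial>Q k n (reorder k \<pi> (points k x))) / fact k"
    by (subst nn_integral_pmf_of_set) auto
  also have "(\<Sum>\<pi>\<in>permutations_of_set {..<k}. \<integral>\<^sup>+y. h y \<partial>Q k n (reorder k \<pi> (points k x))) =
     (\<Sum>\<pi>\<in>permutations_of_set {..<k}. \<integral>\<^sup>+y. h y \<partial>Q k n (\<lambda>i\<in>{..<k}. x (\<pi> ! i)))"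
    by (rule sum_reorder_points)
  finally show ?thesis .
qed

lemma tv_le_to_density:
  assumes f: "density_law f \<in> laws unit_borel"
    and step: "\<And>j. J \<le> j \<Longrightarrow> tv_le (ennreal \<eta>) (iid_law j f \<bind> \<kappa> j) (iid_law (Suc j) f)"
  shows "tv_le (ennreal (\<eta> * sqrt n)) (poisson_process_law n f \<bind> to_density) (iid_law n f)"
proof (rule tv_leI)
  let ?q = "poisson_pmf (real n)"
  have pf: "prob_space (density_law f)" using f by (simp add: space_prob_algebra)
  note I = iid_law_law[OF f] and pts = points_iid_law[OF f] and D = distr_points_law[OF f]
    and PP = poisson_law[OF f, of n]
  note I' = sets_law[OF I]
  fix h :: "(nat \<Rightarrow> real) \<Rightarrow> ennreal"
  assume h0: "h \<in> borel_measurable (poisson_process_law n f \<bind> to_density)" and h1: "\<And>x. h x \<le> 1"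
  have h: "h \<in> borel_measurable (Seq n unit_borel)"
    using h0 unfolding measurable_cong_sets[OF sets_law[OF bind_law[OF PP to_density]] refl] .
  define H where "H X = (integral\<^sup>N (to_density X) h)" for X
  have H: "H \<in> borel_measurable point_configs"
    unfolding H_def by (rule measurable_compose[OF measurable_prob_algebraD[OF to_density]
          nn_integral_measurable_subprob_algebra[OF h]])
  define G where "G k z = (integral\<^sup>N (Q k n z) h)" for k z
  have "G k \<in> borel_measurable (Seq k unit_borel)" for k
    unfolding G_def by (rule measurable_compose[OF measurable_prob_algebraD[OF Q]
          nn_integral_measurable_subprob_algebra[OF h]])
  then have G: "G k \<in> borel_measurable (Seq k (density_law f))" for k
    using I'[of k] unfolding iid_law_def by (simp cong: measurable_cong_sets)
  have "(integral\<^sup>N (poisson_process_law n f \<bind> to_density) h) = (integral\<^sup>N (poisson_process_law n f) H)"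
    unfolding H_def by (rule nn_integral_bind_law[OF PP to_density h])
  also have "\<dots> = (\<integral>\<^sup>+k. \<integral>\<^sup>+X. H X \<partial>distr (iid_law k f) point_configs (points k) \<partial>measure_pmf ?q)"
    unfolding poisson_process_law_def
    using D by (intro nn_integral_bind_law[OF pmf_law _ H]) simp
  also have "\<dots> = (\<integral>\<^sup>+k. \<integral>\<^sup>+z. h z \<partial>(iid_law k f \<bind> Q k n) \<partial>measure_pmf ?q)"
  proof (rule nn_integral_cong)
    fix k
    have "(fact k :: ennreal) = of_nat (fact k)" by simp
    then have fact_ne_0: "(fact k :: ennreal) \<noteq> 0" "(fact k :: ennreal) \<noteq> top"
      by (metis fact_nonzero of_nat_eq_0_iff, metis ennreal_of_nat_neq_top)
    have perm: "(\<lambda>x. \<lambda>i\<in>{..<k}. x (\<pi> ! i)) \<in> Seq k (density_law f) \<rightarrow>\<^sub>M Seq k (density_law f)"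
      if \<pi>: "\<pi> \<in> permutations_of_set {..<k}" for \<pi>
      using nth_permutations_of_set(2)[OF \<pi>] by (intro measurable_restrict measurable_component_singleton) auto
    have "(\<integral>\<^sup>+X. H X \<partial>distr (iid_law k f) point_configs (points k)) = (\<integral>\<^sup>+x. H (points k x) \<partial>iid_law k f)"
      by (rule nn_integral_distr[OF pts]) (use H in simp)
    also have "\<dots> = (\<integral>\<^sup>+x. (\<Sum>\<pi>\<in>permutations_of_set {..<k}. G k (\<lambda>i\<in>{..<k}. x (\<pi> ! i))) / fact k \<partial>iid_law k f)"
      unfolding H_def G_def
      by (intro nn_integral_cong nn_integral_to_density h measurable_space[OF pts])
    also have "\<dots> = (\<Sum>\<pi>\<in>permutations_of_set {..<k}. \<integral>\<^sup>+x. G k (\<lambda>i\<in>{..<k}. x (\<pi> ! i)) \<partial>iid_law k f) / fact k"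
      unfolding iid_law_def using measurable_compose[OF perm G]
      by (subst nn_integral_divide) (auto simp: nn_integral_sum)
    \<comment> \<open>Every rearrangement of an iid sample has the same law, so all summands agree
      and their number cancels the factorial.\<close>
    also have "\<dots> = (\<Sum>\<pi>\<in>permutations_of_set {..<k}. \<integral>\<^sup>+x. G k x \<partial>iid_law k f) / fact k"
      unfolding iid_law_def by (intro arg_cong2[where f="(/)"] sum.cong refl nn_integral_PiM_reindex nth_permutations_of_set pf G)
    also have "\<dots> = (integral\<^sup>N (iid_law k f) (G k))"
      using fact_ne_0 by (simp add: mult.commute[of "fact k"] mult_divide_eq_ennreal)
    also have "\<dots> = (integral\<^sup>N (iid_law k f \<bind> Q k n) h)"
      unfolding G_def by (rule nn_integral_bind_law[OF I Q h, symmetric])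
    finally show "(\<integral>\<^sup>+X. H X \<partial>distr (iid_law k f) point_configs (points k)) = (integral\<^sup>N (iid_law k f \<bind> Q k n) h)" .
  qed
  also have "\<dots> \<le> (\<integral>\<^sup>+k. (integral\<^sup>N (iid_law n f) h) + ennreal (\<eta> * \<bar>real k - real n\<bar>) \<partial>measure_pmf ?q)"
  proof (rule nn_integral_mono)
    fix k
    have "tv_le (ennreal (\<eta> * \<bar>real n - real k\<bar>)) (iid_law k f \<bind> Q k n) (iid_law n f)"
      using tv_le_resize_kernel[OF f \<kappa> step[unfolded iid_law_def] \<eta> J, of k n] by (simp add: iid_law_def)
    then have t: "tv_le (ennreal (\<eta> * \<bar>real k - real n\<bar>)) (iid_law k f \<bind> Q k n) (iid_law n f)"
      by (simp add: abs_minus_commute)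
    have "h \<in> borel_measurable (iid_law k f \<bind> Q k n)"
      using h unfolding measurable_cong_sets[OF sets_law[OF bind_law[OF I Q]] refl] .
    then show "(integral\<^sup>N (iid_law k f \<bind> Q k n) h) \<le> (integral\<^sup>N (iid_law n f) h) + ennreal (\<eta> * \<bar>real k - real n\<bar>)"
      by (rule tv_leD[OF t _ h1])
  qed
  also have "\<dots> = (integral\<^sup>N (iid_law n f) h) + (\<integral>\<^sup>+k. ennreal (\<eta> * \<bar>real k - real n\<bar>) \<partial>measure_pmf ?q)"
    by (simp add: nn_integral_add)
  also have "\<dots> \<le> (integral\<^sup>N (iid_law n f) h) + ennreal (\<eta> * sqrt n)"
    using n by (intro add_left_mono nn_integral_poisson_deviation \<eta>) simp
  finally show "(integral\<^sup>N (poisson_process_law n f \<bind> to_density) h) \<le> (integral\<^sup>N (iid_law n f) h) + ennreal (\<eta> * sqrt n)" .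
qed

lemma le_cam_dist_le:
  assumes f: "\<And>f. f \<in> \<Theta> \<Longrightarrow> density_law f \<in> laws unit_borel"
    and step: "\<And>f j. f \<in> \<Theta> \<Longrightarrow> J \<le> j \<Longrightarrow> tv_le (ennreal \<eta>) (iid_law j f \<bind> \<kappa> j) (iid_law (Suc j) f)"
  shows "le_cam_dist \<Theta> (density_experiment n) (poisson_experiment n) \<le> ennreal (\<eta> * sqrt n)"
proof -
  note I = iid_law_law[OF f] and PP = poisson_law[OF f]
  have "deficiency \<Theta> (density_experiment n) (poisson_experiment n) \<le> ennreal (\<eta> * sqrt n)"
    unfolding deficiency_def density_experiment_def poisson_experiment_def
  proof (rule INF_lower2[of to_poisson], goal_cases)
    case 2
    show ?case
      unfolding stat_experiment.simps
      by (rule SUP_least, rule tv_le_imp_tv_dist_le[OF tv_le_to_poisson])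
         (auto intro!: f step bind_law[OF I to_poisson] PP)
  qed (use to_poisson in simp)
  moreover have "deficiency \<Theta> (poisson_experiment n) (density_experiment n) \<le> ennreal (\<eta> * sqrt n)"
    unfolding deficiency_def density_experiment_def poisson_experiment_def
  proof (rule INF_lower2[of to_density], goal_cases)
    case 2
    show ?case
      unfolding stat_experiment.simps
      by (rule SUP_least, rule tv_le_imp_tv_dist_le[OF tv_le_to_density])
         (auto intro!: f step bind_law[OF PP to_density] I)
  qed (use to_density in simp)
  ultimately show ?thesis by (simp add: le_cam_dist_def)
qed

end

section \<open>Concentration of counts\<close>

lemma exp_le_quadratic:
  fixes s :: real
  assumes "\<bar>s\<bar> \<le> 1"
  shows "exp s \<le> 1 + s + s\<^sup>2"
proof (cases "0 \<le> s")
  case True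
  then show ?thesis using exp_bound[of s] assms by auto
next
  case False
  define x where "x = - s"
  have x: "0 < x" "x \<le> 1" using False assms by (auto simp: x_def)
  have "exp s = 1 / exp x" by (simp add: x_def exp_minus inverse_eq_divide)
  also have "\<dots> \<le> 1 / (1 + x)"
    using x exp_ge_add_one_self[of x] by (intro divide_left_mono) auto
  also have "\<dots> \<le> 1 - x + x\<^sup>2"
  proof -
    have "(1 - x + x\<^sup>2) * (1 + x) = 1 + x ^ 3"
      by (simp add: algebra_simps power2_eq_square power3_eq_cube)
    then show ?thesis using x by (simp add: divide_le_eq)
  qed
  finally show ?thesis by (simp add: x_def)
qed

definition hits :: "nat \<Rightarrow> 'a set \<Rightarrow> (nat \<Rightarrow> 'a) \<Rightarrow> nat" where
  "hits m A w = card {i. i < m \<and> w i \<in> A}"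

lemma hits_eq_sum: "real (hits m A w) = (\<Sum>i<m. indicator A (w i))"
proof -
  have "{i. i < m \<and> w i \<in> A} = {..<m} \<inter> {i. w i \<in> A}" by auto
  then show ?thesis by (simp add: hits_def indicator_def sum.If_cases of_bool_def)
qed

lemma measurable_hits:
  assumes "A \<in> sets S"
  shows "hits m A \<in> Seq m S \<rightarrow>\<^sub>M count_space UNIV"
proof -
  have "(\<lambda>w. \<Sum>i<m. indicator A (w i) :: real) \<in> borel_measurable (Seq m S)"
    using assms by (intro borel_measurable_sum measurable_compose[OF measurable_component_singleton] borel_measurable_indicator) auto
  then have *: "(\<lambda>w. real (hits m A w)) \<in> borel_measurable (Seq m S)"
    by (simp add: hits_eq_sum)
  have "hits m A = (\<lambda>w. nat \<lfloor>real (hits m A w)\<rfloor>)" by auto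
  moreover have "(\<lambda>w. nat \<lfloor>real (hits m A w)\<rfloor>) \<in> Seq m S \<rightarrow>\<^sub>M count_space UNIV"
    using * by measurable
  ultimately show ?thesis by simp
qed

text \<open>Chernoff's method. The parameter \<open>s\<close> may have either sign, so that one
  bound serves both tails; the linear term in the exponent cancels against the centring and only the
  quadratic one is left.\<close>

lemma hits_exponential_bound:
  fixes s a :: real
  assumes \<mu>: "prob_space \<mu>" and A[measurable]: "A \<in> sets \<mu>" and s: "\<bar>s\<bar> \<le> 1"
  shows "emeasure (Seq m \<mu>) {w \<in> space (Seq m \<mu>). a \<le> s * (hits m A w - m * measure \<mu> A)}
     \<le> ennreal (exp (m * measure \<mu> A * s\<^sup>2 - a))"
proof -
  interpret \<mu>: prob_space \<mu> by fact
  interpret PP: product_sigma_finite "\<lambda>_. \<mu>" ..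
  let ?P = "Seq m \<mu>"
  let ?p = "measure \<mu> A"
  let ?u = "\<lambda>w. \<Prod>i<m. ennreal (exp (s * indicator A (w i)))"
  have u: "?u w = ennreal (exp (s * hits m A w))" for w
    by (subst prod_ennreal) (simp_all only: hits_eq_sum sum_distrib_left exp_sum finite_lessThan exp_ge_zero)
  have meas: "(\<lambda>w. ennreal (exp (s * indicator A (w i)))) \<in> borel_measurable ?P" if "i < m" for i
    using that by (intro measurable_compose[OF measurable_component_singleton[of i]]) auto
  have um: "?u \<in> borel_measurable ?P"
    using meas by (intro borel_measurable_prod_ennreal) auto
  have one: "(\<integral>\<^sup>+x. ennreal (exp (s * indicator A x)) \<partial>\<mu>) \<le> ennreal (exp (?p * (s + s\<^sup>2)))"
  proof -
    have "(\<integral>\<^sup>+x. ennreal (exp (s * indicator A x)) \<partial>\<mu>) =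
       (\<integral>\<^sup>+x. ennreal (1 + (exp s - 1) * indicator A x) \<partial>\<mu>)"
      by (intro nn_integral_cong) (auto simp: indicator_def)
    also have "\<dots> = ennreal (\<integral>x. 1 + (exp s - 1) * indicator A x \<partial>\<mu>)"
    proof (rule nn_integral_eq_integral)
      show "integrable \<mu> (\<lambda>x. 1 + (exp s - 1) * indicator A x)"
        by (rule \<mu>.integrable_const_bound[of _ "exp s + 2"]) (auto simp: indicator_def abs_if)
    qed (auto simp: indicator_def)
    also have "(\<integral>x. 1 + (exp s - 1) * indicator A x \<partial>\<mu>) = 1 + (exp s - 1) * ?p"
      by (simp add: \<mu>.prob_space less_top[symmetric] \<mu>.emeasure_eq_measure)
    also have "\<dots> \<le> 1 + ?p * (s + s\<^sup>2)"
      using mult_left_mono[OF exp_le_quadratic[OF s], of ?p] by (simp add: algebra_simps)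
    also have "\<dots> \<le> exp (?p * (s + s\<^sup>2))" by (rule exp_ge_add_one_self)
    finally show ?thesis by (simp add: ennreal_leI)
  qed
  let ?c = "ennreal (exp (- s * m * ?p - a))"
  have "{w \<in> space ?P. a \<le> s * (hits m A w - m * ?p)} = {w \<in> space ?P. 1 \<le> ?c * ?u w} \<inter> space ?P"
  proof -
    have "a \<le> s * (hits m A w - m * ?p) \<longleftrightarrow> 1 \<le> ?c * ?u w" for w
    proof -
      have "?c * ?u w = ennreal (exp (s * (hits m A w - m * ?p) - a))"
        unfolding u by (simp add: algebra_simps exp_add[symmetric] flip: ennreal_mult')
      then show ?thesis by simp
    qed
    then show ?thesis by auto
  qed
  then have "emeasure ?P {w \<in> space ?P. a \<le> s * (hits m A w - m * ?p)} \<le> ?c * (\<integral>\<^sup>+w. ?u w * indicator (space ?P) w \<partial>?P)"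
    using nn_integral_Markov_inequality[of ?u "space ?P" ?P ?c] borel_measurable_times_ennreal[OF um borel_measurable_indicator[OF sets.top]]
    by (simp add: Int_absorb1 del: prod_ennreal)
  also have "(\<integral>\<^sup>+w. ?u w * indicator (space ?P) w \<partial>?P) = (\<integral>\<^sup>+w. ?u w \<partial>?P)"
    by (intro nn_integral_cong) simp
  also have "\<dots> = (\<Prod>i<m. \<integral>\<^sup>+x. ennreal (exp (s * indicator A x)) \<partial>\<mu>)"
    by (rule PP.product_nn_integral_prod[of "{..<m}" "\<lambda>_ x. ennreal (exp (s * indicator A x))"]) auto
  also have "\<dots> \<le> (\<Prod>i<m. ennreal (exp (?p * (s + s\<^sup>2))))"
    using one by (intro prod_mono_ennreal) auto
  also have "\<dots> = ennreal (exp (m * (?p * (s + s\<^sup>2))))"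
    by (simp add: ennreal_power exp_of_nat_mult)
  also have "?c * \<dots> = ennreal (exp (m * ?p * s\<^sup>2 - a))"
    by (simp add: algebra_simps exp_add[symmetric] flip: ennreal_mult')
  finally show ?thesis by (simp add: mult_left_mono)
qed

lemma hits_deviation:
  fixes t :: real
  assumes \<mu>: "prob_space \<mu>" and A: "A \<in> sets \<mu>" and t: "0 \<le> t"
  shows "emeasure (Seq m \<mu>) {w \<in> space (Seq m \<mu>).
            t * (1 + sqrt (m * measure \<mu> A)) \<le> \<bar>hits m A w - m * measure \<mu> A\<bar>}
     \<le> ennreal (2 * exp (1 - t))"
proof -
  let ?P = "Seq m \<mu>"
  define q where "q = m * measure \<mu> A"
  have q: "0 \<le> q" by (simp add: q_def)
  \<comment> \<open>A balanced choice for both small and large mean q: it keeps q s^2 \<le> 1 and s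
    \<le> 1, while s (1 + sqrt q) \<ge> 1 turns the deviation into at least t.\<close>
  define s where "s = 1 / max 1 (sqrt q)"
  have s: "0 < s" "s \<le> 1" "\<bar>- s\<bar> \<le> 1" "\<bar>s\<bar> \<le> 1" by (auto simp: s_def divide_simps)
  have qs: "q * s\<^sup>2 \<le> 1"
  proof -
    have "q \<le> (max 1 (sqrt q))\<^sup>2" using q by (metis max.cobounded2 power_mono real_sqrt_ge_zero real_sqrt_pow2)
    then show ?thesis by (simp add: s_def power_divide divide_le_eq)
  qed
  have ts: "t \<le> s * (t * (1 + sqrt q))"
  proof -
    have "1 \<le> s * (1 + sqrt q)" using q by (simp add: s_def le_divide_eq)
    from mult_left_mono[OF this t] show ?thesis by (simp add: ac_simps)
  qed
  have hm: "hits m A \<in> ?P \<rightarrow>\<^sub>M count_space UNIV" by (rule measurable_hits[OF A])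
  have m1: "{w \<in> space ?P. t \<le> s * (hits m A w - q)} \<in> sets ?P" 
    using hm by measurable
  have m2: "{w \<in> space ?P. t \<le> - s * (hits m A w - q)} \<in> sets ?P"
    using hm by measurable
  have "{w \<in> space ?P. t * (1 + sqrt q) \<le> \<bar>hits m A w - q\<bar>} \<subseteq>
      {w \<in> space ?P. t \<le> s * (hits m A w - q)} \<union> {w \<in> space ?P. t \<le> - s * (hits m A w - q)}"
  proof
    fix w assume "w \<in> {w \<in> space ?P. t * (1 + sqrt q) \<le> \<bar>hits m A w - q\<bar>}"
    then have w: "w \<in> space ?P" "t * (1 + sqrt q) \<le> \<bar>hits m A w - q\<bar>" by auto
    have "t \<le> s * \<bar>hits m A w - q\<bar>"
      using ts mult_left_mono[OF w(2), of s] s by linarith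
    then show "w \<in> {w \<in> space ?P. t \<le> s * (hits m A w - q)} \<union> {w \<in> space ?P. t \<le> - s * (hits m A w - q)}"
      using w(1) by (auto simp: abs_if algebra_simps split: if_splits)
  qed
  then have "emeasure ?P {w \<in> space ?P. t * (1 + sqrt q) \<le> \<bar>hits m A w - q\<bar>} \<le>
     emeasure ?P ({w \<in> space ?P. t \<le> s * (hits m A w - q)} \<union> {w \<in> space ?P. t \<le> - s * (hits m A w - q)})"
    using m1 m2 by (intro emeasure_mono sets.Un) auto
  also have "\<dots> \<le> emeasure ?P {w \<in> space ?P. t \<le> s * (hits m A w - q)} + emeasure ?P {w \<in> space ?P. t \<le> - s * (hits m A w - q)}"
    using m1 m2 by (rule emeasure_subadditive)
  also have "\<dots> \<le> ennreal (exp (q * s\<^sup>2 - t)) + ennreal (exp (q * s\<^sup>2 - t))"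
    using hits_exponential_bound[OF \<mu> A s(4), of m t] hits_exponential_bound[OF \<mu> A s(3), of m t]
    unfolding q_def by (intro add_mono) auto
  also have "\<dots> = ennreal (2 * exp (q * s\<^sup>2 - t))"
    by (simp flip: ennreal_plus)
  also have "\<dots> \<le> ennreal (2 * exp (1 - t))"
    using qs by (intro ennreal_leI) simp
  finally show ?thesis by (simp add: q_def)
qed

section \<open>Selecting a density compatible with the counts\<close>

definition hit_vector :: "'i set \<Rightarrow> ('i \<Rightarrow> 'a set) \<Rightarrow> nat \<Rightarrow> (nat \<Rightarrow> 'a) \<Rightarrow> 'i \<Rightarrow> nat" where
  "hit_vector I D m w = (\<lambda>i\<in>I. hits m (D i) w)"

text \<open>Each count is at most m, so the vector has finitely many values and any function of it
  is measurable. This admits a function defined by the choice operator.\<close>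

lemma measurable_hit_vector_compose:
  assumes I: "finite I" and D: "\<And>i. i \<in> I \<Longrightarrow> D i \<in> sets S" and F: "\<And>c. F c \<in> space N"
  shows "(\<lambda>w. F (hit_vector I D m w)) \<in> Seq m S \<rightarrow>\<^sub>M N"
proof -
  let ?P = "Seq m S"
  let ?R = "PiE I (\<lambda>_. {..m})"
  have fin: "finite ?R" using I by (intro finite_PiE) auto
  have "hit_vector I D m \<in> ?P \<rightarrow>\<^sub>M count_space ?R"
  proof (rule measurable_count_space_eq_countable[THEN iffD2, OF _ conjI])
    show "countable ?R" using fin by (rule countable_finite)
    have "hits m (D i) w \<le> m" for i w
      unfolding hits_def using card_mono[of "{..<m}" "{i'. i' < m \<and> w i' \<in> D i}"] by auto
    then show "hit_vector I D m \<in> space ?P \<rightarrow> ?R" by (auto simp: hit_vector_def)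
    show "\<forall>c\<in>?R. hit_vector I D m -` {c} \<inter> space ?P \<in> sets ?P"
    proof
      fix c assume c: "c \<in> ?R"
      have "hit_vector I D m -` {c} \<inter> space ?P = {w \<in> space ?P. \<forall>i\<in>I. hits m (D i) w = c i}"
        using c by (auto simp: hit_vector_def PiE_def extensional_def fun_eq_iff)
      also have "\<dots> \<in> sets ?P"
      proof (rule sets.sets_Collect_finite_All[OF _ I])
        fix i assume "i \<in> I"
        then have "hits m (D i) -` {c i} \<inter> space ?P \<in> sets ?P"
          using measurable_sets[OF measurable_hits[OF D]] by auto
        then show "{w \<in> space ?P. hits m (D i) w = c i} \<in> sets ?P"
          by (rule back_subst[of "\<lambda>A. A \<in> sets ?P"]) auto
      qed
      finally show "hit_vector I D m -` {c} \<inter> space ?P \<in> sets ?P" .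
    qed
  qed
  then show ?thesis
    by (rule measurable_compose) (use F in auto)
qed

text \<open>The tolerance follows the standard deviation of the count, as in a Bernstein inequality.
  Intervals of small mass are thus estimated more accurately, which is needed where the densities
  are small.\<close>

definition compatible ::
    "'i set \<Rightarrow> ('i \<Rightarrow> real set) \<Rightarrow> nat \<Rightarrow> real \<Rightarrow> ('i \<Rightarrow> nat) \<Rightarrow> (real \<Rightarrow> real) \<Rightarrow> bool" where
  "compatible I D m t c f \<longleftrightarrow> (\<forall>i\<in>I. \<bar>real (c i) - m * measure (density_law f) (D i)\<bar> \<le>
      t * (1 + sqrt (m * measure (density_law f) (D i))))"

lemma compatible_hit_vector:
  fixes m :: nat
  assumes f: "density_law f \<in> laws unit_borel"
    and I: "finite I" and D: "\<And>i. i \<in> I \<Longrightarrow> D i \<in> sets unit_borel" and t: "0 \<le> t"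
  defines "G \<equiv> {w \<in> space (Seq m unit_borel). compatible I D m t (hit_vector I D m w) f}"
  shows "G \<in> sets (Seq m unit_borel)"
    and "emeasure (iid_law m f) (space (Seq m unit_borel) - G) \<le> ennreal (2 * card I * exp (1 - t))"
proof -
  let ?S = "Seq m unit_borel"
  let ?p = "\<lambda>i. measure (density_law f) (D i)"
  have pf: "prob_space (density_law f)" and sf: "sets (density_law f) = sets unit_borel"
    using f by (auto simp: space_prob_algebra)
  note sP = sets_law[OF iid_law_law[OF f]]
  define E where "E i = {w \<in> space ?S. t * (1 + sqrt (m * ?p i)) \<le> \<bar>hits m (D i) w - m * ?p i\<bar>}" for i
  have hm[measurable]: "hits m (D i) \<in> ?S \<rightarrow>\<^sub>M count_space UNIV" if "i \<in> I" for i
    by (rule measurable_hits[OF D[OF that]])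
  have E: "E i \<in> sets ?S" if "i \<in> I" for i
    unfolding E_def using hm[OF that] by measurable
  have "G = {w \<in> space ?S. \<forall>i\<in>I. \<bar>hits m (D i) w - m * ?p i\<bar> \<le> t * (1 + sqrt (m * ?p i))}"
    by (simp add: G_def compatible_def hit_vector_def)
  also have "\<dots> \<in> sets ?S"
  proof (rule sets.sets_Collect_finite_All[OF _ I])
    fix i assume "i \<in> I"
    from hm[OF this] show "{w \<in> space ?S. \<bar>hits m (D i) w - m * ?p i\<bar> \<le> t * (1 + sqrt (m * ?p i))} \<in> sets ?S"
      by measurable
  qed
  finally show G: "G \<in> sets ?S" .
  have "space ?S - G \<subseteq> (\<Union>i\<in>I. E i)"
    by (auto simp: G_def compatible_def hit_vector_def E_def)
  then have "emeasure (iid_law m f) (space ?S - G) \<le> emeasure (iid_law m f) (\<Union>i\<in>I. E i)"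
    using E I by (intro emeasure_mono) (auto simp: sP)
  also have "\<dots> \<le> (\<Sum>i\<in>I. emeasure (iid_law m f) (E i))"
    using E I by (intro emeasure_subadditive_finite) (auto simp: sP)
  also have "\<dots> \<le> (\<Sum>i\<in>I. ennreal (2 * exp (1 - t)))"
  proof (rule sum_mono)
    fix i assume "i \<in> I"
    then show "emeasure (iid_law m f) (E i) \<le> ennreal (2 * exp (1 - t))"
      using hits_deviation[OF pf, of "D i" t m] t D sets_eq_imp_space_eq[OF sP]
      by (simp add: E_def iid_law_def sf)
  qed
  also have "\<dots> = ennreal (2 * card I * exp (1 - t))"
    by (simp add: ennreal_of_nat_eq_real_of_nat ac_simps flip: ennreal_mult')
  finally show "emeasure (iid_law m f) (space ?S - G) \<le> ennreal (2 * card I * exp (1 - t))" .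
qed

section \<open>Local analysis of flat densities\<close>

lemma nth_deriv_Suc_left:
  "nth_deriv j (\<lambda>x. vector_derivative f (at x within {0..1})) = nth_deriv (Suc j) f"
  by (simp add: nth_deriv_def funpow_Suc_right del: funpow.simps)

text \<open>Induction on k: the derivative of the remainder of f is the remainder of f' of one order
  less, and the mean value inequality on the segment from x to y gains one power of |y - x|. The
  smaller constant that integration would give is not pursued.\<close>

lemma taylor_remainder_bound:
  fixes f :: "real \<Rightarrow> real"
  assumes "has_nth_deriv k f" and "0 \<le> a" and x: "x \<in> {0..1}"
    and "\<And>y. y \<in> {0..1} \<Longrightarrow> \<bar>nth_deriv k f y - nth_deriv k f x\<bar> \<le> M * \<bar>y - x\<bar> powr a"
    and "y \<in> {0..1}"
  shows "\<bar>f y - (\<Sum>j\<le>k. nth_deriv j f x / fact j * (y - x) ^ j)\<bar> \<le> M * \<bar>y - x\<bar> powr (k + a)"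
  using assms(1,4,5)
proof (induction k arbitrary: f y)
  case 0
  from 0(2)[OF 0(3)] show ?case by (simp add: nth_deriv_def)
next
  case (Suc k)
  let ?g = "\<lambda>x. vector_derivative f (at x within {0..1})"
  let ?E = "\<lambda>y. f y - (\<Sum>j\<le>Suc k. nth_deriv j f x / fact j * (y - x) ^ j)"
  let ?E' = "\<lambda>y. ?g y - (\<Sum>j\<le>k. nth_deriv j ?g x / fact j * (y - x) ^ j)"
  have g: "has_nth_deriv k ?g"
    using Suc.prems(1) unfolding has_nth_deriv_def nth_deriv_Suc_left by auto
  have IH: "\<bar>?E' z\<bar> \<le> M * \<bar>z - x\<bar> powr (k + a)" if "z \<in> {0..1}" for z
    by (rule Suc.IH[OF g _ that]) (use Suc.prems(2) in \<open>simp add: nth_deriv_Suc_left\<close>)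
  have M: "0 \<le> M"
  proof -
    \<comment> \<open>Any point of the interval other than x shows that the Hoelder bound has a
      nonnegative constant.\<close>
    define y where "y = (if x = 0 then 1 else 0 :: real)"
    have y: "y \<in> {0..1}" "y \<noteq> x" by (auto simp: y_def)
    have "0 \<le> M * \<bar>y - x\<bar> powr a" using Suc.prems(2)[OF y(1)] by linarith
    then show ?thesis using y(2) by (simp add: zero_le_mult_iff not_le)
  qed
  have f': "(f has_field_derivative ?g z) (at z within {0..1})" if "z \<in> {0..1}" for z
  proof -
    have "f differentiable (at z within {0..1})"
      using Suc.prems(1) that by (auto simp: has_nth_deriv_def differentiable_on_def nth_deriv_def dest!: spec[of _ 0])
    then show ?thesis
      by (simp add: has_real_derivative_iff_has_vector_derivative vector_derivative_works)
  qed
  have deriv: "(?E has_field_derivative ?E' z) (at z within {0..1})" if "z \<in> {0..1}" for z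
  proof -
    have "((\<lambda>y. \<Sum>j\<le>Suc k. nth_deriv j f x / fact j * (y - x) ^ j) has_field_derivative
        (\<Sum>j\<le>Suc k. nth_deriv j f x / fact j * (real j * (z - x) ^ (j - 1)))) (at z within {0..1})"
    proof (intro DERIV_sum DERIV_cmult)
      fix j
      show "((\<lambda>y. (y - x) ^ j) has_field_derivative real j * (z - x) ^ (j - 1)) (at z within {0..1})"
        by (auto intro!: derivative_eq_intros)
    qed
    also have "(\<Sum>j\<le>Suc k. nth_deriv j f x / fact j * (real j * (z - x) ^ (j - 1))) =
        (\<Sum>j\<le>k. nth_deriv (Suc j) f x / fact (Suc j) * (real (Suc j) * (z - x) ^ j))"
      by (subst sum.atMost_Suc_shift) simp
    also have "\<dots> = (\<Sum>j\<le>k. nth_deriv j ?g x / fact j * (z - x) ^ j)"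
      by (intro sum.cong) (simp_all add: nth_deriv_Suc_left field_simps del: of_nat_Suc)
    finally show ?thesis by (intro DERIV_diff f' that)
  qed
  let ?S = "closed_segment x y"
  have S: "?S \<subseteq> {0..1}"
    using x Suc.prems(3) by (intro closed_segment_subset) auto
  have "norm (?E y - ?E x) \<le> M * \<bar>y - x\<bar> powr (k + a) * norm (y - x)"
  proof (rule field_differentiable_bound[where S="?S" and f'="?E'"])
    fix z assume z: "z \<in> ?S"
    show "(?E has_field_derivative ?E' z) (at z within ?S)"
      using deriv z S by (intro DERIV_subset[OF deriv S]) auto
    have "\<bar>z - x\<bar> \<le> \<bar>y - x\<bar>" using z by (auto simp: closed_segment_eq_real_ivl split: if_splits)
    then have "M * \<bar>z - x\<bar> powr (k + a) \<le> M * \<bar>y - x\<bar> powr (k + a)"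
      using M \<open>0 \<le> a\<close> by (intro mult_left_mono powr_mono2) auto
    then show "norm (?E' z) \<le> M * \<bar>y - x\<bar> powr (k + a)"
      using IH[of z] z S by (force simp del: of_nat_Suc)
  qed (auto simp: convex_closed_segment)
  moreover have "?E x = 0"
    by (subst sum.atMost_Suc_shift) (simp add: nth_deriv_def)
  moreover have "\<bar>y - x\<bar> powr (k + a) * norm (y - x) = \<bar>y - x\<bar> powr (Suc k + a)"
    by (cases "y = x") (auto simp: powr_add field_simps)
  ultimately show ?case by (simp only: real_norm_def diff_0_right mult.assoc)
qed

text \<open>Lagrange interpolation at the k + 1 nodes: each basis polynomial is a product of k
  quotients, each at most h / \<delta> in absolute value at x.\<close>

lemma interpolation_bound:
  fixes p :: "real poly" and \<xi> :: "nat \<Rightarrow> real"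
  assumes deg: "degree p \<le> k" and e: "\<And>i. i \<le> k \<Longrightarrow> \<bar>poly p (\<xi> i)\<bar> \<le> e"
    and sep: "\<And>i j. i \<le> k \<Longrightarrow> j \<le> k \<Longrightarrow> i \<noteq> j \<Longrightarrow> \<delta> \<le> \<bar>\<xi> i - \<xi> j\<bar>" and \<delta>: "0 < \<delta>"
    and near: "\<And>i. i \<le> k \<Longrightarrow> \<bar>x - \<xi> i\<bar> \<le> h"
  shows "\<bar>poly p x\<bar> \<le> (real k + 1) * (h / \<delta>) ^ k * e"
proof -
  define l where "l i = (\<Prod>j\<in>{..k} - {i}. smult (1 / (\<xi> i - \<xi> j)) [:- \<xi> j, 1:])" for i
  define L where "L = (\<Sum>i\<le>k. smult (poly p (\<xi> i)) (l i))"
  have l: "poly (l i) y = (\<Prod>j\<in>{..k} - {i}. (y - \<xi> j) / (\<xi> i - \<xi> j))" for i y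
    by (simp add: l_def poly_prod diff_divide_distrib)
  have lx: "poly (l i) (\<xi> m) = (if i = m then 1 else 0)" if "i \<le> k" "m \<le> k" for i m
  proof (cases "i = m")
    case True
    have "\<xi> m \<noteq> \<xi> j" if "j \<in> {..k} - {m}" for j
      using sep[of m j] that \<open>m \<le> k\<close> \<delta> by auto
    then have "(\<Prod>j\<in>{..k} - {m}. (\<xi> m - \<xi> j) / (\<xi> m - \<xi> j)) = 1"
      by (intro prod.neutral) auto
    then show ?thesis by (simp add: l True)
  next
    case False
    then have "m \<in> {..k} - {i}" using that by auto
    then have "(\<Prod>j\<in>{..k} - {i}. (\<xi> m - \<xi> j) / (\<xi> i - \<xi> j)) = 0"
      by (intro prod_zero) auto
    then show ?thesis by (simp add: l False)
  qed
  have inj: "inj_on \<xi> {..k}"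
  proof (rule inj_onI)
    fix i j assume "i \<in> {..k}" "j \<in> {..k}" "\<xi> i = \<xi> j"
    then show "i = j" using sep[of i j] \<delta> by auto
  qed
  have degL: "degree L \<le> k"
    unfolding L_def
  proof (rule degree_sum_le)
    fix i assume i: "i \<in> {..k}"
    have "degree (l i) \<le> (\<Sum>j\<in>{..k} - {i}. degree (smult (1 / (\<xi> i - \<xi> j)) [:- \<xi> j, 1:]))"
      unfolding l_def using degree_prod_sum_le[of "{..k} - {i}" "\<lambda>j. smult (1 / (\<xi> i - \<xi> j)) [:- \<xi> j, 1:]"] by (simp add: o_def)
    also have "\<dots> \<le> (\<Sum>j\<in>{..k} - {i}. 1)"
      by (intro sum_mono order_trans[OF degree_smult_le]) simp
    also have "\<dots> = k" using i by simp
    finally show "degree (smult (poly p (\<xi> i)) (l i)) \<le> k"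
      using degree_smult_le order_trans by blast
  qed simp
  have "p = L"
  proof (rule poly_eqI_degree)
    fix y assume "y \<in> \<xi> ` {..k}"
    then obtain m where m: "m \<le> k" "y = \<xi> m" by auto
    have "poly L y = (\<Sum>i\<le>k. poly p (\<xi> i) * (if i = m then 1 else 0))"
      unfolding L_def poly_sum m(2) by (intro sum.cong) (auto simp: lx m(1))
    also have "\<dots> = (\<Sum>i\<le>k. if i = m then poly p (\<xi> i) else 0)" by (intro sum.cong) auto
    also have "\<dots> = poly p y" using m by (simp add: sum.delta)
    finally show "poly p y = poly L y" ..
  qed (use deg degL card_image[OF inj] in auto)
  have h: "0 \<le> h" using near[of 0] by linarith
  have e0: "0 \<le> e" using e[of 0] by linarith
  have lb: "\<bar>poly (l i) x\<bar> \<le> (h / \<delta>) ^ k" if "i \<le> k" for i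
  proof -
    have "\<bar>poly (l i) x\<bar> = (\<Prod>j\<in>{..k} - {i}. \<bar>x - \<xi> j\<bar> / \<bar>\<xi> i - \<xi> j\<bar>)"
      by (simp add: l abs_prod)
    also have "\<dots> \<le> (\<Prod>j\<in>{..k} - {i}. h / \<delta>)"
      using near sep that \<delta> h by (intro prod_mono conjI frac_le) auto
    also have "\<dots> = (h / \<delta>) ^ k" using that by simp
    finally show ?thesis .
  qed
  have "\<bar>poly p x\<bar> = \<bar>\<Sum>i\<le>k. poly p (\<xi> i) * poly (l i) x\<bar>"
    by (subst \<open>p = L\<close>) (simp add: L_def poly_sum)
  also have "\<dots> \<le> (\<Sum>i\<le>k. \<bar>poly p (\<xi> i)\<bar> * \<bar>poly (l i) x\<bar>)"
    by (rule order_trans[OF sum_abs]) (simp add: abs_mult)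
  also have "\<dots> \<le> (\<Sum>i\<le>k. e * (h / \<delta>) ^ k)"
    using e lb e0 by (intro sum_mono mult_mono) auto
  finally show ?thesis by (simp add: ac_simps)
qed

section \<open>Masses of intervals\<close>

lemma integral_mean_value:
  fixes d :: "real \<Rightarrow> real"
  assumes "a < b" "continuous_on {a..b} d"
  obtains \<xi> where "\<xi> \<in> {a..b}" "integral {a..b} d = d \<xi> * (b - a)"
proof -
  let ?F = "\<lambda>t. integral {a..t} d"
  have der: "(?F has_real_derivative d t) (at t within {a..b})" if "t \<in> {a..b}" for t
    by (rule integral_has_real_derivative[OF assms(2) that])
  have "\<exists>\<xi>\<in>{a<..<b}. ?F b - ?F a = d \<xi> * (b - a)"
    by (rule mvt_simple[OF assms(1), where f'="\<lambda>t y. d t * y"])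
       (use der in \<open>auto simp: has_field_derivative_def\<close>)
  then obtain \<xi> where "\<xi> \<in> {a<..<b}" "?F b - ?F a = d \<xi> * (b - a)" by blast
  then show thesis using that[of \<xi>] by simp
qed

lemma measure_density_law_interval:
  assumes cont: "continuous_on {0..1} f" and nn: "\<And>x. x \<in> {0..1} \<Longrightarrow> 0 \<le> f x"
    and ab: "0 \<le> a" "b \<le> 1"
  shows "measure (density_law f) {a..b} = integral {a..b} f"
proof -
  have sub: "{a..b} \<subseteq> {0..1}" using ab by auto
  have meas: "f \<in> borel_measurable (restrict_space lborel {0..1})"
    using borel_measurable_continuous_on_restrict[OF cont]
    by (simp cong: measurable_cong_sets sets_restrict_space_cong)
  have int: "set_integrable lborel {a..b} f"
    by (rule borel_integrable_atLeastAtMost') (rule continuous_on_subset[OF cont sub])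
  have "{a..b} \<in> sets (restrict_space lborel {0..1})"
    using sub by (auto simp: sets_restrict_space intro: image_eqI[of _ _ "{a..b}"])
  then have "emeasure (density_law f) {a..b} = (\<integral>\<^sup>+x. ennreal (f x) * indicator {a..b} x \<partial>restrict_space lborel {0..1})"
    unfolding density_law_def using meas by (subst emeasure_density) auto
  also have "\<dots> = (\<integral>\<^sup>+x. ennreal (indicator {a..b} x *\<^sub>R f x) \<partial>lborel)"
    using sub by (subst nn_integral_restrict_space)
       (auto intro!: nn_integral_cong simp: indicator_def)
  also have "\<dots> = ennreal (LINT x:{a..b}|lborel. f x)"
    unfolding set_lebesgue_integral_def
    using int sub nn
    by (intro nn_integral_eq_integral)
       (auto simp: set_integrable_def indicator_def)
  also have "(LINT x:{a..b}|lborel. f x) = integral {a..b} f"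
    by (rule set_borel_integral_eq_integral(2)[OF int])
  finally have "emeasure (density_law f) {a..b} = ennreal (integral {a..b} f)" .
  moreover have "0 \<le> integral {a..b} f"
    using nn sub by (intro integral_nonneg integrable_continuous_real continuous_on_subset[OF cont sub]) auto
  ultimately show ?thesis by (simp add: measure_def)
qed

text \<open>The last bound is the \<beta>-th root of the flatness condition, |f^(j)|^\<beta> \<le>
  R^j f^(\<beta> - j). Taking M \<ge> 1 absorbs the resulting factor R^(j / \<beta>), because j <
  \<beta>.\<close>

lemma flat_densitiesD:
  fixes \<beta> R :: real
  assumes f: "f \<in> flat_densities \<beta> R" and \<beta>: "0 < \<beta>" 
  defines "M \<equiv> max 1 R"
  shows "\<And>x. x \<in> {0..1} \<Longrightarrow> 0 \<le> f x"
    and "\<And>x. x \<in> {0..1} \<Longrightarrow> f x \<le> M"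
    and "continuous_on {0..1} f"
    and "has_nth_deriv (strict_floor \<beta>) f"
    and "\<And>x y. x \<in> {0..1} \<Longrightarrow> y \<in> {0..1} \<Longrightarrow>
      \<bar>nth_deriv (strict_floor \<beta>) f y - nth_deriv (strict_floor \<beta>) f x\<bar> \<le> M * \<bar>y - x\<bar> powr (\<beta> - strict_floor \<beta>)"
    and "\<And>x j. x \<in> {0..1} \<Longrightarrow> j \<le> strict_floor \<beta> \<Longrightarrow> \<bar>nth_deriv j f x\<bar> \<le> M * f x powr (1 - j / \<beta>)"
proof -
  have fH: "f \<in> holder_densities \<beta> R" and fn: "flat_norm \<beta> f \<le> ennreal R"
    using f by (auto simp: flat_densities_def)
  have M: "1 \<le> M" "R \<le> M" by (auto simp: M_def)
  show nn: "0 \<le> f x" if "x \<in> {0..1}" for x using fH that by (auto simp: holder_densities_def)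
  show "continuous_on {0..1} f" by (rule holder_densities_continuous[OF \<beta> fH])
  show "has_nth_deriv (strict_floor \<beta>) f" using fH by (auto simp: holder_densities_def)
  have le: "a \<le> a + b" "b \<le> a + b" for a b :: ennreal by auto
  have s1: "sup_norm f \<le> ennreal R"
    using fn unfolding flat_norm_def holder_norm_def by (meson le order_trans)
  have s2: "holder_seminorm \<beta> f \<le> ennreal R"
    using fn unfolding flat_norm_def holder_norm_def by (meson le order_trans)
  have s3: "flat_seminorm \<beta> f \<le> ennreal R"
    using fn unfolding flat_norm_def by (meson le order_trans)
  \<comment> \<open>The sign of R is not among the hypotheses. A negative R becomes 0 in
    \<open>ennreal\<close> and would force f to vanish on the unit interval, against its integral
    1.\<close>
  have R0: "0 \<le> R"
  proof (rule ccontr)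
    assume "\<not> 0 \<le> R"
    then have "ennreal R = 0" by (simp add: ennreal_neg)
    moreover have "ennreal \<bar>f x\<bar> \<le> ennreal R" if "x \<in> {0..1}" for x
      using s1 that unfolding sup_norm_def by (meson SUP_upper order_trans)
    ultimately have "f x = 0" if "x \<in> {0..1}" for x
      using that by (metis abs_ge_zero abs_eq_0_iff ennreal_eq_0_iff le_zero_eq order_antisym)
    then have "indicator {0..1} x *\<^sub>R f x = 0" for x by (simp add: indicator_def)
    then have "(LINT x:{0..1}|lborel. f x) = 0"
      by (simp only: set_lebesgue_integral_def Bochner_Integration.integral_zero)
    then show False using fH by (simp add: holder_densities_def)
  qed
  show fM: "f x \<le> M" if "x \<in> {0..1}" for x
  proof -
    have "ennreal \<bar>f x\<bar> \<le> ennreal R"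
      using s1 that unfolding sup_norm_def by (meson SUP_upper order_trans)
    then show ?thesis using R0 M by (auto simp: ennreal_le_iff)
  qed
  show "\<bar>nth_deriv (strict_floor \<beta>) f y - nth_deriv (strict_floor \<beta>) f x\<bar> \<le> M * \<bar>y - x\<bar> powr (\<beta> - strict_floor \<beta>)"
    if "x \<in> {0..1}" "y \<in> {0..1}" for x y
  proof (cases "x = y")
    case False
    have "ennreal (\<bar>nth_deriv (strict_floor \<beta>) f y - nth_deriv (strict_floor \<beta>) f x\<bar> / \<bar>y - x\<bar> powr (\<beta> - strict_floor \<beta>)) \<le> holder_seminorm \<beta> f"
      unfolding holder_seminorm_def using that False by (intro SUP_upper2[of "(y, x)"]) auto
    also note s2
    finally have "\<bar>nth_deriv (strict_floor \<beta>) f y - nth_deriv (strict_floor \<beta>) f x\<bar> / \<bar>y - x\<bar> powr (\<beta> - strict_floor \<beta>) \<le> R"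
      using R0 by (simp add: ennreal_le_iff)
    then have "\<bar>nth_deriv (strict_floor \<beta>) f y - nth_deriv (strict_floor \<beta>) f x\<bar> \<le> R * \<bar>y - x\<bar> powr (\<beta> - strict_floor \<beta>)"
      using False by (simp add: divide_le_eq)
    also have "\<dots> \<le> M * \<bar>y - x\<bar> powr (\<beta> - strict_floor \<beta>)"
      using M by (intro mult_right_mono) auto
    finally show ?thesis .
  qed simp
  show "\<bar>nth_deriv j f x\<bar> \<le> M * f x powr (1 - j / \<beta>)" if x: "x \<in> {0..1}" and j: "j \<le> strict_floor \<beta>" for x j
  proof (cases "j = 0")
    case True
    have "f x \<le> M * f x" using nn[OF x] M by (simp add: mult_le_cancel_right1)
    then show ?thesis using True nn[OF x] by (simp add: nth_deriv_def)
  next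
    case False
    have jb: "real j < \<beta>" using j le_strict_floor_iff[OF \<beta>] by blast
    define s where "s = (SUP x\<in>{0..1}. ennreal (\<bar>nth_deriv j f x\<bar> powr \<beta>) / ennreal (\<bar>f x\<bar> powr (\<beta> - j)))"
    have "ennreal_powr s (1 / j) \<le> flat_seminorm \<beta> f"
      unfolding flat_seminorm_def s_def using jb False by (intro SUP_upper) auto
    then have sR: "ennreal_powr s (1 / j) \<le> ennreal R" using s3 by (rule order_trans)
    then have "s \<noteq> \<infinity>" by (auto simp: ennreal_powr_def top_unique)
    then obtain q where q: "s = ennreal q" "0 \<le> q" by (cases s) auto
    have "q powr (1 / j) \<le> R" using sR R0 q by (simp add: ennreal_powr_def ennreal_le_iff)
    then have "(q powr (1 / j)) powr j \<le> R powr j" by (intro powr_mono2) auto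
    then have qR: "q \<le> R powr j" using False q by (simp add: powr_powr)
    let ?D = "\<bar>nth_deriv j f x\<bar>"
    have D: "ennreal (?D powr \<beta>) / ennreal (f x powr (\<beta> - j)) \<le> ennreal q"
      unfolding q(1)[symmetric] s_def using nn[OF x] by (intro SUP_upper2[OF x]) auto
    show ?thesis
    proof (cases "f x = 0")
      case True
      \<comment> \<open>A finite quotient with denominator 0 must have numerator 0, so a flat
        density has vanishing derivatives at its zeros.\<close>
      then have "ennreal (?D powr \<beta>) / 0 \<le> ennreal q" using D jb by simp
      then have "ennreal (?D powr \<beta>) = 0"
        by (metis ennreal_divide_zero ennreal_less_top not_le top.not_eq_extremum)
      then show ?thesis using True by simp
    next
      case False
      then have fx: "0 < f x" using nn[OF x] by simp
      then have "ennreal (?D powr \<beta> / f x powr (\<beta> - j)) \<le> ennreal q"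
        using D by (simp add: divide_ennreal)
      then have "?D powr \<beta> \<le> q * f x powr (\<beta> - j)"
        using q fx by (simp add: divide_le_eq)
      also have "\<dots> \<le> R powr j * f x powr (\<beta> - j)"
        using qR by (intro mult_right_mono) auto
      finally have "(?D powr \<beta>) powr (1 / \<beta>) \<le> (R powr j * f x powr (\<beta> - j)) powr (1 / \<beta>)"
        using \<beta> by (intro powr_mono2) auto
      then have "?D \<le> (R powr j * f x powr (\<beta> - j)) powr (1 / \<beta>)"
        using \<beta> by (simp add: powr_powr)
      also have "\<dots> = R powr (j / \<beta>) * f x powr (1 - j / \<beta>)"
        using \<beta> by (simp add: powr_mult powr_powr diff_divide_distrib)
      also have "R powr (j / \<beta>) \<le> M powr (j / \<beta>)" using R0 M \<beta> by (intro powr_mono2) auto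
      also have "M powr (j / \<beta>) \<le> M powr 1" using M jb \<beta> by (intro powr_mono) auto
      finally show ?thesis using M by (simp add: mult_right_mono)
    qed
  qed
qed

section \<open>Flat densities at the local scale\<close>

lemma flat_taylor:
  fixes \<beta> R :: real
  assumes f: "f \<in> flat_densities \<beta> R" and \<beta>: "0 < \<beta>" and xy: "x \<in> {0..1}" "y \<in> {0..1}"
  shows "\<bar>f y - (\<Sum>j\<le>strict_floor \<beta>. nth_deriv j f x / fact j * (y - x) ^ j)\<bar> \<le> max 1 R * \<bar>y - x\<bar> powr \<beta>"
  using taylor_remainder_bound[OF flat_densitiesD(4)[OF f \<beta>] _ xy(1) flat_densitiesD(5)[OF f \<beta> xy(1)] xy(2)]
    strict_floor_less[OF \<beta>] by simp

text \<open>At distance at most v^(1 / \<beta>) the j-th Taylor term is at most M v^(1 - j /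
  \<beta>) v^(j / \<beta>) = M v, and so is the remainder. There are k + 1 terms and one
  remainder.\<close>

lemma flat_growth:
  fixes \<beta> R v h :: real
  assumes f: "f \<in> flat_densities \<beta> R" and \<beta>: "0 < \<beta>" and xy: "x \<in> {0..1}" "y \<in> {0..1}"
    and v: "f x \<le> v" "0 < v" and h: "\<bar>y - x\<bar> \<le> v powr (1 / \<beta>)"
  shows "f y \<le> (strict_floor \<beta> + 2) * max 1 R * v"
proof -
  let ?k = "strict_floor \<beta>" and ?M = "max 1 R"
  note F = flat_densitiesD[OF f \<beta>]
  have "\<bar>nth_deriv j f x / fact j * (y - x) ^ j\<bar> \<le> ?M * v" if j: "j \<le> ?k" for j
  proof -
    have jb: "real j < \<beta>" using j le_strict_floor_iff[OF \<beta>] by blast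
    have "\<bar>nth_deriv j f x\<bar> \<le> ?M * f x powr (1 - j / \<beta>)" by (rule F(6)[OF xy(1) j])
    also have "\<dots> \<le> ?M * v powr (1 - j / \<beta>)"
      using v F(1)[OF xy(1)] jb \<beta> by (intro mult_left_mono powr_mono2) auto
    finally have 1: "\<bar>nth_deriv j f x\<bar> \<le> ?M * v powr (1 - j / \<beta>)" .
    have "\<bar>y - x\<bar> ^ j \<le> (v powr (1 / \<beta>)) ^ j" using h by (intro power_mono) auto
    also have "\<dots> = v powr (j / \<beta>)" using v by (simp add: powr_powr flip: powr_realpow)
    finally have 2: "\<bar>y - x\<bar> ^ j \<le> v powr (j / \<beta>)" .
    have "\<bar>nth_deriv j f x / fact j * (y - x) ^ j\<bar> = \<bar>nth_deriv j f x\<bar> / fact j * \<bar>y - x\<bar> ^ j"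
      by (simp add: abs_mult power_abs)
    also have "\<dots> \<le> \<bar>nth_deriv j f x\<bar> * \<bar>y - x\<bar> ^ j"
      by (intro mult_right_mono) (auto simp: divide_le_eq mult_le_cancel_left1)
    also have "\<dots> \<le> (?M * v powr (1 - j / \<beta>)) * v powr (j / \<beta>)"
      using 1 2 by (intro mult_mono) auto
    also have "\<dots> = ?M * v"
      using v by (simp flip: powr_add)
    finally show ?thesis .
  qed
  then have "(\<Sum>j\<le>?k. nth_deriv j f x / fact j * (y - x) ^ j) \<le> (\<Sum>j\<le>?k. ?M * v)"
    by (intro sum_mono) (meson abs_ge_self atMost_iff order_trans)
  moreover have "?M * \<bar>y - x\<bar> powr \<beta> \<le> ?M * v"
  proof -
    have "\<bar>y - x\<bar> powr \<beta> \<le> (v powr (1 / \<beta>)) powr \<beta>" using h \<beta> by (intro powr_mono2) auto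
    then show ?thesis using v \<beta> by (intro mult_left_mono) (auto simp: powr_powr)
  qed
  ultimately have "f y \<le> (\<Sum>j\<le>?k. ?M * v) + ?M * v"
    using flat_taylor[OF f \<beta> xy] by linarith
  then show ?thesis by (simp add: algebra_simps)
qed

text \<open>The estimator controls \<open>f - g\<close> only through the masses of these intervals; \<open>l\<close> will be
  \<open>ln\<^sup>2 n / n\<close>, the squared scale of the stochastic error.\<close>

definition grid_close :: "nat \<Rightarrow> real \<Rightarrow> real \<Rightarrow> (real \<Rightarrow> real) \<Rightarrow> (real \<Rightarrow> real) \<Rightarrow> bool" where
  "grid_close n A l f g \<longleftrightarrow> (\<forall>a::nat. \<forall>b::nat. a \<le> n \<longrightarrow> b \<le> n \<longrightarrow>
     \<bar>integral {a/n..b/n} f - integral {a/n..b/n} g\<bar> \<le>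
       A * (l + sqrt (l * integral {a/n..b/n} f) + sqrt (l * integral {a/n..b/n} g)))"

text \<open>The mean value theorem turns a difference of masses into a difference of values at one
  point. Dividing the tolerance by the length of the interval leaves l / \<delta> and the root of l
  B / \<delta>.\<close>

lemma grid_close_average:
  fixes \<delta> B A l L :: real
  assumes fc: "continuous_on {0..1} f" and gc: "continuous_on {0..1} g"
    and close: "grid_close n A l f g" and A: "0 \<le> A" and l: "0 < l" and n: "0 < n"
    and L: "0 \<le> L" "L + \<delta> \<le> 1" and n\<delta>: "4 \<le> n * \<delta>"
    and fB: "\<And>y. y \<in> {L..L + \<delta>} \<Longrightarrow> 0 \<le> f y \<and> f y \<le> B"
    and gB: "\<And>y. y \<in> {L..L + \<delta>} \<Longrightarrow> 0 \<le> g y \<and> g y \<le> B"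
  obtains \<xi> where "\<xi> \<in> {L..L + \<delta>}" "\<bar>f \<xi> - g \<xi>\<bar> \<le> A * (2 * l / \<delta> + 2 * sqrt (2 * l * B / \<delta>))"
proof -
  have \<delta>: "0 < \<delta>"
  proof (rule ccontr)
    assume "\<not> 0 < \<delta>"
    then have "n * \<delta> \<le> 0" by (simp add: mult_nonneg_nonpos)
    with n\<delta> show False by linarith
  qed
  have B: "0 \<le> B" using fB[of L] \<delta> by auto
  \<comment> \<open>Rounding inwards to the grid loses at most 2 of the n \<delta> \<ge> 4 grid
    steps, so at least half of the length \<delta> is left.\<close>
  define a where "a = nat \<lceil>n * L\<rceil>"
  define b where "b = nat \<lfloor>n * (L + \<delta>)\<rfloor>"
  have nL: "0 \<le> n * L" "0 \<le> n * (L + \<delta>)" "n * (L + \<delta>) \<le> n" using L n \<delta> by (auto intro: mult_left_le)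
  have a: "n * L \<le> a" "a \<le> n * L + 1" using nL(1) unfolding a_def by linarith+
  have b: "b \<le> n * (L + \<delta>)" "n * (L + \<delta>) - 1 \<le> b" using nL(2) unfolding b_def by linarith+
  have ab: "n * \<delta> - 2 \<le> real b - real a" using a b by (simp add: algebra_simps)
  have bn: "b \<le> n" using b(1) nL(3) by linarith
  have abn: "a \<le> n" using ab n\<delta> bn by linarith
  let ?\<alpha> = "a / n" and ?\<gamma> = "b / n"
  define len where "len = ?\<gamma> - ?\<alpha>"
  have len: "\<delta> / 2 \<le> len"
  proof -
    have "\<delta> / 2 * n \<le> real b - real a" using ab n\<delta> by (simp add: mult.commute)
    then show ?thesis using n by (simp add: len_def field_simps)
  qed
  then have len0: "0 < len" using \<delta> by linarith
  have sub: "{?\<alpha>..?\<gamma>} \<subseteq> {L..L + \<delta>}"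
    using a b n by (auto simp: field_simps)
  have sub1: "{?\<alpha>..?\<gamma>} \<subseteq> {0..1}" using sub L by auto
  note fc' = continuous_on_subset[OF fc sub1] and gc' = continuous_on_subset[OF gc sub1]
  have "?\<alpha> < ?\<gamma>" using len0 by (simp add: len_def)
  moreover have "continuous_on {?\<alpha>..?\<gamma>} (\<lambda>x. f x - g x)" by (intro continuous_intros fc' gc')
  ultimately obtain \<xi> where \<xi>: "\<xi> \<in> {?\<alpha>..?\<gamma>}" "integral {?\<alpha>..?\<gamma>} (\<lambda>x. f x - g x) = (f \<xi> - g \<xi>) * len"
    using integral_mean_value unfolding len_def by blast
  have diff: "integral {?\<alpha>..?\<gamma>} (\<lambda>x. f x - g x) = integral {?\<alpha>..?\<gamma>} f - integral {?\<alpha>..?\<gamma>} g"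
    by (intro integral_diff integrable_continuous_real fc' gc')
  have bound: "0 \<le> integral {?\<alpha>..?\<gamma>} u" "integral {?\<alpha>..?\<gamma>} u \<le> B * len"
    if "continuous_on {?\<alpha>..?\<gamma>} u" "\<And>y. y \<in> {L..L + \<delta>} \<Longrightarrow> 0 \<le> u y \<and> u y \<le> B" for u
  proof -
    show "0 \<le> integral {?\<alpha>..?\<gamma>} u"
      using that sub by (intro integral_nonneg integrable_continuous_real) auto
    have "integral {?\<alpha>..?\<gamma>} u \<le> integral {?\<alpha>..?\<gamma>} (\<lambda>_. B)"
      using that sub by (intro integral_le integrable_continuous_real) auto
    then show "integral {?\<alpha>..?\<gamma>} u \<le> B * len"
      using len0 by (simp add: len_def mult.commute)
  qed
  have s: "sqrt (l * integral {?\<alpha>..?\<gamma>} f) \<le> sqrt (l * (B * len))" "sqrt (l * integral {?\<alpha>..?\<gamma>} g) \<le> sqrt (l * (B * len))"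
    using bound(2)[OF fc' fB] bound(2)[OF gc' gB] l by (auto intro!: mult_left_mono)
  have "\<bar>f \<xi> - g \<xi>\<bar> * len = \<bar>integral {?\<alpha>..?\<gamma>} f - integral {?\<alpha>..?\<gamma>} g\<bar>"
    using \<xi>(2) diff len0 by (simp add: abs_mult)
  also have "\<dots> \<le> A * (l + sqrt (l * integral {?\<alpha>..?\<gamma>} f) + sqrt (l * integral {?\<alpha>..?\<gamma>} g))"
    using close abn bn by (simp add: grid_close_def)
  also have "\<dots> \<le> A * (l + 2 * sqrt (l * (B * len)))"
  proof (rule mult_left_mono[OF _ A])
    show "l + sqrt (l * integral {?\<alpha>..?\<gamma>} f) + sqrt (l * integral {?\<alpha>..?\<gamma>} g) \<le> l + 2 * sqrt (l * (B * len))"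
      using s by linarith
  qed
  finally have "\<bar>f \<xi> - g \<xi>\<bar> \<le> A * (l + 2 * sqrt (l * (B * len))) / len"
    using len0 by (simp add: le_divide_eq)
  also have "\<dots> = A * (l / len + 2 * sqrt (l * B / len))"
  proof -
    have "sqrt (l * (B * len)) / len = sqrt (l * (B * len) / len\<^sup>2)"
      using len0 by (simp add: real_sqrt_divide)
    also have "l * (B * len) / len\<^sup>2 = l * B / len" using len0 by (simp add: power2_eq_square)
    finally have "sqrt (l * (B * len)) / len = sqrt (l * B / len)" .
    then show ?thesis by (simp add: distrib_left add_divide_distrib flip: times_divide_eq_right)
  qed
  also have "\<dots> \<le> A * (l / (\<delta> / 2) + 2 * sqrt (l * B / (\<delta> / 2)))"
    using A l B len \<delta> by (intro mult_left_mono add_mono real_sqrt_le_mono divide_left_mono mult_pos_pos) auto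
  also have "\<dots> = A * (2 * l / \<delta> + 2 * sqrt (2 * l * B / \<delta>))" by (simp add: field_simps)
  finally show thesis using that \<xi>(1) sub by blast
qed

text \<open>The difference of the Taylor polynomials at x is small at k + 1 separated points near x,
  where f and g nearly agree, hence also at x by interpolation. The lower bound on v makes the
  window short enough for both densities to stay of order v on it, and the bound on n makes it long
  enough to contain grid intervals.\<close>

lemma flat_densities_close:
  fixes \<beta> R v l A x :: real and n :: nat
  assumes \<beta>: "0 < \<beta>" and f: "f \<in> flat_densities \<beta> R" and g: "g \<in> flat_densities \<beta> R"
    and close: "grid_close n A l f g" and A: "0 \<le> A" and l: "0 < l" "max 1 R * l \<le> 1"
    and n: "8 * (strict_floor \<beta> + 1) \<le> n * l powr (1 / (\<beta> + 1))"
    and x: "x \<in> {0..1}" and v: "f x \<le> v" "g x \<le> v" "v \<le> max 1 R" "l powr (\<beta> / (\<beta> + 1)) \<le> v"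
  defines "k \<equiv> strict_floor \<beta>" and "M \<equiv> max 1 R" 
  defines "q \<equiv> 2 * (real k + 1)"
  shows "\<bar>f x - g x\<bar> \<le> (k + 1) * q ^ k * (A * (2 * q + 2 * sqrt (2 * q * ((k + 2) * M))) + 2 * M) * (v * l) powr (\<beta> / (2 * \<beta> + 1))"
proof -
  note F = flat_densitiesD[OF f \<beta>, folded k_def M_def] and G = flat_densitiesD[OF g \<beta>, folded k_def M_def]
  have "0 < l powr (\<beta> / (\<beta> + 1))" using l(1) by simp
  then have v0: "0 < v" using v(4) by linarith
  have M: "1 \<le> M" by (simp add: M_def)
  have q: "2 \<le> q" by (simp add: q_def)
  \<comment> \<open>The bandwidth at which the stochastic error sqrt (l v / h) equals the smoothness
    error h^\<beta>.\<close>
  define h where "h = (v * l) powr (1 / (2 * \<beta> + 1))"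
  have h0: "0 < h" using v0 l by (simp add: h_def)
  have "v * l \<le> M * l" using v(3) l by (intro mult_right_mono) (auto simp: M_def)
  then have "v * l \<le> 1" using l(2) by (simp add: M_def)
  then have h1: "h \<le> 1" using v0 l \<beta> by (simp add: h_def powr_le1)
  have hb: "h powr \<beta> = (v * l) powr (\<beta> / (2 * \<beta> + 1))" by (simp add: h_def powr_powr)
  have hv: "h \<le> v powr (1 / \<beta>)"
  proof -
    have "(l powr (\<beta> / (\<beta> + 1))) powr ((\<beta> + 1) / \<beta>) \<le> v powr ((\<beta> + 1) / \<beta>)"
      using v(4) \<beta> by (intro powr_mono2) auto
    then have "l \<le> v powr ((\<beta> + 1) / \<beta>)" using \<beta> l by (simp add: powr_powr)
    then have "v * l \<le> v powr 1 * v powr ((\<beta> + 1) / \<beta>)" using v0 by simp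
    also have "\<dots> = v powr ((2 * \<beta> + 1) / \<beta>)"
      unfolding powr_add[symmetric] using \<beta> by (intro arg_cong[where f="(powr) v"]) (simp add: field_simps)
    finally have "h \<le> (v powr ((2 * \<beta> + 1) / \<beta>)) powr (1 / (2 * \<beta> + 1))"
      unfolding h_def using v0 l \<beta> by (intro powr_mono2) auto
    then show ?thesis using \<beta> by (simp add: powr_powr)
  qed
  have hl: "l powr (1 / (\<beta> + 1)) \<le> h"
  proof -
    have "l powr ((2 * \<beta> + 1) / (\<beta> + 1)) = l powr (\<beta> / (\<beta> + 1)) * l powr 1"
      unfolding powr_add[symmetric] using \<beta> by (intro arg_cong[where f="(powr) l"]) (simp add: field_simps)
    also have "\<dots> \<le> v * l" using v(4) l by simp
    finally have "(l powr ((2 * \<beta> + 1) / (\<beta> + 1))) powr (1 / (2 * \<beta> + 1)) \<le> h"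
      unfolding h_def using \<beta> by (intro powr_mono2) auto
    then show ?thesis using \<beta> by (simp add: powr_powr)
  qed
  have lh: "l / h \<le> h powr \<beta>"
  proof -
    have "(l powr (1 / (\<beta> + 1))) powr (\<beta> + 1) \<le> h powr (\<beta> + 1)"
      using hl \<beta> by (intro powr_mono2) auto
    moreover have "(l powr (1 / (\<beta> + 1))) powr (\<beta> + 1) = l" using \<beta> l by (simp add: powr_powr)
    moreover have "h powr (\<beta> + 1) = h powr \<beta> * h" using h0 by (simp add: powr_add)
    ultimately have "l \<le> h powr \<beta> * h" by simp
    then show ?thesis using h0 by (simp add: divide_le_eq)
  qed
  have lvh: "l * v / h = (h powr \<beta>)\<^sup>2"
  proof -
    have "l * v = h powr (2 * \<beta> + 1)" using \<beta> v0 l by (simp add: h_def powr_powr mult.commute)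
    also have "\<dots> = h powr \<beta> * h powr \<beta> * h powr 1" unfolding powr_add[symmetric] by (simp add: algebra_simps)
    finally show ?thesis using h0 by (simp add: power2_eq_square)
  qed
  \<comment> \<open>The window is cut into q = 2 (k + 1) pieces, and one point is taken from every
    second piece; the pieces in between separate the points by at least \<delta>.\<close>
  define \<delta> where "\<delta> = h / q"
  have \<delta>0: "0 < \<delta>" using h0 q by (simp add: \<delta>_def)
  have q\<delta>: "q * \<delta> = h" "\<delta> * q = h" using q by (simp_all add: \<delta>_def)
  \<comment> \<open>The window starts at x unless it would leave the unit interval, in which case it
    ends at 1; it contains x in both cases.\<close>
  define a0 where "a0 = min x (1 - h)"
  have a0: "0 \<le> a0" "a0 \<le> x" "x \<le> a0 + h" "a0 + h \<le> 1" using x h1 h0 by (auto simp: a0_def)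
  define B where "B = (k + 2) * M * v"
  have near: "\<bar>y - x\<bar> \<le> h" "y \<in> {0..1}" if "y \<in> {a0..a0 + h}" for y using that a0 by auto
  have fB: "0 \<le> f y \<and> f y \<le> B" "0 \<le> g y \<and> g y \<le> B" if y: "y \<in> {a0..a0 + h}" for y
    using F(1) G(1) near[OF y] hv
      flat_growth[OF f \<beta> x near(2)[OF y] v(1) v0] flat_growth[OF g \<beta> x near(2)[OF y] v(2) v0]
    unfolding B_def k_def M_def by auto
  have n4: "4 * q \<le> n * h"
  proof -
    have "4 * q \<le> n * l powr (1 / (\<beta> + 1))" using n by (simp add: q_def k_def algebra_simps)
    also have "\<dots> \<le> n * h" using hl by (intro mult_left_mono) auto
    finally show ?thesis .
  qed
  have n0: "0 < n" using n4 q by (cases "n = 0") auto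
  have n\<delta>: "4 \<le> n * \<delta>" using n4 q by (simp add: \<delta>_def le_divide_eq)
  \<comment> \<open>The two summands come from l / h \<le> h^\<beta> and from l v / h =
    (h^\<beta>)^2, with the factor (k + 2) M due to the growth of the densities on the
    window.\<close>
  define E where "E = A * (2 * q + 2 * sqrt (2 * q * ((k + 2) * M))) * h powr \<beta>"
  have ex: "\<exists>\<xi>. \<xi> \<in> {a0 + 2 * real i * \<delta>..a0 + 2 * real i * \<delta> + \<delta>} \<and> \<bar>f \<xi> - g \<xi>\<bar> \<le> E" if i: "i \<le> k" for i
  proof -
    let ?L = "a0 + 2 * real i * \<delta>"
    have "(2 * real i + 1) * \<delta> \<le> q * \<delta>" using i \<delta>0 by (intro mult_right_mono) (auto simp: q_def)
    then have Lh: "?L + \<delta> \<le> a0 + h" by (simp add: q\<delta> algebra_simps)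
    have L0: "a0 \<le> ?L" using \<delta>0 by simp
    have inJ: "y \<in> {a0..a0 + h}" if "y \<in> {?L..?L + \<delta>}" for y
      using that Lh L0 unfolding atLeastAtMost_iff by linarith
    have L01: "0 \<le> ?L" "?L + \<delta> \<le> 1" using Lh L0 a0 by linarith+
    obtain \<xi> where \<xi>: "\<xi> \<in> {?L..?L + \<delta>}" "\<bar>f \<xi> - g \<xi>\<bar> \<le> A * (2 * l / \<delta> + 2 * sqrt (2 * l * B / \<delta>))"
      using grid_close_average[OF F(3) G(3) close A l(1) n0 L01 n\<delta> fB(1)[OF inJ] fB(2)[OF inJ], of thesis]
      by blast
    have "2 * l / \<delta> = 2 * q * (l / h)" by (simp add: \<delta>_def)
    also have "\<dots> \<le> 2 * q * h powr \<beta>" using lh q by (intro mult_left_mono) auto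
    finally have 1: "2 * l / \<delta> \<le> 2 * q * h powr \<beta>" .
    have "2 * l * B / \<delta> = 2 * q * ((k + 2) * M) * (l * v / h)" by (simp add: \<delta>_def B_def field_simps)
    then have "sqrt (2 * l * B / \<delta>) = sqrt (2 * q * ((k + 2) * M)) * h powr \<beta>"
      unfolding lvh by (simp only: real_sqrt_mult real_sqrt_abs) simp
    with 1 have "A * (2 * l / \<delta> + 2 * sqrt (2 * l * B / \<delta>)) \<le> A * (2 * q * h powr \<beta> + 2 * (sqrt (2 * q * ((k + 2) * M)) * h powr \<beta>))"
      using A by (intro mult_left_mono add_mono) auto
    also have "\<dots> = E" by (simp add: E_def algebra_simps)
    finally show ?thesis using \<xi> by (intro exI[of _ \<xi>]) auto
  qed
  then obtain \<xi> where \<xi>: "\<And>i. i \<le> k \<Longrightarrow> \<xi> i \<in> {a0 + 2 * real i * \<delta>..a0 + 2 * real i * \<delta> + \<delta>}"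
      "\<And>i. i \<le> k \<Longrightarrow> \<bar>f (\<xi> i) - g (\<xi> i)\<bar> \<le> E"
    by metis
  have \<xi>J: "\<xi> i \<in> {a0..a0 + h}" if "i \<le> k" for i
  proof -
    have "(2 * real i + 1) * \<delta> \<le> q * \<delta>" using that \<delta>0 by (intro mult_right_mono) (auto simp: q_def)
    moreover have "0 \<le> 2 * real i * \<delta>" using \<delta>0 by simp
    moreover have "(2 * real i + 1) * \<delta> = 2 * real i * \<delta> + \<delta>" by (simp add: algebra_simps)
    ultimately show ?thesis using \<xi>(1)[OF that] unfolding atLeastAtMost_iff q\<delta> by linarith
  qed
  have sep': "\<delta> \<le> \<xi> j - \<xi> i" if "i < j" "j \<le> k" for i j
  proof -
    have "2 * (real i + 1) * \<delta> \<le> 2 * real j * \<delta>" using that \<delta>0 by (intro mult_right_mono) auto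
    then show ?thesis using \<xi>(1)[of i] \<xi>(1)[of j] that by (auto simp: algebra_simps)
  qed
  have sep: "\<delta> \<le> \<bar>\<xi> i - \<xi> j\<bar>" if "i \<le> k" "j \<le> k" "i \<noteq> j" for i j
    using sep'[of i j] sep'[of j i] that by (cases "i < j") auto
  define c where "c j = nth_deriv j f x / fact j - nth_deriv j g x / fact j" for j
  \<comment> \<open>The difference of the two Taylor polynomials: its value at x is f x - g x, and
    at the points \<xi> i it differs from f - g by two remainders, each at most M h^\<beta>.\<close>
  define p where "p = (\<Sum>j\<le>k. smult (c j) ([:- x, 1:] ^ j))"
  have p: "poly p y = (\<Sum>j\<le>k. nth_deriv j f x / fact j * (y - x) ^ j) - (\<Sum>j\<le>k. nth_deriv j g x / fact j * (y - x) ^ j)" for y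
    by (simp add: p_def poly_sum c_def left_diff_distrib sum_subtractf)
  have degp: "degree p \<le> k"
    unfolding p_def
  proof (rule degree_sum_le)
    fix j assume "j \<in> {..k}"
    then show "degree (smult (c j) ([:- x, 1:] ^ j)) \<le> k"
      using order_trans[OF degree_smult_le degree_power_le[of "[:- x, 1:]" j], of "c j"] by simp
  qed simp
  have px: "poly p x = f x - g x"
    unfolding p by (simp add: power_0_left nth_deriv_def sum.delta if_distrib[of "\<lambda>t. _ * t"] cong: if_cong)
  have pe: "\<bar>poly p (\<xi> i)\<bar> \<le> E + 2 * M * h powr \<beta>" if i: "i \<le> k" for i
  proof -
    note nr = near[OF \<xi>J[OF i]]
    have "M * \<bar>\<xi> i - x\<bar> powr \<beta> \<le> M * h powr \<beta>"
      using nr \<beta> M by (intro mult_left_mono powr_mono2) auto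
    then show ?thesis
      using flat_taylor[OF f \<beta> x nr(2)] flat_taylor[OF g \<beta> x nr(2)] \<xi>(2)[OF i]
      unfolding p k_def M_def by linarith
  qed
  have "\<bar>poly p x\<bar> \<le> (real k + 1) * (h / \<delta>) ^ k * (E + 2 * M * h powr \<beta>)"
    using near(1)[OF \<xi>J] by (intro interpolation_bound[OF degp pe sep \<delta>0]) (simp_all add: abs_minus_commute)
  also have "h / \<delta> = q" using h0 q by (simp add: \<delta>_def)
  finally show ?thesis
    unfolding px E_def hb[symmetric] by (simp add: algebra_simps)
qed

section \<open>The rate function\<close>

abbreviation rate_exp :: "real \<Rightarrow> real" where
  "rate_exp \<beta> \<equiv> 2 * \<beta> / (2 * \<beta> + 1)"

text \<open>The integrand of the theorem with its prefactor, as a real function of the value y of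
  the density. The truncated reciprocal is written as the reciprocal of a maximum, so that y = 0
  needs no special treatment.\<close>

definition rate :: "nat \<Rightarrow> real \<Rightarrow> real \<Rightarrow> real" where
  "rate n \<beta> y = n powr (- (rate_exp \<beta>)) * (ln n)\<^sup>2 *
     max y (n powr (- (\<beta> / (\<beta> + 1)))) powr (- (1 / (2 * \<beta> + 1)))"

lemma rate_nonneg: "0 \<le> rate n \<beta> y"
  by (simp add: rate_def)

lemma measurable_rate[measurable]: "rate n \<beta> \<in> borel_measurable borel"
  unfolding rate_def[abs_def] by measurable

context
  fixes \<beta> l :: real and n :: nat
  assumes \<beta>: "0 < \<beta>" and ln1: "1 \<le> ln n" and n: "0 < n"
  defines "l \<equiv> (ln n)\<^sup>2 / n"
begin

lemma noise_pos: "0 < l" and noise_ge: "1 / n \<le> l"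
proof -
  have "1 \<le> (ln n)\<^sup>2" using ln1 by (simp add: one_le_power)
  then show "1 / n \<le> l" unfolding l_def using n by (intro divide_right_mono) auto
  then show "0 < l" using n by (meson divide_pos_pos less_le_trans of_nat_0_less_iff zero_less_one)
qed

text \<open>The power of the logarithm is rounded up to 2, as the exponent of l is at most 1 and ln
  n \<ge> 1.\<close>

lemma noise_powr_le: "l powr (rate_exp \<beta>) \<le> n powr (- (rate_exp \<beta>)) * (ln n)\<^sup>2"
proof -
  let ?e = "2 * \<beta> / (2 * \<beta> + 1)"
  have "1 \<le> (ln n)\<^sup>2" using ln1 by (simp add: one_le_power)
  moreover have "?e \<le> 1" using \<beta> by simp
  ultimately have "((ln n)\<^sup>2) powr ?e \<le> ((ln n)\<^sup>2) powr 1" by (intro powr_mono) auto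
  then have "((ln n)\<^sup>2) powr ?e \<le> (ln n)\<^sup>2" by simp
  then have "((ln n)\<^sup>2) powr ?e / n powr ?e \<le> (ln n)\<^sup>2 / n powr ?e" by (intro divide_right_mono) auto
  moreover have "l powr ?e = ((ln n)\<^sup>2) powr ?e / n powr ?e" unfolding l_def by (simp add: powr_divide)
  moreover have "(ln n)\<^sup>2 / n powr ?e = n powr (- ?e) * (ln n)\<^sup>2" by (simp add: powr_minus_divide)
  ultimately show ?thesis by metis
qed

lemma threshold_ge: "n powr (- (\<beta> / (\<beta> + 1))) \<le> l powr (\<beta> / (\<beta> + 1))"
proof -
  have "(1 / n) powr (\<beta> / (\<beta> + 1)) \<le> l powr (\<beta> / (\<beta> + 1))"
    using noise_ge \<beta> by (intro powr_mono2) auto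
  then show ?thesis using n by (simp add: powr_divide powr_minus_divide)
qed

text \<open>The threshold \<tau> = l^(\<beta> / (\<beta> + 1)) satisfies \<tau>^(1 + p) = l^(2
  \<beta> / (2 \<beta> + 1)) with p = 1 / (2 \<beta> + 1). Dividing by the p-th power of the maximum
  in the rate shows that smaller values are dominated by their own rate; K^(1 + p) \<le> K^2 gives
  the constant.\<close>

lemma le_rate_below_threshold:
  assumes y: "y \<le> K * l powr (\<beta> / (\<beta> + 1))" and K: "1 \<le> K"
  shows "y \<le> K\<^sup>2 * rate n \<beta> y"
proof -
  let ?\<tau> = "l powr (\<beta> / (\<beta> + 1))" and ?p = "1 / (2 * \<beta> + 1)"
  define m where "m = max y (n powr (- (\<beta> / (\<beta> + 1))))"
  let ?e = "(2 * \<beta> + 2) / (2 * \<beta> + 1)"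
  have m0: "0 < m" unfolding m_def using n by (simp add: less_max_iff_disj)
  have "?\<tau> \<le> K * ?\<tau>" using K by (simp add: mult_le_cancel_right1)
  then have mK: "m \<le> K * ?\<tau>" unfolding m_def using y threshold_ge by simp
  have e: "?e = 1 + ?p" using \<beta> by (simp add: field_simps)
  have "m powr ?e \<le> (K * ?\<tau>) powr ?e" using mK m0 \<beta> by (intro powr_mono2) auto
  also have "(K * ?\<tau>) powr ?e = K powr ?e * l powr (rate_exp \<beta>)"
  proof -
    have "\<beta> / (\<beta> + 1) * (2 * (\<beta> + 1) / (2 * \<beta> + 1)) = 2 * \<beta> / (2 * \<beta> + 1)"
    proof -
      have "\<beta> + 1 \<noteq> 0" "2 * \<beta> + 1 \<noteq> 0" using \<beta> by linarith+
      then show ?thesis by (simp add: frac_eq_eq del: mult_2 distrib_left_numeral)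
    qed
    moreover have "2 * (\<beta> + 1) = 2 * \<beta> + 2" by simp
    ultimately have "\<beta> / (\<beta> + 1) * ?e = 2 * \<beta> / (2 * \<beta> + 1)" by metis
    then show ?thesis using K by (simp add: powr_mult powr_powr)
  qed
  also have "K powr ?e * l powr (rate_exp \<beta>) \<le> K\<^sup>2 * (n powr (- (rate_exp \<beta>)) * (ln n)\<^sup>2)"
  proof (rule mult_mono)
    have "K powr ?e \<le> K powr 2" using K \<beta> by (intro powr_mono) (auto simp: divide_le_eq)
    then show "K powr ?e \<le> K\<^sup>2" using K by (simp add: powr_numeral)
  qed (use noise_powr_le in auto)
  finally have "m powr ?e * m powr (- ?p) \<le> K\<^sup>2 * (n powr (- (rate_exp \<beta>)) * (ln n)\<^sup>2) * m powr (- ?p)"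
    by (rule mult_right_mono) simp
  moreover have "m powr ?e * m powr (- ?p) = m"
    unfolding powr_add[symmetric] e using m0 by simp
  ultimately have "m \<le> K\<^sup>2 * rate n \<beta> y"
    by (simp add: rate_def m_def mult.assoc)
  then show ?thesis by (simp add: m_def)
qed

text \<open>As 2 \<beta> / (2 \<beta> + 1) = 1 - p, a full factor v splits off the squared error. It
  is the factor that the division by the density in the chi-square divergence removes; what is left
  decreases in v and is compared with the rate at y.\<close>

lemma error_square_le_rate:
  assumes v: "0 < v" "y \<le> v" "l powr (\<beta> / (\<beta> + 1)) \<le> v" and C: "0 \<le> C"
    and d: "\<bar>d\<bar> \<le> C * (v * l) powr (\<beta> / (2 * \<beta> + 1))"
  shows "d\<^sup>2 \<le> v * (C\<^sup>2 * rate n \<beta> y)"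
proof -
  let ?p = "1 / (2 * \<beta> + 1)"
  let ?m = "max y (n powr (- (\<beta> / (\<beta> + 1))))"
  have "d\<^sup>2 \<le> (C * (v * l) powr (\<beta> / (2 * \<beta> + 1)))\<^sup>2"
    using d by (metis abs_ge_zero power2_abs power_mono)
  also have "\<dots> = C\<^sup>2 * (v * l) powr (rate_exp \<beta>)"
  proof -
    have "((v * l) powr (\<beta> / (2 * \<beta> + 1)))\<^sup>2 = (v * l) powr (\<beta> / (2 * \<beta> + 1) + \<beta> / (2 * \<beta> + 1))"
      unfolding powr_add by (rule power2_eq_square)
    also have "\<beta> / (2 * \<beta> + 1) + \<beta> / (2 * \<beta> + 1) = 2 * \<beta> / (2 * \<beta> + 1)" by simp
    finally show ?thesis by (simp add: power_mult_distrib)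
  qed
  also have "(v * l) powr (rate_exp \<beta>) = v powr (1 + - ?p) * l powr (rate_exp \<beta>)"
  proof -
    have "2 * \<beta> / (2 * \<beta> + 1) = 1 + - ?p" using \<beta> by (simp add: field_simps)
    then show ?thesis using v noise_pos by (simp add: powr_mult)
  qed
  also have "\<dots> = v * (v powr (- ?p) * l powr (rate_exp \<beta>))"
    unfolding powr_add using v by simp
  also have "C\<^sup>2 * \<dots> \<le> C\<^sup>2 * (v * (?m powr (- ?p) * (n powr (- (rate_exp \<beta>)) * (ln n)\<^sup>2)))"
  proof (intro mult_left_mono mult_mono)
    have "?m \<le> v" using v threshold_ge by auto
    moreover have "0 < ?m" using n by (simp add: less_max_iff_disj)
    ultimately show "v powr (- ?p) \<le> ?m powr (- ?p)"
      using \<beta> by (intro powr_mono2') auto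
  qed (use noise_powr_le v in auto)
  finally show ?thesis by (simp add: rate_def ac_simps)
qed

text \<open>The exponent (\<beta> + 1) / (2 \<beta> + 1) is at least 1 / 2, which is why the
  threshold carries the square of 2 C: its power is still at least 2 C.\<close>

lemma error_le_half:
  assumes v: "(2 * C)\<^sup>2 * l powr (\<beta> / (\<beta> + 1)) \<le> v" and C: "1 \<le> C"
  shows "C * (v * l) powr (\<beta> / (2 * \<beta> + 1)) \<le> v / 2"
proof -
  let ?\<tau> = "l powr (\<beta> / (\<beta> + 1))"
  let ?e = "(\<beta> + 1) / (2 * \<beta> + 1)"
  have \<tau>: "0 < ?\<tau>" using noise_pos by simp
  have C2: "0 < (2 * C)\<^sup>2" using C by simp
  have "0 < (2 * C)\<^sup>2 * ?\<tau>" using \<tau> C2 by (rule mult_pos_pos[rotated])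
  then have v0: "0 < v" using v by linarith
  have "?\<tau> \<le> v / (2 * C)\<^sup>2" using v C2 by (simp add: pos_le_divide_eq mult.commute)
  then have "?\<tau> powr ?e \<le> (v / (2 * C)\<^sup>2) powr ?e" using \<beta> by (intro powr_mono2) auto
  also have "?\<tau> powr ?e = l powr (\<beta> / (2 * \<beta> + 1))" using \<beta> by (simp add: powr_powr)
  also have "(v / (2 * C)\<^sup>2) powr ?e = v powr ?e / ((2 * C)\<^sup>2) powr ?e"
    using v0 by (simp add: powr_divide)
  also have "\<dots> \<le> v powr ?e / (2 * C)"
  proof -
    have "(2 * C)\<^sup>2 = (2 * C) powr 2" using C by (simp add: powr_numeral)
    then have "((2 * C)\<^sup>2) powr ?e = (2 * C) powr (2 * ?e)" by (simp only: powr_powr)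
    moreover have "(2 * C) powr 1 \<le> (2 * C) powr (2 * ?e)" using C \<beta> by (intro powr_mono) (auto simp: le_divide_eq)
    ultimately have "2 * C \<le> ((2 * C)\<^sup>2) powr ?e" using C by simp
    then show ?thesis using C by (intro divide_left_mono) auto
  qed
  finally have le: "l powr (\<beta> / (2 * \<beta> + 1)) \<le> v powr ?e / (2 * C)" .
  have "(v * l) powr (\<beta> / (2 * \<beta> + 1)) = v powr (\<beta> / (2 * \<beta> + 1)) * l powr (\<beta> / (2 * \<beta> + 1))"
    using v0 noise_pos by (simp add: powr_mult)
  also have "\<dots> \<le> v powr (\<beta> / (2 * \<beta> + 1)) * (v powr ?e / (2 * C))"
    using le by (intro mult_left_mono) auto
  also have "\<dots> = v powr (\<beta> / (2 * \<beta> + 1) + ?e) / (2 * C)" by (simp add: powr_add)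
  also have "\<beta> / (2 * \<beta> + 1) + ?e = 1" using \<beta> by (simp add: add_divide_distrib[symmetric])
  finally have "(v * l) powr (\<beta> / (2 * \<beta> + 1)) \<le> v / (2 * C)" using v0 by simp
  then have "C * (v * l) powr (\<beta> / (2 * \<beta> + 1)) \<le> C * (v / (2 * C))" using C by (intro mult_left_mono) auto
  also have "\<dots> = v / 2" using C by simp
  finally show ?thesis .
qed

text \<open>Here y and z stand for the values of f and g at one point. Above the cutoff \<theta> the
  error is at most half the larger value, so both values are comparable and the squared error can be
  divided by y. Below it both values are at most 2 \<theta>, which is 8 C^2 times the threshold, and
  each is dominated by its own rate.\<close>

lemma pointwise_comparison:
  assumes C: "1 \<le> C" and y: "0 \<le> y" "0 \<le> z"
    and close: "\<And>v. v = max y z \<Longrightarrow> l powr (\<beta> / (\<beta> + 1)) \<le> v \<Longrightarrow> \<bar>y - z\<bar> \<le> C * (v * l) powr (\<beta> / (2 * \<beta> + 1))"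
  defines "\<theta> \<equiv> (2 * C)\<^sup>2 * l powr (\<beta> / (\<beta> + 1))"
  shows "\<theta> < z \<Longrightarrow> 0 < y \<and> z \<le> 2 * y \<and> (y - z)\<^sup>2 \<le> y * (2 * C\<^sup>2 * rate n \<beta> z)"
    and "z \<le> \<theta> \<Longrightarrow> z \<le> (8 * C\<^sup>2)\<^sup>2 * rate n \<beta> z \<and> y \<le> (8 * C\<^sup>2)\<^sup>2 * rate n \<beta> y"
proof -
  let ?\<tau> = "l powr (\<beta> / (\<beta> + 1))"
  define v where "v = max y z"
  have \<tau>: "0 < ?\<tau>" using noise_pos by simp
  have C2: "1 \<le> C\<^sup>2" using C by (simp add: one_le_power)
  have \<tau>\<theta>: "?\<tau> \<le> \<theta>" unfolding \<theta>_def using C2 by (simp add: mult_le_cancel_right1)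
  have half: "\<bar>y - z\<bar> \<le> v / 2" if "\<theta> \<le> v"
  proof -
    have "\<bar>y - z\<bar> \<le> C * (v * l) powr (\<beta> / (2 * \<beta> + 1))" using close[OF v_def] \<tau>\<theta> that by linarith
    also have "\<dots> \<le> v / 2" using that C unfolding \<theta>_def by (rule error_le_half)
    finally show ?thesis .
  qed
  {
    assume z: "\<theta> < z"
    then have v\<theta>: "\<theta> \<le> v" by (simp add: v_def)
    then have v0: "0 < v" using \<tau> \<tau>\<theta> by linarith
    have vy: "v \<le> 2 * y" using half[OF v\<theta>] by (auto simp: v_def max_def abs_if split: if_splits)
    then have y0: "0 < y" using v0 by linarith
    have "(y - z)\<^sup>2 \<le> v * (C\<^sup>2 * rate n \<beta> z)"
      using close[OF v_def] \<tau>\<theta> v\<theta> C v0 by (intro error_square_le_rate) (auto simp: v_def)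
    also have "\<dots> \<le> (2 * y) * (C\<^sup>2 * rate n \<beta> z)"
      using vy rate_nonneg by (intro mult_right_mono) auto
    finally show "0 < y \<and> z \<le> 2 * y \<and> (y - z)\<^sup>2 \<le> y * (2 * C\<^sup>2 * rate n \<beta> z)"
      using vy y0 by (auto simp: v_def ac_simps)
  next
    assume z: "z \<le> \<theta>"
    \<comment> \<open>A larger y would be the maximum v, and an error of at most v / 2 would push z
      above \<theta>.\<close>
    have "y \<le> 2 * \<theta>"
    proof (rule ccontr)
      assume "\<not> y \<le> 2 * \<theta>"
      then have "z \<le> y" "\<theta> \<le> y" using z \<tau> \<tau>\<theta> by linarith+
      then have "v = y" "\<theta> \<le> v" by (simp_all add: v_def)
      then show False using half z \<open>\<not> y \<le> 2 * \<theta>\<close> by (auto simp: abs_if split: if_splits)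
    qed
    then have "y \<le> (8 * C\<^sup>2) * ?\<tau>" by (simp add: \<theta>_def power_mult_distrib)
    moreover have "z \<le> (8 * C\<^sup>2) * ?\<tau>"
    proof -
      have "\<theta> \<le> 2 * \<theta>" using \<tau> \<tau>\<theta> by linarith
      then have "z \<le> 2 * \<theta>" using z by linarith
      then show ?thesis by (simp add: \<theta>_def power_mult_distrib)
    qed
    moreover have "1 \<le> 8 * C\<^sup>2" using C2 by linarith
    ultimately show "z \<le> (8 * C\<^sup>2)\<^sup>2 * rate n \<beta> z \<and> y \<le> (8 * C\<^sup>2)\<^sup>2 * rate n \<beta> y"
      using le_rate_below_threshold by blast
  }
qed

end

section \<open>The truncated estimator and its chi-square distance\<close>

abbreviation U01 :: "real measure" where
  "U01 \<equiv> restrict_space lborel {0..1}"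

lemma prob_space_U01: "prob_space U01"
  by (rule prob_spaceI) (simp add: space_restrict_space emeasure_restrict_space)

definition kept_mass :: "real \<Rightarrow> (real \<Rightarrow> real) \<Rightarrow> real" where
  "kept_mass \<theta> g = (\<integral>x. (if \<theta> < g x then g x else 0) \<partial>U01)"

definition truncated :: "real \<Rightarrow> (real \<Rightarrow> real) \<Rightarrow> real \<Rightarrow> real" where
  "truncated \<theta> g x = (if \<theta> < g x then g x / kept_mass \<theta> g else 0)"

definition unit_density :: "(real \<Rightarrow> real) \<Rightarrow> bool" where
  "unit_density f \<longleftrightarrow> f \<in> borel_measurable U01 \<and> (\<forall>x\<in>{0..1}. 0 \<le> f x) \<and>
     (\<exists>M. \<forall>x\<in>{0..1}. f x \<le> M) \<and> (integral\<^sup>L U01 f) = 1"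

lemma integrable_U01:
  fixes h :: "real \<Rightarrow> real"
  assumes "h \<in> borel_measurable U01" "\<And>x. x \<in> {0..1} \<Longrightarrow> \<bar>h x\<bar> \<le> M"
  shows "integrable U01 h"
proof -
  interpret prob_space U01 by (rule prob_space_U01)
  show ?thesis
    by (rule integrable_const_bound[of _ M]) (use assms in \<open>auto simp: space_restrict_space\<close>)
qed

lemma unit_density_integrable: "unit_density f \<Longrightarrow> integrable U01 f"
  by (auto simp: unit_density_def intro!: integrable_U01)

lemma flat_unit_density:
  assumes f: "f \<in> flat_densities \<beta> R" and \<beta>: "0 < \<beta>"
  shows "unit_density f"
proof -
  have "f \<in> borel_measurable U01"
    using borel_measurable_continuous_on_restrict[OF flat_densitiesD(3)[OF f \<beta>]]
    by (simp cong: measurable_cong_sets sets_restrict_space_cong)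
  moreover have "(integral\<^sup>L U01 f) = 1"
    using f by (simp add: integral_restrict_space flat_densities_def holder_densities_def set_lebesgue_integral_def)
  ultimately show ?thesis
    using flat_densitiesD(1,2)[OF f \<beta>] unfolding unit_density_def by blast
qed

lemma kept_mass_complement:
  assumes g: "unit_density g"
  shows "1 - kept_mass \<theta> g = (\<integral>x. (if \<theta> < g x then 0 else g x) \<partial>U01)"
    and "integrable U01 (\<lambda>x. if \<theta> < g x then 0 else g x)"
    and "integrable U01 (\<lambda>x. if \<theta> < g x then g x else 0)"
proof -
  have [measurable]: "g \<in> borel_measurable U01" using g by (simp add: unit_density_def)
  obtain M where M: "\<And>x. x \<in> {0..1} \<Longrightarrow> 0 \<le> g x \<and> g x \<le> M" using g unfolding unit_density_def by blast
  show i1: "integrable U01 (\<lambda>x. if \<theta> < g x then 0 else g x)"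
    by (rule integrable_U01[of _ "max 0 M"]) (use M in \<open>auto simp: le_max_iff_disj\<close>)
  show i2: "integrable U01 (\<lambda>x. if \<theta> < g x then g x else 0)"
    by (rule integrable_U01[of _ "max 0 M"]) (use M in \<open>auto simp: le_max_iff_disj\<close>)
  have "(\<integral>x. (if \<theta> < g x then 0 else g x) \<partial>U01) + kept_mass \<theta> g =
      (\<integral>x. (if \<theta> < g x then 0 else g x) + (if \<theta> < g x then g x else 0) \<partial>U01)"
    unfolding kept_mass_def using i1 i2 by simp
  also have "\<dots> = (integral\<^sup>L U01 g)" by (rule Bochner_Integration.integral_cong) auto
  also have "\<dots> = 1" using g by (simp add: unit_density_def)
  finally show "1 - kept_mass \<theta> g = (\<integral>x. (if \<theta> < g x then 0 else g x) \<partial>U01)" by simp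
qed

lemma kept_mass_bounds:
  assumes g: "unit_density g" and \<theta>: "0 \<le> \<theta>" "\<theta> \<le> 1 / 2"
  shows "1 / 2 \<le> kept_mass \<theta> g" "kept_mass \<theta> g \<le> 1"
proof -
  interpret prob_space U01 by (rule prob_space_U01)
  have nn: "0 \<le> g x" if "x \<in> {0..1}" for x using g that by (simp add: unit_density_def)
  have "0 \<le> (\<integral>x. (if \<theta> < g x then 0 else g x) \<partial>U01)"
    by (rule integral_nonneg_AE) (use nn in \<open>auto simp: space_restrict_space\<close>)
  then show "kept_mass \<theta> g \<le> 1" using kept_mass_complement(1)[OF g, of \<theta>] by simp
  have "(\<integral>x. (if \<theta> < g x then 0 else g x) \<partial>U01) \<le> (\<integral>x. \<theta> \<partial>U01)"
    by (rule integral_mono[OF kept_mass_complement(2)[OF g]]) (use \<theta> in auto)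
  also have "\<dots> = \<theta>" using prob_space by (simp add: space_restrict_space)
  finally show "1 / 2 \<le> kept_mass \<theta> g" using kept_mass_complement(1)[OF g, of \<theta>] \<theta> by simp
qed

lemma density_law_truncated:
  assumes g: "unit_density g" and \<theta>: "0 \<le> \<theta>" "\<theta> \<le> 1 / 2"
  shows "density_law (truncated \<theta> g) \<in> laws unit_borel"
proof -
  note Z = kept_mass_bounds[OF g \<theta>]
  have [measurable]: "g \<in> borel_measurable U01" using g by (simp add: unit_density_def)
  have m: "(\<lambda>x. ennreal (truncated \<theta> g x)) \<in> borel_measurable U01"
    unfolding truncated_def by measurable
  have t: "truncated \<theta> g x = (if \<theta> < g x then g x else 0) / kept_mass \<theta> g" for x
    by (simp add: truncated_def)
  have "emeasure (density_law (truncated \<theta> g)) (space (density_law (truncated \<theta> g))) =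
      (\<integral>\<^sup>+x. ennreal (truncated \<theta> g x) \<partial>U01)"
    unfolding density_law_def space_density emeasure_density[OF m sets.top] by (intro nn_integral_cong) simp
  also have "\<dots> = ennreal (\<integral>x. truncated \<theta> g x \<partial>U01)"
    unfolding t using kept_mass_complement(3)[OF g, of \<theta>] Z \<theta> by (intro nn_integral_eq_integral) auto
  also have "(\<integral>x. truncated \<theta> g x \<partial>U01) = 1"
    unfolding t using kept_mass_complement(3)[OF g, of \<theta>] Z by (simp flip: kept_mass_def)
  finally have "prob_space (density_law (truncated \<theta> g))" by (intro prob_spaceI) simp
  then show ?thesis
    by (auto simp: space_prob_algebra density_law_def cong: sets_restrict_space_cong)
qed

text \<open>In the application \<open>w\<close> and \<open>u\<close> are the rates at g and at f.
  Where g is kept, the error consists of f - g and of the renormalisation by the kept mass Z; where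
  g is cut off, the ratio is 0 and the contribution is f itself. Both f and the lost mass are
  bounded by the rates through \<open>small\<close>.\<close>

lemma truncated_chi_square:
  fixes f g w u :: "real \<Rightarrow> real"
  assumes f: "unit_density f" and g: "unit_density g" and \<theta>: "0 \<le> \<theta>" "\<theta> \<le> 1 / 2"
    and w: "integrable U01 w" and u: "integrable U01 u"
    and wu: "\<And>x. 0 \<le> w x" "\<And>x. 0 \<le> u x" and DD: "0 \<le> D" "0 \<le> D'"
    and large: "\<And>x. x \<in> {0..1} \<Longrightarrow> \<theta> < g x \<Longrightarrow> 0 < f x \<and> g x \<le> 2 * f x \<and> (f x - g x)\<^sup>2 \<le> f x * (D * w x)"
    and small: "\<And>x. x \<in> {0..1} \<Longrightarrow> g x \<le> \<theta> \<Longrightarrow> g x \<le> D' * w x \<and> f x \<le> D' * u x"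
  shows "\<exists>r. r \<in> borel_measurable unit_borel \<and> (\<forall>x. 0 \<le> r x \<and> r x \<le> 4) \<and>
     density_law (truncated \<theta> g) = density (density_law f) (\<lambda>x. ennreal (r x)) \<and>
     (\<integral>x. (r x - 1)\<^sup>2 \<partial>density_law f) \<le> (8 * D + 8 * D') * (integral\<^sup>L U01 w) + D' * (integral\<^sup>L U01 u)"
proof -
  define Z where "Z = kept_mass \<theta> g"
  note Z = kept_mass_bounds[OF g \<theta>, folded Z_def]
  have fm[measurable]: "f \<in> borel_measurable U01" and gm[measurable]: "g \<in> borel_measurable U01"
    using f g by (simp_all add: unit_density_def)
  have nn: "0 \<le> f x" if "x \<in> {0..1}" for x using f that by (simp add: unit_density_def)
  have sU: "sets U01 = sets unit_borel" by (simp cong: sets_restrict_space_cong)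
  \<comment> \<open>The ratio is bounded by 4: a factor 2 from g \<le> 2 f and another from Z \<ge>
    1 / 2.\<close>
  define r where "r x = (if x \<in> {0..1} \<and> \<theta> < g x then g x / Z / f x else 0)" for x
  have "(\<lambda>x. if \<theta> < g x then g x / Z / f x else 0) \<in> borel_measurable U01" by measurable
  then have rm[measurable]: "r \<in> borel_measurable U01"
    by (rule measurable_cong[THEN iffD1, rotated]) (auto simp: r_def space_restrict_space)
  have r_bound: "0 \<le> r x \<and> r x \<le> 4" for x
  proof (cases "x \<in> {0..1} \<and> \<theta> < g x")
    case True
    then have l: "0 < f x" "g x \<le> 2 * f x" using large by auto
    have g0: "0 \<le> g x" using True \<theta> by linarith
    have "g x / Z \<le> g x / (1 / 2)" using Z g0 by (intro divide_left_mono) auto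
    also have "\<dots> \<le> 4 * f x" using l by simp
    finally show ?thesis using True l Z g0 by (simp add: r_def divide_le_eq ac_simps)
  qed (auto simp: r_def)
  have dens: "density_law (truncated \<theta> g) = density (density_law f) (\<lambda>x. ennreal (r x))"
  proof -
    have "density (density_law f) (\<lambda>x. ennreal (r x)) = density U01 (\<lambda>x. ennreal (f x) * ennreal (r x))"
      unfolding density_law_def by (rule density_density_eq) auto
    also have "\<dots> = density_law (truncated \<theta> g)"
      unfolding density_law_def
    proof (rule density_cong)
      show "(\<lambda>x. ennreal (truncated \<theta> g x)) \<in> borel_measurable U01"
        unfolding truncated_def by measurable
      show "AE x in U01. ennreal (f x) * ennreal (r x) = ennreal (truncated \<theta> g x)"
      proof (rule AE_I2)
        fix x assume "x \<in> space U01"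
        then have x: "x \<in> {0..1}" by (simp add: space_restrict_space)
        then have "f x * r x = truncated \<theta> g x"
          using large[OF x] by (auto simp: r_def truncated_def Z_def)
        then show "ennreal (f x) * ennreal (r x) = ennreal (truncated \<theta> g x)"
          using nn[OF x] r_bound by (simp flip: ennreal_mult)
      qed
    qed auto
    finally show ?thesis ..
  qed
  have pw: "f x * (r x - 1)\<^sup>2 \<le> 8 * D * w x + 8 * (1 - Z)\<^sup>2 * f x + D' * u x" if x: "x \<in> {0..1}" for x
  proof (cases "\<theta> < g x")
    case True
    note L = large[OF x True]
    \<comment> \<open>After multiplication by f, the deviation of the ratio from 1 splits into the
      estimation error \<open>a\<close> and the renormalisation error \<open>b\<close>; the extra
      factor f is cancelled at the end.\<close>
    define a where "a = (g x - f x) / Z"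
    define b where "b = f x * ((1 - Z) / Z)"
    have Z2: "1 / Z\<^sup>2 \<le> 4"
    proof -
      have "(1/2)\<^sup>2 \<le> Z\<^sup>2" using Z by (intro power_mono) auto
      then show ?thesis using Z by (simp add: divide_le_eq power2_eq_square)
    qed
    have "f x * (r x - 1) = a + b"
      using True x L Z by (simp add: r_def a_def b_def field_simps)
    moreover have "f x * (f x * (r x - 1)\<^sup>2) = (f x * (r x - 1))\<^sup>2"
      by (simp add: power2_eq_square ac_simps)
    ultimately have "f x * (f x * (r x - 1)\<^sup>2) = (a + b)\<^sup>2" by (simp only:)
    also have "\<dots> \<le> 2 * a\<^sup>2 + 2 * b\<^sup>2"
      using sum_squares_bound[of a b] by (simp add: power2_sum)
    also have "a\<^sup>2 = (f x - g x)\<^sup>2 * (1 / Z\<^sup>2)" by (simp add: a_def power_divide power2_commute)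
    also have "\<dots> \<le> (f x * (D * w x)) * 4"
      using L Z2 DD wu by (intro mult_mono) auto
    also have "b\<^sup>2 = (f x)\<^sup>2 * (1 - Z)\<^sup>2 * (1 / Z\<^sup>2)" by (simp add: b_def power_mult_distrib power_divide)
    also have "\<dots> \<le> (f x)\<^sup>2 * (1 - Z)\<^sup>2 * 4" using Z2 by (intro mult_left_mono) auto
    finally have "f x * (f x * (r x - 1)\<^sup>2) \<le> f x * (8 * D * w x + 8 * (1 - Z)\<^sup>2 * f x)"
      by (simp add: algebra_simps power2_eq_square)
    then have "f x * (r x - 1)\<^sup>2 \<le> 8 * D * w x + 8 * (1 - Z)\<^sup>2 * f x"
      using L by (simp add: mult_le_cancel_left_pos)
    moreover have "0 \<le> D' * u x" using DD wu by simp
    ultimately show ?thesis by linarith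
  next
    case False
    then have "f x * (r x - 1)\<^sup>2 = f x" by (simp add: r_def)
    moreover have "f x \<le> D' * u x" using small[OF x] False by simp
    moreover have "0 \<le> 8 * D * w x" "0 \<le> 8 * (1 - Z)\<^sup>2 * f x" using DD wu nn[OF x] by auto
    ultimately show ?thesis by linarith
  qed
  note fi = unit_density_integrable[OF f]
  have "(\<integral>x. (r x - 1)\<^sup>2 \<partial>density_law f) = (\<integral>x. f x * (r x - 1)\<^sup>2 \<partial>U01)"
    unfolding density_law_def
    by (subst integral_density) (use nn in \<open>auto simp: space_restrict_space\<close>)
  also have "\<dots> \<le> (\<integral>x. 8 * D * w x + 8 * (1 - Z)\<^sup>2 * f x + D' * u x \<partial>U01)"
  proof (rule integral_mono)
    obtain M where M: "\<And>x. x \<in> {0..1} \<Longrightarrow> f x \<le> M" using f unfolding unit_density_def by blast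
    show "integrable U01 (\<lambda>x. f x * (r x - 1)\<^sup>2)"
    proof (rule integrable_U01)
      fix x :: real assume x: "x \<in> {0..1}"
      have "(r x - 1)\<^sup>2 \<le> 3\<^sup>2" using r_bound[of x] by (intro abs_le_square_iff[THEN iffD1]) auto
      then show "\<bar>f x * (r x - 1)\<^sup>2\<bar> \<le> M * 3\<^sup>2"
        using nn[OF x] M[OF x] unfolding abs_mult by (intro mult_mono) auto
    qed measurable
  qed (use w u fi pw in \<open>auto simp: space_restrict_space\<close>)
  also have "\<dots> = 8 * D * (integral\<^sup>L U01 w) + 8 * (1 - Z)\<^sup>2 + D' * (integral\<^sup>L U01 u)"
    using w u fi f by (simp add: unit_density_def)
  \<comment> \<open>The lost mass 1 - Z lies in [0, 1], so its square is at most the mass itself,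
    which is the integral of g where g is cut off.\<close>
  also have "(1 - Z)\<^sup>2 \<le> D' * (integral\<^sup>L U01 w)"
  proof -
    have "(1 - Z)\<^sup>2 \<le> 1 - Z" using Z by (simp add: power2_eq_square mult_left_le)
    also have "1 - Z = (\<integral>x. (if \<theta> < g x then 0 else g x) \<partial>U01)"
      unfolding Z_def by (rule kept_mass_complement(1)[OF g])
    also have "\<dots> \<le> (\<integral>x. D' * w x \<partial>U01)"
      by (rule integral_mono[OF kept_mass_complement(2)[OF g]])
         (use w small DD wu in \<open>auto simp: space_restrict_space\<close>)
    also have "\<dots> = D' * (integral\<^sup>L U01 w)" by simp
    finally show ?thesis .
  qed
  finally have "(\<integral>x. (r x - 1)\<^sup>2 \<partial>density_law f) \<le> (8 * D + 8 * D') * (integral\<^sup>L U01 w) + D' * (integral\<^sup>L U01 u)"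
    by (simp add: algebra_simps)
  moreover have "r \<in> borel_measurable unit_borel" using rm unfolding measurable_cong_sets[OF sU refl] .
  ultimately show ?thesis using r_bound dens by blast
qed

section \<open>The estimator and its risk\<close>

definition grid_index :: "nat \<Rightarrow> (nat \<times> nat) set" where
  "grid_index n = {..n} \<times> {..n}"

text \<open>The intersection makes every cell a set of \<open>unit_borel\<close>, whatever the
  indices are.\<close>

definition grid_cell :: "nat \<Rightarrow> nat \<times> nat \<Rightarrow> real set" where
  "grid_cell n = (\<lambda>(a, b). {a / n..b / n} \<inter> {0..1})"

abbreviation "fits n \<equiv> compatible (grid_index n) (grid_cell n)"
abbreviation "grid_hits n \<equiv> hit_vector (grid_index n) (grid_cell n)"

text \<open>The choice sees the observations only through the count vector. The point mass at 0 is
  an arbitrary law for counts that no element of \<open>T\<close> fits; this does not happen when f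
  itself fits.\<close>

definition estimator ::
    "(real \<Rightarrow> real) set \<Rightarrow> nat \<Rightarrow> nat \<Rightarrow> real \<Rightarrow> real \<Rightarrow> (nat \<Rightarrow> real) \<Rightarrow> real measure" where
  "estimator T n m t \<theta> w =
     (let F = {g \<in> T. fits n m t (grid_hits n m w) g}
      in if F = {} then return unit_borel 0 else density_law (truncated \<theta> (SOME g. g \<in> F)))"

lemma grid_cell_sets: "grid_cell n i \<in> sets unit_borel"
  unfolding grid_cell_def case_prod_beta sets_restrict_space
  by (rule image_eqI[of _ _ "{fst i / n..snd i / n}"]) auto

lemma measurable_estimator:
  assumes T: "\<And>g. g \<in> T \<Longrightarrow> unit_density g" and \<theta>: "0 \<le> \<theta>" "\<theta> \<le> 1 / 2"
  shows "estimator T n m t \<theta> \<in> kernels (Seq m unit_borel) unit_borel"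
proof -
  define E where "E c = (let F = {g \<in> T. fits n m t c g}
      in if F = {} then return unit_borel 0 else density_law (truncated \<theta> (SOME g. g \<in> F)))" for c
  have "E c \<in> laws unit_borel" for c
  proof (cases "{g \<in> T. fits n m t c g} = {}")
    case True
    have "return unit_borel (0::real) \<in> laws unit_borel"
      by (rule measurable_space[OF measurable_return_prob_space]) (simp add: space_restrict_space)
    then show ?thesis using True by (simp add: E_def)
  next
    case False
    then have E: "E c = density_law (truncated \<theta> (SOME g. g \<in> {g \<in> T. fits n m t c g}))"
      by (simp only: E_def Let_def if_False)
    have "(SOME g. g \<in> {g \<in> T. fits n m t c g}) \<in> T"
      using some_in_eq[of "{g \<in> T. fits n m t c g}"] False by blast
    then show ?thesis
      unfolding E by (rule density_law_truncated[OF T \<theta>])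
  qed
  then have "(\<lambda>w. E (grid_hits n m w)) \<in> kernels (Seq m unit_borel) unit_borel"
    by (intro measurable_hit_vector_compose) (auto simp: grid_index_def grid_cell_sets)
  then show ?thesis by (simp add: E_def estimator_def[abs_def])
qed

text \<open>The triangle inequality through the common counts, divided by the sample size m = n div
  4, which is at least n / 8 as n \<ge> 8.\<close>

lemma compatible_imp_grid_close:
  fixes \<beta> R :: real
  assumes f: "f \<in> flat_densities \<beta> R" and g: "g \<in> flat_densities \<beta> R" and \<beta>: "0 < \<beta>"
    and n: "8 \<le> n" and ln1: "1 \<le> ln n"
    and cf: "fits n (n div 4) (4 * ln n) c f"
    and cg: "fits n (n div 4) (4 * ln n) c g"
  shows "grid_close n 64 ((ln n)\<^sup>2 / n) f g"
proof -
  let ?m = "real (n div 4)" and ?l = "(ln n)\<^sup>2 / n" and ?L = "ln n"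
  have "\<bar>integral {a/n..b/n} f - integral {a/n..b/n} g\<bar> \<le>
      64 * (?l + sqrt (?l * integral {a/n..b/n} f) + sqrt (?l * integral {a/n..b/n} g))"
    if ab: "a \<le> n" "b \<le> n" for a b
  proof -
  have n0: "0 < real n" using n by simp
  have m8: "n \<le> 8 * ?m" using n by linarith
  have m0: "0 < ?m" using m8 n0 by linarith
  have cell: "{real a / n..real b / n} \<inter> {0..1} = {real a / n..real b / n}"
    using ab n0 by (auto simp: divide_le_eq intro: order_trans)
  have P: "measure (density_law u) (grid_cell n (a, b)) = integral {a/n..b/n} u" if "u \<in> flat_densities \<beta> R" for u
    using measure_density_law_interval[OF flat_densitiesD(3)[OF that \<beta>] flat_densitiesD(1)[OF that \<beta>], of "a / n" "b / n"] ab n0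
    by (simp add: grid_cell_def cell)
  define p where "p = integral {a/n..b/n} f"
  define q where "q = integral {a/n..b/n} g"
  have p0: "0 \<le> p" "0 \<le> q" unfolding p_def q_def using P[OF f] P[OF g] measure_nonneg by metis+
  let ?c = "real (c (a, b))"
  have i: "(a, b) \<in> grid_index n" using ab by (simp add: grid_index_def)
  have 1: "\<bar>?c - ?m * p\<bar> \<le> 4 * ?L * (1 + sqrt (?m * p))"
    using cf i P[OF f] unfolding compatible_def p_def by (metis (no_types, lifting))
  have 2: "\<bar>?c - ?m * q\<bar> \<le> 4 * ?L * (1 + sqrt (?m * q))"
    using cg i P[OF g] unfolding compatible_def q_def by (metis (no_types, lifting))
  have "?m * \<bar>p - q\<bar> = \<bar>?m * p - ?m * q\<bar>" using m0 by (simp add: abs_mult flip: right_diff_distrib)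
  also have "\<dots> \<le> 4 * ?L * (1 + sqrt (?m * p)) + 4 * ?L * (1 + sqrt (?m * q))" using 1 2 by linarith
  finally have "\<bar>p - q\<bar> \<le> (4 * ?L * (1 + sqrt (?m * p)) + 4 * ?L * (1 + sqrt (?m * q))) / ?m"
    using m0 by (simp add: le_divide_eq mult.commute)
  also have "\<dots> = 8 * (?L / ?m) + 4 * (?L * sqrt (?m * p) / ?m) + 4 * (?L * sqrt (?m * q) / ?m)"
    by (simp add: algebra_simps add_divide_distrib)
  \<comment> \<open>The factor 8 of n / m appears once in the linear term, where ln n \<le> (ln n)^2
    is used as well, and under the root in the others, where sqrt 8 is rounded up to 3.\<close>
  also have "\<dots> \<le> 8 * (8 * ?l) + 4 * (3 * sqrt (?l * p)) + 4 * (3 * sqrt (?l * q))"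
  proof -
    have Lm: "?L / ?m \<le> 8 * ?l"
    proof -
      have "?L / ?m \<le> ?L / (n / 8)" using m8 m0 n0 ln1 by (intro divide_left_mono) auto
      also have "\<dots> = 8 * (?L / n)" by simp
      also have "?L \<le> ?L\<^sup>2" using ln1 by (simp add: power2_eq_square mult_le_cancel_left1)
      then have "8 * (?L / n) \<le> 8 * ?l" using n0 by (simp add: divide_right_mono)
      finally show ?thesis .
    qed
    have sq: "?L * sqrt (?m * s) / ?m \<le> 3 * sqrt (?l * s)" if "0 \<le> s" for s
    proof (rule power2_le_imp_le)
      have "(?L * sqrt (?m * s) / ?m)\<^sup>2 = ?L\<^sup>2 * s / ?m"
        using m0 that by (simp add: power_mult_distrib power_divide) (simp add: power2_eq_square)
      also have "\<dots> \<le> ?L\<^sup>2 * s / (n / 8)" using m8 m0 n0 that by (intro divide_left_mono) auto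
      also have "\<dots> \<le> 9 * (?l * s)" using that n0 by (simp add: divide_right_mono mult_right_mono)
      also have "\<dots> = (3 * sqrt (?l * s))\<^sup>2" using that n0 by (simp add: power_mult_distrib)
      finally show "(?L * sqrt (?m * s) / ?m)\<^sup>2 \<le> (3 * sqrt (?l * s))\<^sup>2" .
      show "0 \<le> 3 * sqrt (?l * s)" using that n0 by simp
    qed
    show ?thesis using Lm sq[OF p0(1)] sq[OF p0(2)] by linarith
  qed
  also have "\<dots> \<le> 64 * (?l + sqrt (?l * p) + sqrt (?l * q))"
  proof -
    have "0 \<le> sqrt (?l * p)" "0 \<le> sqrt (?l * q)" using p0 n0 by simp_all
    then show ?thesis by (simp add: algebra_simps)
  qed
  finally have "\<bar>p - q\<bar> \<le> 64 * (?l + sqrt (?l * p) + sqrt (?l * q))" .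
  then show ?thesis unfolding p_def q_def .
  qed
  then show ?thesis by (simp add: grid_close_def)
qed

section \<open>The rate integrated over the unit interval\<close>

definition mean_rate :: "nat \<Rightarrow> real \<Rightarrow> (real \<Rightarrow> real) \<Rightarrow> real" where
  "mean_rate n \<beta> f = (\<integral>x. rate n \<beta> (f x) \<partial>U01)"

lemma integrable_rate:
  assumes "unit_density f" and n: "0 < n" and \<beta>: "0 < \<beta>"
  shows "integrable U01 (\<lambda>x. rate n \<beta> (f x))"
proof (rule integrable_U01)
  have [measurable]: "f \<in> borel_measurable U01" using assms(1) by (simp add: unit_density_def)
  show "(\<lambda>x. rate n \<beta> (f x)) \<in> borel_measurable U01" by measurable
  fix x :: real assume "x \<in> {0..1}"
  have "max (f x) (n powr (- (\<beta> / (\<beta> + 1)))) powr (- (1 / (2 * \<beta> + 1))) \<le> (n powr (- (\<beta> / (\<beta> + 1)))) powr (- (1 / (2 * \<beta> + 1)))"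
    using n \<beta> by (intro powr_mono2') auto
  then show "\<bar>rate n \<beta> (f x)\<bar> \<le> n powr (- (rate_exp \<beta>)) * (ln n)\<^sup>2 * (n powr (- (\<beta> / (\<beta> + 1)))) powr (- (1 / (2 * \<beta> + 1)))"
    unfolding rate_def by (simp add: mult_left_mono)
qed

text \<open>The target is never smaller than a multiple of 1 / n. This absorbs the probability that
  f does not fit the counts, which enters every insertion.\<close>

lemma mean_rate_ge:
  fixes \<beta> R :: real
  assumes f: "f \<in> flat_densities \<beta> R" and \<beta>: "0 < \<beta>" and n: "0 < n" and ln1: "1 \<le> ln n"
  shows "max 1 R powr (- (1 / (2 * \<beta> + 1))) / n \<le> mean_rate n \<beta> f"
proof -
  interpret prob_space U01 by (rule prob_space_U01)
  let ?c = "max 1 R powr (- (1 / (2 * \<beta> + 1))) / n"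
  have pw: "?c \<le> rate n \<beta> (f x)" if x: "x \<in> {0..1}" for x
  proof -
    have "n powr (- (\<beta> / (\<beta> + 1))) \<le> n powr 0" using n \<beta> by (intro powr_mono) auto
    then have "max (f x) (n powr (- (\<beta> / (\<beta> + 1)))) \<le> max 1 R"
      using flat_densitiesD(2)[OF f \<beta> x] n by auto
    then have 1: "max 1 R powr (- (1 / (2 * \<beta> + 1))) \<le> max (f x) (n powr (- (\<beta> / (\<beta> + 1)))) powr (- (1 / (2 * \<beta> + 1)))"
      using n \<beta> by (intro powr_mono2') (auto simp: less_max_iff_disj)
    have "n powr (- 1) \<le> n powr (- (rate_exp \<beta>))"
      using n \<beta> by (intro powr_mono) auto
    moreover have "1 \<le> (ln n)\<^sup>2" using ln1 by (simp add: one_le_power)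
    ultimately have 2: "n powr (- 1) * 1 \<le> n powr (- (rate_exp \<beta>)) * (ln n)\<^sup>2"
      by (intro mult_mono) auto
    have "n powr (- 1) * 1 * max 1 R powr (- (1 / (2 * \<beta> + 1))) \<le> rate n \<beta> (f x)"
      unfolding rate_def by (rule mult_mono[OF 2 1]) auto
    then show ?thesis using n by (simp add: powr_minus_divide mult.commute)
  qed
  have "?c = (\<integral>x. ?c \<partial>U01)" using prob_space by (simp add: space_restrict_space)
  also have "\<dots> \<le> mean_rate n \<beta> f"
    unfolding mean_rate_def
    using integrable_rate[OF flat_unit_density[OF f \<beta>] n \<beta>] pw
    by (intro integral_mono) (auto simp: space_restrict_space)
  finally show ?thesis .
qed

lemma mean_rate_eq:
  fixes \<beta> R :: real
  assumes f: "f \<in> flat_densities \<beta> R" and \<beta>: "0 < \<beta>" and n: "0 < n"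
  shows "ennreal (mean_rate n \<beta> f) = ennreal (real n powr (- (rate_exp \<beta>)) * (ln (real n))\<^sup>2) *
     (\<integral>\<^sup>+x\<in>{0..1}. ennreal_powr (min (1 / ennreal (f x)) (ennreal (real n powr (\<beta> / (\<beta> + 1))))) (1 / (2 * \<beta> + 1)) \<partial>lborel)"
    (is "_ = ennreal ?\<rho> * _")
proof -
  let ?\<tau> = "real n powr (- (\<beta> / (\<beta> + 1)))" and ?p = "1 / (2 * \<beta> + 1)"
  have \<tau>0: "0 < ?\<tau>" using n by simp
  have inv: "real n powr (\<beta> / (\<beta> + 1)) = 1 / ?\<tau>" using n by (simp add: powr_minus_divide)
  have pw: "ennreal_powr (min (1 / ennreal (f x)) (ennreal (real n powr (\<beta> / (\<beta> + 1))))) ?p = ennreal (max (f x) ?\<tau> powr (- ?p))"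
    if x: "x \<in> {0..1}" for x
  proof -
    have "min (1 / ennreal (f x)) (ennreal (1 / ?\<tau>)) = ennreal (1 / max (f x) ?\<tau>)"
    proof (cases "f x = 0")
      \<comment> \<open>At a zero of f the reciprocal is infinite in \<open>ennreal\<close>, and the
        minimum is the power of n.\<close>
      case True
      then show ?thesis using \<tau>0 by (simp add: max_absorb2)
    next
      case False
      then have "0 < f x" using flat_densitiesD(1)[OF f \<beta> x] by simp
      then have "1 / ennreal (f x) = ennreal (1 / f x)" by (simp add: divide_ennreal flip: ennreal_1)
      moreover have "min (1 / f x) (1 / ?\<tau>) = 1 / max (f x) ?\<tau>"
        using \<open>0 < f x\<close> \<tau>0 by (auto simp: min_def max_def frac_le divide_le_cancel field_simps)
      ultimately show ?thesis using \<open>0 < f x\<close> \<tau>0 by (simp add: min_ennreal)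
    qed
    moreover have "(1 / max (f x) ?\<tau>) powr ?p = max (f x) ?\<tau> powr (- ?p)"
      using \<tau>0 by (simp add: powr_divide powr_minus_divide)
    ultimately show ?thesis unfolding inv using \<tau>0 by (simp add: ennreal_powr_def less_max_iff_disj le_max_iff_disj)
  qed
  have fm: "f \<in> borel_measurable U01"
    using flat_unit_density[OF f \<beta>] by (simp add: unit_density_def)
  have "ennreal (mean_rate n \<beta> f) = (\<integral>\<^sup>+x. ennreal (rate n \<beta> (f x)) \<partial>U01)"
    unfolding mean_rate_def
    using integrable_rate[OF flat_unit_density[OF f \<beta>] n \<beta>] rate_nonneg
    by (intro nn_integral_eq_integral[symmetric]) auto
  also have "\<dots> = (\<integral>\<^sup>+x. ennreal ?\<rho> * ennreal (max (f x) ?\<tau> powr (- ?p)) \<partial>U01)"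
    by (simp add: rate_def ennreal_mult')
  also have "\<dots> = ennreal ?\<rho> * (\<integral>\<^sup>+x. ennreal (max (f x) ?\<tau> powr (- ?p)) \<partial>U01)"
    using fm by (intro nn_integral_cmult) auto
  also have "(\<integral>\<^sup>+x. ennreal (max (f x) ?\<tau> powr (- ?p)) \<partial>U01) =
      (\<integral>\<^sup>+x. ennreal (max (f x) ?\<tau> powr (- ?p)) * indicator {0..1} x \<partial>lborel)"
    by (subst nn_integral_restrict_space) auto
  also have "\<dots> = (\<integral>\<^sup>+x\<in>{0..1}. ennreal_powr (min (1 / ennreal (f x)) (ennreal (real n powr (\<beta> / (\<beta> + 1))))) ?p \<partial>lborel)"
    by (intro nn_integral_cong) (auto simp: pw indicator_def)
  finally show ?thesis .
qed

text \<open>A bound uniform in f: it makes the supremum over the parameter set finite, so that it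
  can be treated as a real number.\<close>

lemma mean_rate_le:
  assumes f: "unit_density f" and n: "0 < n" and \<beta>: "0 < \<beta>"
  shows "mean_rate n \<beta> f \<le> rate n \<beta> 0"
proof -
  interpret prob_space U01 by (rule prob_space_U01)
  have "rate n \<beta> (f x) \<le> rate n \<beta> 0" for x
    unfolding rate_def using n \<beta> by (intro mult_left_mono powr_mono2') (auto simp: max_def)
  then have "mean_rate n \<beta> f \<le> (\<integral>x. rate n \<beta> 0 \<partial>U01)"
    unfolding mean_rate_def by (intro integral_mono[OF integrable_rate[OF f n \<beta>]]) auto
  also have "\<dots> = rate n \<beta> 0" using prob_space by (simp add: space_restrict_space)
  finally show ?thesis .
qed

text \<open>For an empty parameter set the right-hand side of the theorem is 0, so the distance has
  to be exactly 0. The infimum needs at least one kernel, for which a point of the target space is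
  enough.\<close>

lemma deficiency_empty:
  assumes "space (sample_space F) \<noteq> {}"
  shows "deficiency {} E F = 0"
proof -
  obtain x where "x \<in> space (sample_space F)" using assms by blast
  then have "(\<lambda>_. return (sample_space F) x) \<in> kernels (sample_space E) (sample_space F)"
    by (intro measurable_const measurable_space[OF measurable_return_prob_space])
  then have "deficiency {} E F \<le> 0"
    unfolding deficiency_def by (rule INF_lower2) (simp add: bot_ennreal)
  then show ?thesis by simp
qed

lemma le_cam_dist_empty: "le_cam_dist {} (density_experiment n) (poisson_experiment n) = 0"
proof -
  have "(\<lambda>i\<in>{..<n}. 0) \<in> space (Seq n unit_borel)"
    by (auto simp: space_PiM space_restrict_space)
  then have "space (sample_space (density_experiment n)) \<noteq> {}" by (auto simp: density_experiment_def)
  moreover have "{#} \<in> space (sample_space (poisson_experiment n))"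
    by (simp add: poisson_experiment_def space_point_configs)
  then have "space (sample_space (poisson_experiment n)) \<noteq> {}" by blast
  ultimately show ?thesis by (simp add: le_cam_dist_def deficiency_empty)
qed

text \<open>In the constant, \<open>24 / sqrt c\<close> accounts for the probability that \<open>f\<close> is incompatible with the
  counts, the other term for the chi-square cost of insertions among at least \<open>n / 4\<close> positions.\<close>

lemma le_cam_dist_le_mean_rate:
  fixes \<beta> R B C :: real and T :: "(real \<Rightarrow> real) set"
  defines "M \<equiv> max 1 R"
  defines "c \<equiv> M powr (- (1 / (2 * \<beta> + 1)))"
  assumes \<beta>: "0 < \<beta>" and T: "T \<subseteq> flat_densities \<beta> R" "T \<noteq> {}"
    and n: "8 \<le> n" and ln1: "1 \<le> ln n"
    and B: "\<And>f. f \<in> T \<Longrightarrow> mean_rate n \<beta> f \<le> B"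
    and C: "1 \<le> C"
    and close: "\<And>f g x v. f \<in> T \<Longrightarrow> g \<in> T \<Longrightarrow> grid_close n 64 ((ln n)\<^sup>2 / n) f g \<Longrightarrow> x \<in> {0..1} \<Longrightarrow>
        v = max (f x) (g x) \<Longrightarrow> ((ln n)\<^sup>2 / n) powr (\<beta> / (\<beta> + 1)) \<le> v \<Longrightarrow>
        \<bar>f x - g x\<bar> \<le> C * (v * ((ln n)\<^sup>2 / n)) powr (\<beta> / (2 * \<beta> + 1))"
    and \<theta>: "(2 * C)\<^sup>2 * ((ln n)\<^sup>2 / n) powr (\<beta> / (\<beta> + 1)) \<le> 1 / 2"
  shows "le_cam_dist T (density_experiment n) (poisson_experiment n) \<le>
    ennreal ((24 / sqrt c + sqrt (4 * (16 * C\<^sup>2 + 9 * (8 * C\<^sup>2)\<^sup>2))) * sqrt B)"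
proof -
  define l where "l = (ln n)\<^sup>2 / n"
  define \<theta>' where "\<theta>' = (2 * C)\<^sup>2 * l powr (\<beta> / (\<beta> + 1))"
  define m where "m = n div 4"
  define J where "J = n div 2"
  \<comment> \<open>The sum of 8 * 2 C^2, 8 (8 C^2)^2 and (8 C^2)^2, the coefficients in the
    chi-square bound when both integrated rates are at most B.\<close>
  define D where "D = 16 * C\<^sup>2 + 9 * (8 * C\<^sup>2)\<^sup>2"
  define \<eta> where "\<eta> = (24 / sqrt c + sqrt (4 * D)) * sqrt (B / n)"
  have n0: "0 < n" "0 < real n" using n by auto
  have c0: "0 < c" by (simp add: c_def M_def)
  have D0: "0 \<le> D" by (simp add: D_def)
  have ud: "unit_density f" if "f \<in> T" for f using flat_unit_density[OF _ \<beta>] T that by blast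
  have dl: "density_law f \<in> laws unit_borel" if "f \<in> T" for f
    using density_law_in_prob_algebra[OF \<beta>] T that unfolding flat_densities_def by blast
  obtain f0 where "f0 \<in> T" using T by blast
  then have cB: "c / n \<le> B"
    using mean_rate_ge[OF _ \<beta> n0(1) ln1, of f0 R] B[of f0] T by (auto simp: c_def M_def)
  then have B0: "0 < B" using c0 n0 by (meson divide_pos_pos less_le_trans)
  have sB: "sqrt c / n \<le> sqrt (B / n)"
  proof -
    have "sqrt c / n = sqrt (c / n / n)"
      using n0 by (simp add: real_sqrt_divide)
    also have "\<dots> \<le> sqrt (B / n)" using cB n0 by (intro real_sqrt_le_mono divide_right_mono) auto
    finally show ?thesis .
  qed
  have e24: "24 / n \<le> 24 / sqrt c * sqrt (B / n)"
    using mult_left_mono[OF sB, of "24 / sqrt c"] c0 by simp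
  have \<eta>0: "0 \<le> \<eta>" using c0 D0 B0 n0 by (simp add: \<eta>_def)
  have \<eta>24: "24 / n \<le> \<eta>"
  proof -
    have "0 \<le> sqrt (4 * D) * sqrt (B / n)" using D0 B0 n0 by simp
    then show ?thesis using e24 by (simp add: \<eta>_def distrib_right)
  qed
  have \<theta>'0: "0 \<le> \<theta>'" "\<theta>' \<le> 1 / 2" using \<theta> by (auto simp: \<theta>'_def l_def)
  let ?\<nu> = "estimator T n m (4 * ln n) \<theta>'"
  have \<nu>: "?\<nu> \<in> kernels (Seq m unit_borel) unit_borel"
    by (rule measurable_estimator[OF ud \<theta>'0])
  \<comment> \<open>With fewer than m points there is no estimator. Appending the constant 0 is a
    measurable placeholder, as accuracy is claimed only from J on, and m \<le> J.\<close>
  define \<kappa> where "\<kappa> j = (if m \<le> j then step_kernel unit_borel m j ?\<nu>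
    else (\<lambda>x. return (Seq (Suc j) unit_borel) (insert_swap j j x 0)))" for j
  have \<kappa>: "\<kappa> j \<in> kernels (Seq j unit_borel) (Seq (Suc j) unit_borel)" for j
  proof (cases "m \<le> j")
    case True
    then show ?thesis unfolding \<kappa>_def using measurable_step_kernel[OF \<nu> True] by simp
  next
    case False
    have "(0::real) \<in> space unit_borel" by (simp add: space_restrict_space)
    from measurable_Pair1[OF measurable_insert_swap[OF order_refl] this]
    have "(\<lambda>x. insert_swap j j x (0::real)) \<in> Seq j unit_borel \<rightarrow>\<^sub>M Seq (Suc j) unit_borel"
      by simp
    from measurable_compose[OF this measurable_return_prob_space] False show ?thesis by (simp add: \<kappa>_def)
  qed
  have step: "tv_le (ennreal \<eta>) (iid_law j f \<bind> \<kappa> j) (iid_law (Suc j) f)" if f: "f \<in> T" and j: "J \<le> j" for f j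
  proof -
    let ?G = "{w \<in> space (Seq m unit_borel). fits n m (4 * ln n) (grid_hits n m w) f}"
    have mj: "m \<le> j" using j by (simp add: m_def J_def)
    have fin: "finite (grid_index n)" by (simp add: grid_index_def)
    have t0: "0 \<le> 4 * ln n" using ln1 by simp
    note G = compatible_hit_vector[OF dl[OF f] fin grid_cell_sets t0, of m]
    have good: "\<exists>r. r \<in> borel_measurable unit_borel \<and> (\<forall>x. 0 \<le> r x \<and> r x \<le> 4) \<and>
        ?\<nu> w = density (density_law f) (\<lambda>x. ennreal (r x)) \<and> (\<integral>x. (r x - 1)\<^sup>2 \<partial>density_law f) \<le> D * B"
      if w: "w \<in> ?G" for w
    proof -
      define F where "F = {g \<in> T. fits n m (4 * ln n) (grid_hits n m w) g}"
      define g where "g = (SOME g. g \<in> F)"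
      have fF: "f \<in> F" using w f by (simp add: F_def)
      then have gF: "g \<in> F" unfolding g_def using some_in_eq[of F] by blast
      have \<nu>w: "?\<nu> w = density_law (truncated \<theta>' g)"
        using fF by (auto simp: estimator_def F_def[symmetric] g_def[symmetric] Let_def)
      have gT: "g \<in> T" using gF by (simp add: F_def)
      have gc: "grid_close n 64 l f g"
        unfolding l_def
        by (rule compatible_imp_grid_close[OF _ _ \<beta> n ln1]) (use fF gF T in \<open>auto simp: F_def m_def\<close>)
      have nn: "0 \<le> f x" "0 \<le> g x" if "x \<in> {0..1}" for x
        using ud[OF f] ud[OF gT] that by (simp_all add: unit_density_def)
      have cl: "\<bar>f x - g x\<bar> \<le> C * (v * l) powr (\<beta> / (2 * \<beta> + 1))"
        if "x \<in> {0..1}" "v = max (f x) (g x)" "l powr (\<beta> / (\<beta> + 1)) \<le> v" for x v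
        using close[OF f gT gc[unfolded l_def] that(1,2)] that(3) unfolding l_def by blast
      note pc = pointwise_comparison[OF \<beta> ln1 n0(1) C, folded l_def \<theta>'_def]
      have "\<exists>r. r \<in> borel_measurable unit_borel \<and> (\<forall>x. 0 \<le> r x \<and> r x \<le> 4) \<and>
         density_law (truncated \<theta>' g) = density (density_law f) (\<lambda>x. ennreal (r x)) \<and>
         (\<integral>x. (r x - 1)\<^sup>2 \<partial>density_law f) \<le>
           (8 * (2 * C\<^sup>2) + 8 * (8 * C\<^sup>2)\<^sup>2) * (\<integral>x. rate n \<beta> (g x) \<partial>U01) + (8 * C\<^sup>2)\<^sup>2 * (\<integral>x. rate n \<beta> (f x) \<partial>U01)"
      proof (rule truncated_chi_square[OF ud[OF f] ud[OF gT] \<theta>'0 integrable_rate[OF ud[OF gT] n0(1) \<beta>] integrable_rate[OF ud[OF f] n0(1) \<beta>] rate_nonneg rate_nonneg])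
        fix x :: real assume x: "x \<in> {0..1}"
        show "\<theta>' < g x \<Longrightarrow> 0 < f x \<and> g x \<le> 2 * f x \<and> (f x - g x)\<^sup>2 \<le> f x * (2 * C\<^sup>2 * rate n \<beta> (g x))"
          unfolding \<theta>'_def by (rule pc(1)[OF nn[OF x]]) (auto intro: cl[OF x])
        show "g x \<le> \<theta>' \<Longrightarrow> g x \<le> (8 * C\<^sup>2)\<^sup>2 * rate n \<beta> (g x) \<and> f x \<le> (8 * C\<^sup>2)\<^sup>2 * rate n \<beta> (f x)"
          unfolding \<theta>'_def by (rule pc(2)[OF nn[OF x]]) (auto intro: cl[OF x])
      qed auto
      moreover have "(8 * (2 * C\<^sup>2) + 8 * (8 * C\<^sup>2)\<^sup>2) * mean_rate n \<beta> g + (8 * C\<^sup>2)\<^sup>2 * mean_rate n \<beta> f \<le>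
          (8 * (2 * C\<^sup>2) + 8 * (8 * C\<^sup>2)\<^sup>2) * B + (8 * C\<^sup>2)\<^sup>2 * B"
        using B[OF f] B[OF gT] by (intro add_mono mult_left_mono) auto
      moreover have "\<dots> = D * B" by (simp add: D_def algebra_simps)
      ultimately show ?thesis
        unfolding \<nu>w mean_rate_def by fastforce
    qed
    have "tv_le (ennreal (2 * card (grid_index n) * exp (1 - 4 * ln n)) + ennreal (sqrt (D * B / (Suc j - m))))
        (iid_law j f \<bind> step_kernel unit_borel m j ?\<nu>) (iid_law (Suc j) f)"
      unfolding iid_law_def
      by (rule tv_le_step_kernel[OF dl[OF f] \<nu> mj G(1) G(2)[unfolded iid_law_def] good])
    moreover have "ennreal (2 * card (grid_index n) * exp (1 - 4 * ln n)) + ennreal (sqrt (D * B / (Suc j - m))) \<le> ennreal \<eta>"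
    proof -
      \<comment> \<open>There are (n + 1)^2 \<le> (2 n)^2 cells, the tolerance 4 ln n gives e / n^4
        with e \<le> 3, and both tails count: 2 * 4 * 3 = 24, with a spare factor 1 / n.\<close>
      have "2 * card (grid_index n) * exp (1 - 4 * ln n) \<le> 24 / n"
      proof -
        have "exp (1 - 4 * ln n) = exp 1 / real n ^ 4"
          using n0 by (simp add: exp_diff exp_of_nat_mult[of 4 "ln (real n)", simplified])
        moreover have "real (card (grid_index n)) = (real n + 1)\<^sup>2"
          by (simp add: grid_index_def card_cartesian_product power2_eq_square algebra_simps)
        moreover have "(real n + 1)\<^sup>2 \<le> (2 * real n)\<^sup>2" using n0 by (intro power_mono) auto
        moreover have "exp 1 / real n ^ 4 \<le> 3 / real n ^ 4" using exp_le by (intro divide_right_mono) auto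
        ultimately have "2 * card (grid_index n) * exp (1 - 4 * ln n) \<le> 2 * (2 * real n)\<^sup>2 * (3 / real n ^ 4)"
          by (simp only: of_nat_mult of_nat_numeral) (intro mult_mono, auto)
        also have "\<dots> = 24 / (real n)\<^sup>2" using n0 by (simp add: field_simps power2_eq_square eval_nat_numeral)
        also have "\<dots> \<le> 24 / n" using n0 by (intro divide_left_mono) (auto simp: power2_eq_square)
        finally show ?thesis .
      qed
      also have "\<dots> \<le> 24 / sqrt c * sqrt (B / n)" by (rule e24)
      finally have 1: "2 * card (grid_index n) * exp (1 - 4 * ln n) \<le> 24 / sqrt c * sqrt (B / n)" .
      \<comment> \<open>Half of n lies below j and a quarter is reserved for the estimator, so at
        least n / 4 positions are available for the insertion.\<close>
      have "n \<le> 4 * (Suc j - m)" using j by (simp add: m_def J_def)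
      then have "n / 4 \<le> real (Suc j - m)" by linarith
      then have "D * B / (Suc j - m) \<le> D * B / (n / 4)"
        using D0 B0 n0 by (intro divide_left_mono) auto
      then have "sqrt (D * B / (Suc j - m)) \<le> sqrt (4 * D * (B / n))" by (simp add: ac_simps)
      also have "\<dots> = sqrt (4 * D) * sqrt (B / n)" by (rule real_sqrt_mult)
      finally have "2 * card (grid_index n) * exp (1 - 4 * ln n) + sqrt (D * B / (Suc j - m)) \<le> \<eta>"
        using 1 by (simp only: \<eta>_def distrib_right)
      moreover have "0 \<le> sqrt (D * B / (Suc j - m))" using D0 B0 by simp
      ultimately show ?thesis by (simp flip: ennreal_plus add: ennreal_leI)
    qed
    ultimately show ?thesis
      using mj by (auto simp: \<kappa>_def intro: tv_le_mono)
  qed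
  interpret resizing \<kappa> n J \<eta>
  proof
    \<comment> \<open>Since \<eta> \<ge> 24 / n, extending across n / 2 missing points has a claimed
      error of at least 12.\<close>
    have "n / 2 \<le> real n - real J" unfolding J_def by linarith
    then have "24 / n * (n / 2) \<le> \<eta> * (real n - real J)" using \<eta>24 \<eta>0 n0 by (intro mult_mono) auto
    then show "1 \<le> \<eta> * (real n - real J)" using n0 by simp
  qed (use \<kappa> n0 \<eta>0 in \<open>auto simp: J_def\<close>)
  have "le_cam_dist T (density_experiment n) (poisson_experiment n) \<le> ennreal (\<eta> * sqrt n)"
    by (rule le_cam_dist_le[OF dl step])
  also have "\<eta> * sqrt n = (24 / sqrt c + sqrt (4 * D)) * sqrt B"
    using n0 by (simp add: \<eta>_def real_sqrt_divide)
  finally show ?thesis by (simp add: D_def)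
qed

theorem theorem1:
  fixes \<beta> R :: real and \<Theta> :: "nat \<Rightarrow> (real \<Rightarrow> real) set"
  assumes "\<beta> > 0" and "R > 0"
    and "\<And>n. \<Theta> n \<subseteq> flat_densities \<beta> R"
  shows "\<exists>C::real>0. \<exists>n0\<ge>1. \<forall>n\<ge>n0.
    (le_cam_dist (\<Theta> n) (density_experiment n) (poisson_experiment n))\<^sup>2
      \<le> ennreal C * (ennreal (real n powr (- (2 * \<beta> / (2 * \<beta> + 1))) * (ln (real n))\<^sup>2) *
          (SUP f\<in>\<Theta> n. \<integral>\<^sup>+x\<in>{0..1}.
             ennreal_powr (min (1 / ennreal (f x)) (ennreal (real n powr (\<beta> / (\<beta> + 1)))))
               (1 / (2 * \<beta> + 1)) \<partial>lborel))"
proof -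
  note \<beta> = assms(1)
  define M where "M = max 1 R"
  define k where "k = strict_floor \<beta>"
  define q where "q = 2 * (real k + 1)"
  \<comment> \<open>The constant of the local comparison with tolerance factor 64, raised to at
    least 1 as the comparison of values requires.\<close>
  define C where "C = max 1 ((k + 1) * q ^ k * (64 * (2 * q + 2 * sqrt (2 * q * ((k + 2) * M))) + 2 * M))"
  define c where "c = M powr (- (1 / (2 * \<beta> + 1)))"
  define D where "D = 24 / sqrt c + sqrt (4 * (16 * C\<^sup>2 + 9 * (8 * C\<^sup>2)\<^sup>2))"
  let ?l = "\<lambda>n::nat. (ln (real n))\<^sup>2 / real n"
  have c0: "0 < c" by (simp add: c_def M_def)
  have D0: "0 < D" unfolding D_def using c0 by (intro add_pos_nonneg) auto
  have l0: "?l \<longlonglongrightarrow> 0" by real_asymp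
  have "\<forall>\<^sub>F n in sequentially. ?l n < 1 / M"
    using l0 by (rule order_tendstoD) (simp add: M_def)
  moreover have "(\<lambda>n. ?l n powr (\<beta> / (\<beta> + 1))) \<longlonglongrightarrow> 0"
    using l0 \<beta> by (intro tendsto_zero_powrI[where b="\<beta> / (\<beta> + 1)"]) auto
  then have "\<forall>\<^sub>F n in sequentially. ?l n powr (\<beta> / (\<beta> + 1)) < 1 / (2 * (2 * C)\<^sup>2)"
    by (rule order_tendstoD) (simp add: C_def)
  moreover have "filterlim (\<lambda>n. real n powr (\<beta> / (\<beta> + 1))) at_top sequentially"
  proof -
    have "0 < \<beta> / (\<beta> + 1)" using \<beta> by simp
    then show ?thesis by real_asymp
  qed
  then have "\<forall>\<^sub>F n in sequentially. 8 * (k + 1) \<le> real n powr (\<beta> / (\<beta> + 1))"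
    by (auto simp: filterlim_at_top)
  moreover have "\<forall>\<^sub>F n in sequentially. 1 \<le> ln (real n)" by real_asymp
  moreover have "\<forall>\<^sub>F n in sequentially. 8 \<le> n" by (rule eventually_ge_at_top)
  ultimately have "\<forall>\<^sub>F n in sequentially. ?l n < 1 / M \<and> ?l n powr (\<beta> / (\<beta> + 1)) < 1 / (2 * (2 * C)\<^sup>2) \<and>
     8 * (k + 1) \<le> real n powr (\<beta> / (\<beta> + 1)) \<and> 1 \<le> ln (real n) \<and> 8 \<le> n"
    by eventually_elim auto
  then obtain n0 where n0: "\<And>n. n0 \<le> n \<Longrightarrow> ?l n < 1 / M \<and> ?l n powr (\<beta> / (\<beta> + 1)) < 1 / (2 * (2 * C)\<^sup>2) \<and>
     8 * (k + 1) \<le> real n powr (\<beta> / (\<beta> + 1)) \<and> 1 \<le> ln (real n) \<and> 8 \<le> n"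
    by (auto simp: eventually_sequentially)
  have main: "(le_cam_dist (\<Theta> n) (density_experiment n) (poisson_experiment n))\<^sup>2
      \<le> ennreal (D\<^sup>2) * (ennreal (real n powr (- (2 * \<beta> / (2 * \<beta> + 1))) * (ln (real n))\<^sup>2) *
          (SUP f\<in>\<Theta> n. \<integral>\<^sup>+x\<in>{0..1}.
             ennreal_powr (min (1 / ennreal (f x)) (ennreal (real n powr (\<beta> / (\<beta> + 1)))))
               (1 / (2 * \<beta> + 1)) \<partial>lborel))" (is "_ \<le> _ * (ennreal ?\<rho> * (SUP f\<in>\<Theta> n. ?I f))")
    if n: "n0 \<le> n" for n
  proof (cases "\<Theta> n = {}")
    case True
    then show ?thesis by (simp add: le_cam_dist_empty)
  next
    case False
    note N = n0[OF n]
    have n1: "0 < n" and ln1: "1 \<le> ln (real n)" and n8: "8 \<le> n" using N by auto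
    define S where "S = ennreal ?\<rho> * (SUP f\<in>\<Theta> n. ?I f)"
    have S: "S = (SUP f\<in>\<Theta> n. ennreal (mean_rate n \<beta> f))"
      unfolding S_def SUP_mult_left_ennreal
      by (intro SUP_cong refl mean_rate_eq[OF _ \<beta> n1, symmetric]) (use assms(3) in blast)
    \<comment> \<open>Finiteness of the supremum gives a real bound \<open>B\<close> for all
      integrated rates with \<open>ennreal B\<close> equal to the right-hand side, up to the
      constant.\<close>
    have "S \<le> ennreal (rate n \<beta> 0)"
      unfolding S using mean_rate_le[OF flat_unit_density[OF _ \<beta>] n1 \<beta>] assms(3)
      by (intro SUP_least ennreal_leI) blast
    then have "S < top" by (rule le_less_trans) simp
    then obtain B where B: "S = ennreal B" "0 \<le> B" by (cases S) auto
    have fB: "mean_rate n \<beta> f \<le> B" if "f \<in> \<Theta> n" for f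
    proof -
      have "ennreal (mean_rate n \<beta> f) \<le> ennreal B" unfolding B(1)[symmetric] S using that by (rule SUP_upper)
      then show ?thesis using B(2) by (simp add: ennreal_le_iff)
    qed
    have lpos: "0 < ?l n" "1 / n \<le> ?l n" using noise_pos[OF \<beta> ln1 n1] noise_ge[OF \<beta> ln1 n1] by auto
    \<comment> \<open>From l \<ge> 1 / n one gets n l^(1 / (\<beta> + 1)) \<ge> n^(\<beta> /
      (\<beta> + 1)), which exceeds any constant for large n: the smallest bandwidth still spans
      enough grid points.\<close>
    have grid: "real (8 * (strict_floor \<beta> + 1)) \<le> n * ?l n powr (1 / (\<beta> + 1))"
    proof -
      have "real n powr (\<beta> / (\<beta> + 1)) = real n powr 1 * real n powr (- (1 / (\<beta> + 1)))"
        unfolding powr_add[symmetric] using \<beta> by (intro arg_cong[where f="(powr) (real n)"]) (simp add: field_simps)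
      also have "\<dots> = n * (1 / n) powr (1 / (\<beta> + 1))"
        using n1 by (simp add: powr_minus_divide powr_divide)
      also have "\<dots> \<le> n * ?l n powr (1 / (\<beta> + 1))"
        using lpos \<beta> by (intro mult_left_mono powr_mono2) auto
      finally show ?thesis using N by (simp add: k_def)
    qed
    have "le_cam_dist (\<Theta> n) (density_experiment n) (poisson_experiment n) \<le> ennreal (D * sqrt B)"
      unfolding D_def c_def M_def
    proof (rule le_cam_dist_le_mean_rate[OF \<beta> assms(3) False n8 ln1 fB])
      show "1 \<le> C" by (simp add: C_def)
      have "0 < 2 * (2 * C)\<^sup>2" by (simp add: C_def)
      then show "(2 * C)\<^sup>2 * ?l n powr (\<beta> / (\<beta> + 1)) \<le> 1 / 2"
        using N by (simp add: pos_less_divide_eq mult.commute)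
      fix f g x v
      assume fg: "f \<in> \<Theta> n" "g \<in> \<Theta> n" and gc: "grid_close n 64 (?l n) f g" and x: "x \<in> {0..1::real}"
        and v: "v = max (f x) (g x)" "?l n powr (\<beta> / (\<beta> + 1)) \<le> v"
      have ff: "f \<in> flat_densities \<beta> R" "g \<in> flat_densities \<beta> R" using fg assms(3) by auto
      have "M * ?l n \<le> M * (1 / M)" using N by (intro mult_left_mono) (auto simp: M_def)
      moreover have "M * (1 / M) = 1" by (simp add: M_def)
      ultimately have Ml: "max 1 R * ?l n \<le> 1" by (simp only: M_def)
      have vM: "f x \<le> v" "g x \<le> v" "v \<le> max 1 R"
        using flat_densitiesD(2)[OF ff(1) \<beta> x] flat_densitiesD(2)[OF ff(2) \<beta> x] v(1) by auto
      have "\<bar>f x - g x\<bar> \<le> (k + 1) * q ^ k * (64 * (2 * q + 2 * sqrt (2 * q * ((k + 2) * M))) + 2 * M) * (v * ?l n) powr (\<beta> / (2 * \<beta> + 1))"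
        using flat_densities_close[OF \<beta> ff gc _ lpos(1) Ml grid x vM v(2)] by (simp add: k_def q_def M_def add.commute)
      also have "\<dots> \<le> C * (v * ?l n) powr (\<beta> / (2 * \<beta> + 1))"
        by (intro mult_right_mono) (auto simp: C_def)
      finally show "\<bar>f x - g x\<bar> \<le> C * (v * ?l n) powr (\<beta> / (2 * \<beta> + 1))" .
    qed
    then have "(le_cam_dist (\<Theta> n) (density_experiment n) (poisson_experiment n))\<^sup>2 \<le> (ennreal (D * sqrt B))\<^sup>2"
      by (intro power_mono) auto
    also have "\<dots> = ennreal (D\<^sup>2) * ennreal B"
      using D0 B by (simp add: ennreal_power power_mult_distrib flip: ennreal_mult)
    finally show ?thesis unfolding B(1)[symmetric] S_def .
  qed
  show ?thesis
    using D0 main by (intro exI[of _ "D\<^sup>2"] conjI exI[of _ "max 1 n0"]) auto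
qed

end
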